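(* Let $\lambda\in\mathbb R$ be fixed, and suppose that there exists $c\in(a,b)$ such that $p$ is sign-definite a.e. on $(c,b)$ (i.e. $p>0$ a.e. or $p<0$ a.e. on $(c,b)$). If $\tau-\lambda$ is non-oscillatory at $b$, then there exists a nontrivial real-valued solution $u_0$ of $(\tau-\lambda)u=0$ satisfying the following properties (i)–(iii), in which $u_1$ denotes an arbitrary real-valued solution of $(\tau-\lambda)u=0$ linearly independent of $u_0$. (i) $\displaystyle\lim_{x\uparrow b}\frac{u_0(x)}{u_1(x)}=0$. (ii) $\displaystyle\int^b\frac{dx}{|p(x)|u_1(x)^2}<\infty$ and $\displaystyle\int^b\frac{dx}{|p(x)|u_0(x)^2}=\infty$. (iii) Suppose $x_0\in(c,b)$ strictly exceeds the largest zero, if any, of $u_0$, and $u_1(x_0)\neq0$. If $u_1(x_0)/u_0(x_0)>0$, then in the case $p>0$ a.e. on $(c,b)$, $u_1$ has no zero in $(x_0,b)$ if $W(u_0,u_1)>0$ and exactly one zero in $(x_0,b)$ if $W(u_0,u_1)<0$; in the case $p<0$ a.e. on $(c,b)$, $u_1$ has no zero in $(x_0,b)$ if $W(u_0,u_1)<0$ and exactly one zero if $W(u_0,u_1)>0$. If $u_1(x_0)/u_0(x_0)<0$, then in the case $p>0$ a.e. on $(c,b)$, $u_1$ has no zero in $(x_0,b)$ if $W(u_0,u_1)<0$ and exactly one zero if $W(u_0,u_1)>0$; in the case $p<0$ a.e. on $(c,b)$, $u_1$ has no zero in $(x_0,b)$ if $W(u_0,u_1)>0$ and exactly one zero if $W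(u_0,u_1)<0$.
   Context: Setting. $(a,b)\subseteq\mathbb R$ is an open interval (possibly unbounded); $p,q,r,s$ are Lebesgue measurable and real-valued a.e. on $(a,b)$, with $p^{-1},q,r,s\in L^1_{\mathrm{loc}}((a,b);dx)$, $r>0$ and $p\neq0$ a.e. For $f\in AC_{\mathrm{loc}}((a,b))$ put $f^{[1]}=p(f'+sf)$, $\mathfrak D_\tau=\{f\in AC_{\mathrm{loc}}((a,b)) : f^{[1]}\in AC_{\mathrm{loc}}((a,b))\}$, and $\tau f=\frac1r\big(-(f^{[1]})'+sf^{[1]}+qf\big)$ for $f\in\mathfrak D_\tau$; solutions of $(\tau-\lambda)u=0$ are elements of $\mathfrak D_\tau$. The Wronskian $W(f,g)=fg^{[1]}-f^{[1]}g$ of two solutions of $(\tau-\lambda)u=0$ is constant. $\tau-\lambda$ is called oscillatory at $b$ if some (nontrivial, real-valued) solution of $(\tau-\lambda)u=0$ has infinitely many zeros accumulating at $b$; otherwise non-oscillatory at $b$. The notation $\int^b$ denotes integration over $(x,b)$ for $x<b$ sufficiently close to $b$ (in particular beyond all zeros of the function in the denominator). *)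

theory Defs
  imports "HOL-Analysis.Analysis"
begin

text \<open>
  The interval \<open>(a,b)\<close> is \<^term>\<open>einterval a b\<close> with extended real endpoints. Functions on
  \<open>(a,b)\<close> are total functions of which only the restriction to \<open>(a,b)\<close> matters.
\<close>

definition locally_integrable_on :: "(real \<Rightarrow> real) \<Rightarrow> real set \<Rightarrow> bool"
  where "locally_integrable_on f S \<longleftrightarrow>
    (\<forall>K. compact K \<and> K \<subseteq> S \<longrightarrow> f absolutely_integrable_on K)"

definition abs_continuous_on_interval :: "real \<Rightarrow> real \<Rightarrow> (real \<Rightarrow> real) \<Rightarrow> bool"
  where "abs_continuous_on_interval \<alpha> \<beta> f \<longleftrightarrow>
    (\<forall>\<epsilon>>0. \<exists>\<delta>>0. \<forall>D :: (real \<times> real) set.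
       finite D \<and> (\<forall>(x, y)\<in>D. \<alpha> \<le> x \<and> x \<le> y \<and> y \<le> \<beta>) \<and>
       disjoint_family_on (\<lambda>(x, y). {x<..<y}) D \<and>
       (\<Sum>(x, y)\<in>D. y - x) < \<delta> \<longrightarrow>
       (\<Sum>(x, y)\<in>D. \<bar>f y - f x\<bar>) < \<epsilon>)"

definition AC_loc :: "ereal \<Rightarrow> ereal \<Rightarrow> (real \<Rightarrow> real) set"
  where "AC_loc a b =
    {f. \<forall>\<alpha> \<beta>. {\<alpha>..\<beta>} \<subseteq> einterval a b \<longrightarrow> abs_continuous_on_interval \<alpha> \<beta> f}"

text \<open>
  The expression \<open>p (f' + s f)\<close> is determined only almost everywhere; that \<open>f\<^sup>[\<^sup>1\<^sup>]\<close> lies in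
  \<open>AC\<^sub>l\<^sub>o\<^sub>c\<close> means that it agrees almost everywhere with some \<open>g\<close> in \<open>AC\<^sub>l\<^sub>o\<^sub>c\<close>. On \<open>(a,b)\<close> this \<open>g\<close> is
  unique by continuity, and it is what \<open>f\<^sup>[\<^sup>1\<^sup>]\<close> denotes at individual points.
\<close>

definition is_quasi_deriv ::
    "ereal \<Rightarrow> ereal \<Rightarrow> (real \<Rightarrow> real) \<Rightarrow> (real \<Rightarrow> real) \<Rightarrow> (real \<Rightarrow> real) \<Rightarrow> (real \<Rightarrow> real) \<Rightarrow> bool"
  where "is_quasi_deriv a b p s f g \<longleftrightarrow>
    g \<in> AC_loc a b \<and>
    (AE x\<in>einterval a b in lebesgue. g x = p x * (deriv f x + s x * f x))"

definition quasi_deriv ::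
    "ereal \<Rightarrow> ereal \<Rightarrow> (real \<Rightarrow> real) \<Rightarrow> (real \<Rightarrow> real) \<Rightarrow> (real \<Rightarrow> real) \<Rightarrow> real \<Rightarrow> real"
  where "quasi_deriv a b p s f = (SOME g. is_quasi_deriv a b p s f g)"

definition tau_domain ::
    "ereal \<Rightarrow> ereal \<Rightarrow> (real \<Rightarrow> real) \<Rightarrow> (real \<Rightarrow> real) \<Rightarrow> (real \<Rightarrow> real) set"
  where "tau_domain a b p s = {f \<in> AC_loc a b. \<exists>g. is_quasi_deriv a b p s f g}"

definition tau ::
    "ereal \<Rightarrow> ereal \<Rightarrow> (real \<Rightarrow> real) \<Rightarrow> (real \<Rightarrow> real) \<Rightarrow> (real \<Rightarrow> real) \<Rightarrow> (real \<Rightarrow> real)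
      \<Rightarrow> (real \<Rightarrow> real) \<Rightarrow> real \<Rightarrow> real"
  where "tau a b p q r s f x =
    1 / r x * (- deriv (quasi_deriv a b p s f) x + s x * quasi_deriv a b p s f x + q x * f x)"

definition is_solution ::
    "ereal \<Rightarrow> ereal \<Rightarrow> (real \<Rightarrow> real) \<Rightarrow> (real \<Rightarrow> real) \<Rightarrow> (real \<Rightarrow> real) \<Rightarrow> (real \<Rightarrow> real)
      \<Rightarrow> real \<Rightarrow> (real \<Rightarrow> real) \<Rightarrow> bool"
  where "is_solution a b p q r s lam u \<longleftrightarrow>
    u \<in> tau_domain a b p s \<and>
    (AE x\<in>einterval a b in lebesgue. tau a b p q r s u x - lam * u x = 0)"

definition nontrivial_on :: "real set \<Rightarrow> (real \<Rightarrow> real) \<Rightarrow> bool"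
  where "nontrivial_on S u \<longleftrightarrow> (\<exists>x\<in>S. u x \<noteq> 0)"

definition lin_indep_on :: "real set \<Rightarrow> (real \<Rightarrow> real) \<Rightarrow> (real \<Rightarrow> real) \<Rightarrow> bool"
  where "lin_indep_on S u v \<longleftrightarrow>
    (\<forall>\<alpha> \<beta>. (\<forall>x\<in>S. \<alpha> * u x + \<beta> * v x = 0) \<longrightarrow> \<alpha> = 0 \<and> \<beta> = 0)"

text \<open>For two solutions of the same equation this is constant in the last argument on \<open>(a,b)\<close>.\<close>

definition wronskian ::
    "ereal \<Rightarrow> ereal \<Rightarrow> (real \<Rightarrow> real) \<Rightarrow> (real \<Rightarrow> real) \<Rightarrow> (real \<Rightarrow> real) \<Rightarrow> (real \<Rightarrow> real)
      \<Rightarrow> real \<Rightarrow> real"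
  where "wronskian a b p s f g x =
    f x * quasi_deriv a b p s g x - quasi_deriv a b p s f x * g x"

definition oscillatory_at_right_end ::
    "ereal \<Rightarrow> ereal \<Rightarrow> (real \<Rightarrow> real) \<Rightarrow> (real \<Rightarrow> real) \<Rightarrow> (real \<Rightarrow> real) \<Rightarrow> (real \<Rightarrow> real)
      \<Rightarrow> real \<Rightarrow> bool"
  where "oscillatory_at_right_end a b p q r s lam \<longleftrightarrow>
    (\<exists>u. is_solution a b p q r s lam u \<and> nontrivial_on (einterval a b) u \<and>
         (\<forall>d\<in>einterval a b. infinite {x \<in> einterval d b. u x = 0}))"

definition no_zero_in :: "real set \<Rightarrow> (real \<Rightarrow> real) \<Rightarrow> bool"
  where "no_zero_in S u \<longleftrightarrow> (\<forall>x\<in>S. u x \<noteq> 0)"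

definition exactly_one_zero_in :: "real set \<Rightarrow> (real \<Rightarrow> real) \<Rightarrow> bool"
  where "exactly_one_zero_in S u \<longleftrightarrow> (\<exists>!x. x \<in> S \<and> u x = 0)"

text \<open>
  \<open>int_to_end b p u x\<close> is the integral of \<open>1 / (|p| u\<^sup>2)\<close> over \<open>(x,b)\<close>. The notation with only
  the upper limit \<open>b\<close> refers to all \<open>x\<close> sufficiently close to \<open>b\<close>, beyond all zeros of \<open>u\<close>.
\<close>

definition int_to_end :: "ereal \<Rightarrow> (real \<Rightarrow> real) \<Rightarrow> (real \<Rightarrow> real) \<Rightarrow> real \<Rightarrow> ennreal"
  where "int_to_end b p u x =
    (\<integral>\<^sup>+t\<in>einterval x b. ennreal (1 / (\<bar>p t\<bar> * (u t)\<^sup>2)) \<partial>lebesgue)"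

definition int_near_end_finite ::
    "ereal \<Rightarrow> ereal \<Rightarrow> (real \<Rightarrow> real) \<Rightarrow> (real \<Rightarrow> real) \<Rightarrow> bool"
  where "int_near_end_finite a b p u \<longleftrightarrow>
    (\<exists>d\<in>einterval a b. no_zero_in (einterval d b) u \<and>
       (\<forall>x\<in>einterval d b. int_to_end b p u x < \<infinity>))"

definition int_near_end_infinite ::
    "ereal \<Rightarrow> ereal \<Rightarrow> (real \<Rightarrow> real) \<Rightarrow> (real \<Rightarrow> real) \<Rightarrow> bool"
  where "int_near_end_infinite a b p u \<longleftrightarrow>
    (\<exists>d\<in>einterval a b. no_zero_in (einterval d b) u \<and>
       (\<forall>x\<in>einterval d b. int_to_end b p u x = \<infinity>))"

end

theory Submission
  imports Defs
begin

text \<open>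
  Let \<open>\<sigma>\<close> be the sign of \<open>p\<close> near \<open>b\<close>. If \<open>u\<close> and \<open>w\<close> are solutions with Wronskian \<open>W = W(w,u) \<noteq> 0\<close> and \<open>w\<close> has no
  zeros near \<open>b\<close>, then \<open>(\<sigma> / W) u / w\<close> has derivative \<open>1 / (\<bar>p\<bar> w\<^sup>2)\<close> almost everywhere, hence is strictly
  increasing and converges to a limit in \<open>(-\<infinity>,\<infinity>]\<close>. If the limit \<open>L\<close> of \<open>u / w\<close> is finite, \<open>u\<^sub>0 = u - L w\<close> is
  principal, otherwise \<open>u\<^sub>0 = w\<close> is. Any independent \<open>u\<^sub>1\<close> dominates \<open>u\<^sub>0\<close>; the integrals of
  \<open>1 / (\<bar>p\<bar> u\<^sub>j\<^sup>2)\<close> are increments of quotients of solutions, and the zeros of \<open>u\<^sub>1\<close> beyond \<open>x\<^sub>0\<close> are those of a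
  strictly monotone function tending to infinity in absolute value.

  Solutions are only locally absolutely continuous, so this needs Lebesgue's theory: such functions are
  differentiable almost everywhere and are the integrals of their derivatives. Existence of two
  independent solutions comes from the Picard series of the first-order system for \<open>u\<close> and \<open>u\<^sup>[\<^sup>1\<^sup>]\<close>,
  dominated termwise by \<open>K \<bar>H\<bar>\<^sup>n / n!\<close>, where \<open>H\<close> is a primitive of the sum of the moduli of the coefficients.
\<close>

section \<open>Almost everywhere differentiability\<close>

text \<open>The obstacle is that every derivative exists only almost everywhere, so monotonicity
  cannot be read off from the sign of a derivative directly and each identity has to pass through an
  integral. The differentiation theory rests on one device: a Vitali cover by bad intervals, where a
  set is negligible as soon as disjoint bad intervals have small total length. That total is
  controlled by the variation of the function in some applications and by Henstock's lemma in
  another.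

  Finite families of intervals are kept as packings: degenerate pairs are excluded, so that
  disjointness of open intervals amounts to comparing endpoints, and neighbours may touch, so that a
  packing can be completed to a partition with telescoping sums.

  All linear relations between solutions are read off from constant Wronskians: with k = W(u0,w),
  every solution u1 satisfies k u1 = W(u1,w) u0 + W(u0,u1) w.\<close>

definition interval_packing :: "real \<Rightarrow> real \<Rightarrow> (real \<times> real) set \<Rightarrow> bool"
  where "interval_packing \<alpha> \<beta> D \<longleftrightarrow> finite D \<and> (\<forall>x y. (x, y) \<in> D \<longrightarrow> \<alpha> \<le> x \<and> x < y \<and> y \<le> \<beta>) \<and>
    (\<forall>x y x' y'. (x, y) \<in> D \<and> (x', y') \<in> D \<and> (x, y) \<noteq> (x', y') \<longrightarrow> y \<le> x' \<or> y' \<le> x)"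

lemma interval_packingI:
  assumes "finite D" "\<And>x y. (x, y) \<in> D \<Longrightarrow> \<alpha> \<le> x \<and> x < y \<and> y \<le> \<beta>"
    and "\<And>x y x' y'. \<lbrakk>(x, y) \<in> D; (x', y') \<in> D; (x, y) \<noteq> (x', y')\<rbrakk> \<Longrightarrow> y \<le> x' \<or> y' \<le> x"
  shows "interval_packing \<alpha> \<beta> D"
  unfolding interval_packing_def using assms by blast

lemma interval_packingD:
  assumes "interval_packing \<alpha> \<beta> D"
  shows "finite D" "(x, y) \<in> D \<Longrightarrow> \<alpha> \<le> x" "(x, y) \<in> D \<Longrightarrow> x < y" "(x, y) \<in> D \<Longrightarrow> y \<le> \<beta>"
    "\<lbrakk>(x, y) \<in> D; (x', y') \<in> D; (x, y) \<noteq> (x', y')\<rbrakk> \<Longrightarrow> y \<le> x' \<or> y' \<le> x"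
  using assms unfolding interval_packing_def by blast+

lemma open_intervals_disjoint_iff:
  fixes x y x' y' :: real
  assumes "x < y" "x' < y'"
  shows "{x<..<y} \<inter> {x'<..<y'} = {} \<longleftrightarrow> y \<le> x' \<or> y' \<le> x"
  unfolding Int_greaterThanLessThan greaterThanLessThan_empty_iff using assms by linarith

text \<open>By Vitali, countably many pairwise disjoint intervals of \<open>K\<close> cover
  \<open>E - N\<close> up to a negligible set. Finite subfamilies are packings, so their unions, and
  hence the countable union, have measure at most \<open>e\<close>; thus \<open>E\<close> has outer
  measure at most \<open>e\<close>. The set \<open>N\<close> leaves room for exceptional points such
  as the division points of a partition.\<close>

lemma negligible_Vitali_packing:
  fixes E :: "real set"
  assumes "\<And>e. e > 0 \<Longrightarrow> \<exists>K N. K \<subseteq> {(u, v). \<alpha> \<le> u \<and> u < v \<and> v \<le> \<beta>} \<and> negligible N \<and>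
     (\<forall>x\<in>E - N. \<forall>d>0. \<exists>u v. (u, v) \<in> K \<and> u \<le> x \<and> x \<le> v \<and> v - u < d) \<and>
     (\<forall>D\<subseteq>K. interval_packing \<alpha> \<beta> D \<longrightarrow> (\<Sum>(u, v)\<in>D. v - u) \<le> e)"
  shows "negligible E"
  unfolding negligible_outer_le
proof (intro allI impI)
  fix e :: real assume "e > 0"
  from assms[OF this] obtain K N where K: "K \<subseteq> {(u, v). \<alpha> \<le> u \<and> u < v \<and> v \<le> \<beta>}"
    and N0: "negligible N" and fine: "\<forall>x\<in>E - N. \<forall>d>0. \<exists>u v. (u, v) \<in> K \<and> u \<le> x \<and> x \<le> v \<and> v - u < d"
    and small: "\<forall>D\<subseteq>K. interval_packing \<alpha> \<beta> D \<longrightarrow> (\<Sum>(u, v)\<in>D. v - u) \<le> e"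
    by (elim exE conjE)
  \<comment> \<open>Midpoints and half-lengths present the intervals as closed balls.\<close>
  let ?a = "\<lambda>i :: real \<times> real. (fst i + snd i) / 2" and ?r = "\<lambda>i :: real \<times> real. (snd i - fst i) / 2"
  have cb: "cball (?a i) (?r i) = {fst i..snd i}" for i
    by (auto simp: cball_eq_atLeastAtMost field_simps)
  obtain C where C: "countable C" "C \<subseteq> K"
    and disj: "pairwise (\<lambda>i j. disjnt (cball (?a i) (?r i)) (cball (?a j) (?r j))) C"
    and neg: "negligible (E - N - (\<Union>i\<in>C. cball (?a i) (?r i)))"
  proof (rule Vitali_covering_theorem_cballs[of K ?r "E - N" ?a])
    show "0 < ?r i" if "i \<in> K" for i using K that by auto
    show "\<exists>i. i \<in> K \<and> x \<in> cball (?a i) (?r i) \<and> ?r i < d" if x: "x \<in> E - N" and d: "0 < d" for x d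
    proof -
      obtain u v where uv: "(u, v) \<in> K" "u \<le> x" "x \<le> v" "v - u < d" using fine x d by blast
      then have "?r (u, v) < d" using d by auto
      then show ?thesis unfolding cb using uv by (intro exI[of _ "(u, v)"]) auto
    qed
  qed auto
  have disj': "{fst i..snd i} \<inter> {fst j..snd j} = {}" if "i \<in> C" "j \<in> C" "i \<noteq> j" for i j
    using disj that unfolding pairwise_def cb disjnt_def by blast
  \<comment> \<open>A bound uniform in finite subfamilies passes to the countable union.\<close>
  have *: "measure lebesgue (\<Union>i\<in>I. {fst i..snd i}) \<le> e" if I: "I \<subseteq> C" "finite I" for I
  proof -
    have pack: "interval_packing \<alpha> \<beta> I"
    proof (rule interval_packingI)
      show "\<alpha> \<le> x \<and> x < y \<and> y \<le> \<beta>" if "(x, y) \<in> I" for x y using that I C K by auto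
      show "y \<le> x' \<or> y' \<le> x" if "(x, y) \<in> I" "(x', y') \<in> I" "(x, y) \<noteq> (x', y')" for x y x' y'
      proof -
        have "{x..y} \<inter> {x'..y'} = {}"
          using disj'[of "(x, y)" "(x', y')"] that I by auto
        moreover have "x < y" "x' < y'" using that I C K by auto
        ultimately show ?thesis unfolding Int_atLeastAtMost atLeastatMost_empty_iff by linarith
      qed
    qed fact
    have "measure lebesgue (\<Union>i\<in>I. {fst i..snd i}) \<le> (\<Sum>i\<in>I. measure lebesgue {fst i..snd i})"
      using I by (intro measure_UNION_le) auto
    also have "\<dots> = (\<Sum>(u, v)\<in>I. v - u)"
      using interval_packingD(3)[OF pack] by (intro sum.cong) (force simp: split_def)+
    also have "\<dots> \<le> e" using small pack I C by auto
    finally show ?thesis .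
  qed
  let ?U = "\<Union>i\<in>C. {fst i..snd i}"
  have U: "?U \<in> lmeasurable" "measure lebesgue ?U \<le> e"
    using fmeasurable_UN_bound[OF C(1) _ *] measure_UN_bound[OF C(1) _ *] by auto
  have "negligible ((E - N - ?U) \<union> N)" using neg N0 unfolding cb by (rule negligible_Un)
  then have N: "negligible (E - ?U)" by (rule negligible_subset) blast
  show "\<exists>T. E \<subseteq> T \<and> T \<in> lmeasurable \<and> measure lebesgue T \<le> e"
  proof (intro exI conjI)
    show "E \<subseteq> ?U \<union> (E - ?U)" by blast
    show "?U \<union> (E - ?U) \<in> lmeasurable"
      by (intro fmeasurable.Un U(1) negligible_imp_measurable N)
    have "measure lebesgue (?U \<union> (E - ?U)) \<le> measure lebesgue ?U + measure lebesgue (E - ?U)"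
      using U N by (intro measure_Un_le) (auto simp: fmeasurableD negligible_imp_sets)
    also have "measure lebesgue (E - ?U) = 0" using N by (rule negligible_imp_measure0)
    finally show "measure lebesgue (?U \<union> (E - ?U)) \<le> e" using U by simp
  qed
qed

text \<open>The gaps between the intervals are filled in, which turns the packing into a partition
  of \<open>{c..d}\<close>; increments then telescope. Induction on the number of intervals removes
  the rightmost one. The covering claim is guarded by \<open>c < d\<close> because a packing of a
  degenerate interval is empty.\<close>

lemma interval_packing_complete:
  assumes "interval_packing c d D" "c \<le> d"
  obtains D' where "interval_packing c d (D \<union> D')" "D \<inter> D' = {}"
    "\<And>x. x \<in> {c..d} \<Longrightarrow> c < d \<Longrightarrow> \<exists>(u, v)\<in>D \<union> D'. u \<le> x \<and> x \<le> v"
    "\<And>f :: real \<Rightarrow> real. (\<Sum>(u, v)\<in>D \<union> D'. f v - f u) = f d - f c"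
proof -
  have fin: "finite D" using assms interval_packing_def by blast
  have "\<exists>D'. interval_packing c d (D \<union> D') \<and> D \<inter> D' = {} \<and>
    (\<forall>x\<in>{c..d}. c < d \<longrightarrow> (\<exists>(u, v)\<in>D \<union> D'. u \<le> x \<and> x \<le> v)) \<and>
    (\<forall>f :: real \<Rightarrow> real. (\<Sum>(u, v)\<in>D \<union> D'. f v - f u) = f d - f c)"
    using assms fin
  proof (induction "card D" arbitrary: D d)
    case 0
    then have [simp]: "D = {}" by auto
    show ?case
    proof (cases "c = d")
      case True
      then show ?thesis using 0 by (intro exI[of _ "{}"]) auto
    next
      case False
      then have "c < d" using 0 by simp
      then show ?thesis by (intro exI[of _ "{(c, d)}"]) (auto simp: interval_packing_def disjoint_family_on_def)
    qed
  next
    case (Suc n)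
    note pack = Suc.prems(1)
    have ne: "snd ` D \<noteq> {}" using Suc by auto
    define v where "v = Max (snd ` D)"
    have "v \<in> snd ` D" unfolding v_def using ne Suc by (intro Max_in) auto
    then obtain u where uv: "(u, v) \<in> D" by auto
    have maxv: "y \<le> v" if "(x, y) \<in> D" for x y
      unfolding v_def using that Suc by (intro Max_ge) (auto intro: rev_image_eqI)
    have uv': "c \<le> u" "u < v" "v \<le> d" using interval_packingD[OF pack] uv by auto
    define D0 where "D0 = D - {(u, v)}"
    have D: "D = insert (u, v) D0" "(u, v) \<notin> D0" using uv D0_def by auto
    have left: "y \<le> u" if "(x, y) \<in> D0" for x y
    proof -
      have xy: "(x, y) \<in> D" "(x, y) \<noteq> (u, v)" using that D0_def by auto
      then have "y \<le> u \<or> v \<le> x" using interval_packingD(5)[OF pack _ uv] by blast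
      moreover have "x < y" "y \<le> v" using interval_packingD(3)[OF pack] maxv xy by auto
      ultimately show ?thesis by auto
    qed
    \<comment> \<open>Everything except the rightmost interval lies to the left of \<open>u\<close>,
      so the induction hypothesis applies on \<open>{c..u}\<close>.\<close>
    have p0: "interval_packing c u D0"
      using interval_packingD[OF pack] left D0_def
      by (intro interval_packingI) (blast, fastforce, blast)
    have card0: "n = card D0" using Suc.hyps(2) Suc.prems(3) uv by (simp add: D0_def)
    have fin0: "finite D0" using Suc.prems(3) D0_def by simp
    have cu: "c \<le> u" using uv' by simp
    obtain D0' where D0': "interval_packing c u (D0 \<union> D0')" "D0 \<inter> D0' = {}"
      "\<forall>x\<in>{c..u}. c < u \<longrightarrow> (\<exists>(u, v)\<in>D0 \<union> D0'. u \<le> x \<and> x \<le> v)"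
      "\<And>f :: real \<Rightarrow> real. (\<Sum>(u, v)\<in>D0 \<union> D0'. f v - f u) = f u - f c"
      using Suc.hyps(1)[OF card0 p0 cu fin0] by blast
    \<comment> \<open>\<open>G\<close> is the gap to the right of the last interval, absent when
      that interval already ends at \<open>d\<close>.\<close>
    define G where "G = (if v < d then {(v, d)} else {})"
    have G: "G = {} \<and> v = d \<or> G = {(v, d)} \<and> v < d" using uv' G_def by auto
    note b0 = interval_packingD[OF D0'(1)]
    have eq: "D \<union> (D0' \<union> G) = insert (u, v) G \<union> (D0 \<union> D0')" using D by auto
    have low: "c \<le> x \<and> x < y \<and> y \<le> u" if "(x, y) \<in> D0 \<union> D0'" for x y
      using b0(2,3,4)[OF that] by auto
    show ?case
    proof (intro exI[of _ "D0' \<union> G"] conjI)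
      show "interval_packing c d (D \<union> (D0' \<union> G))"
        unfolding eq
      proof (rule interval_packingI)
        show "finite (insert (u, v) G \<union> (D0 \<union> D0'))" using b0(1) G by auto
        show "c \<le> x \<and> x < y \<and> y \<le> d" if "(x, y) \<in> insert (u, v) G \<union> (D0 \<union> D0')" for x y
          using that G uv' low[of x y] by auto
        have A: "y \<le> x' \<or> y' \<le> x"
          if "(x, y) \<in> insert (u, v) G" "(x', y') \<in> insert (u, v) G" "(x, y) \<noteq> (x', y')" for x y x' y'
          using that G uv' by auto
        have B: "y \<le> x' \<or> y' \<le> x"
          if "(x, y) \<in> insert (u, v) G" "(x', y') \<in> D0 \<union> D0'" for x y x' y'
          using that G uv' low[of x' y'] by auto
        show "y \<le> x' \<or> y' \<le> x"
          if "(x, y) \<in> insert (u, v) G \<union> (D0 \<union> D0')" "(x', y') \<in> insert (u, v) G \<union> (D0 \<union> D0')"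
            "(x, y) \<noteq> (x', y')" for x y x' y'
          using that A[of x y x' y'] B[of x y x' y'] B[of x' y' x y] b0(5)[of x y x' y'] by blast
      qed
      show "D \<inter> (D0' \<union> G) = {}"
      proof -
        have "(u, v) \<notin> D0'" using low[of u v] uv' by auto
        moreover have "D \<inter> G = {}" using G maxv[of v d] by auto
        moreover have "(v, d) \<notin> D0" if "v < d" using maxv[of v d] that D0_def by auto
        ultimately show ?thesis using D D0'(2) by blast
      qed
      show "\<forall>x\<in>{c..d}. c < d \<longrightarrow> (\<exists>(u, v)\<in>D \<union> (D0' \<union> G). u \<le> x \<and> x \<le> v)"
      proof (intro ballI impI)
        fix x assume x: "x \<in> {c..d}"
        consider "x \<in> {u..v}" | "v < x" | "x < u" by force
        then show "\<exists>(u, v)\<in>D \<union> (D0' \<union> G). u \<le> x \<and> x \<le> v"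
        proof cases
          case 1 then show ?thesis using uv by (intro bexI[of _ "(u, v)"]) auto
        next
          case 2 then show ?thesis using G x by (intro bexI[of _ "(v, d)"]) auto
        next
          case 3 then show ?thesis using D0'(3)[rule_format, of x] x unfolding eq by auto
        qed
      qed
      show "\<forall>f :: real \<Rightarrow> real. (\<Sum>(u, v)\<in>D \<union> (D0' \<union> G). f v - f u) = f d - f c"
      proof
        fix f :: "real \<Rightarrow> real"
        have dis: "insert (u, v) G \<inter> (D0 \<union> D0') = {}"
          using G low[of u v] low[of v d] uv' by auto
        have "(\<Sum>(u, v)\<in>D \<union> (D0' \<union> G). f v - f u)
            = (\<Sum>(u, v)\<in>insert (u, v) G. f v - f u) + (\<Sum>(u, v)\<in>D0 \<union> D0'. f v - f u)"
          unfolding eq using b0(1) G dis by (intro sum.union_disjoint) auto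
        also have "(\<Sum>(u, v)\<in>insert (u, v) G. f v - f u) = f d - f u"
          using G uv' by auto
        finally show "(\<Sum>(u, v)\<in>D \<union> (D0' \<union> G). f v - f u) = f d - f c" using D0'(4) by simp
      qed
    qed
  qed
  then show ?thesis using that by blast
qed

text \<open>Telescoping the identity function over the completed partition gives exactly
  \<open>d - c\<close>, and the added intervals have positive length.\<close>

lemma interval_packing_length_le:
  assumes "interval_packing c d D" "c \<le> d"
  shows "(\<Sum>(u, v)\<in>D. v - u) \<le> d - c"
proof -
  obtain D' where D': "interval_packing c d (D \<union> D')" "D \<inter> D' = {}"
    "\<And>f :: real \<Rightarrow> real. (\<Sum>(u, v)\<in>D \<union> D'. f v - f u) = f d - f c"
    using interval_packing_complete[OF assms] by metis
  have "(\<Sum>(u, v)\<in>D. v - u) \<le> (\<Sum>(u, v)\<in>D \<union> D'. v - u)"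
    using interval_packingD(1,3)[OF D'(1)] by (intro sum_mono2) force+
  then show ?thesis using D'(3)[of "\<lambda>x. x"] by simp
qed

text \<open>Distinct cells of \<open>P\<close> are ordered and each \<open>G I\<close> stays inside
  its cell, so packings of the cells combine to a packing and sums over it regroup by cell. This
  lets the variation bound be applied after a cell-by-cell refinement.\<close>

lemma interval_packing_UN:
  assumes P: "interval_packing \<alpha> \<beta> P" and G: "\<And>c d. (c, d) \<in> P \<Longrightarrow> interval_packing c d (G (c, d))"
  shows "interval_packing \<alpha> \<beta> (\<Union>I\<in>P. G I)"
    and "(\<Sum>i\<in>(\<Union>I\<in>P. G I). h i) = (\<Sum>I\<in>P. \<Sum>i\<in>G I. h i)"
proof -
  note p = interval_packingD[OF P]
  have sep: "y \<le> x' \<or> y' \<le> x" if "I \<in> P" "I' \<in> P" "I \<noteq> I'" "(x, y) \<in> G I" "(x', y') \<in> G I'" for I I' x y x' y'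
  proof -
    obtain c d c' d' where I: "I = (c, d)" "I' = (c', d')" by (cases I; cases I')
    have "d \<le> c' \<or> d' \<le> c" using p(5) that I by blast
    moreover have "c \<le> x" "y \<le> d" "c' \<le> x'" "y' \<le> d'"
      using interval_packingD[OF G] that I by blast+
    ultimately show ?thesis by linarith
  qed
  show "interval_packing \<alpha> \<beta> (\<Union>I\<in>P. G I)"
  proof (rule interval_packingI)
    show "finite (\<Union>I\<in>P. G I)" using p(1) G interval_packingD(1) by force
    show "\<alpha> \<le> x \<and> x < y \<and> y \<le> \<beta>" if xy: "(x, y) \<in> (\<Union>I\<in>P. G I)" for x y
    proof -
      obtain I where "I \<in> P" "(x, y) \<in> G I" using xy by blast
      then obtain c d where cd: "(c, d) \<in> P" "(x, y) \<in> G (c, d)" by (cases I) auto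
      then show ?thesis using p(2)[OF cd(1)] p(4)[OF cd(1)] interval_packingD(2-4)[OF G[OF cd(1)] cd(2)] by linarith
    qed
    show "y \<le> x' \<or> y' \<le> x" if xy: "(x, y) \<in> (\<Union>I\<in>P. G I)" "(x', y') \<in> (\<Union>I\<in>P. G I)" "(x, y) \<noteq> (x', y')"
      for x y x' y'
    proof -
      obtain I I' where I: "I \<in> P" "I' \<in> P" "(x, y) \<in> G I" "(x', y') \<in> G I'" using xy by blast
      show ?thesis
      proof (cases "I = I'")
        case True
        then show ?thesis using interval_packingD(5)[OF G[of "fst I" "snd I"]] I xy(3) by auto
      next
        case False then show ?thesis using sep I by blast
      qed
    qed
  qed
  show "(\<Sum>i\<in>(\<Union>I\<in>P. G I). h i) = (\<Sum>I\<in>P. \<Sum>i\<in>G I. h i)"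
  proof (rule sum.UNION_disjoint)
    show "finite P" by (rule p)
    show "\<forall>i\<in>P. finite (G i)" using G interval_packingD(1) by fastforce
    show "\<forall>i\<in>P. \<forall>j\<in>P. i \<noteq> j \<longrightarrow> G i \<inter> G j = {}"
    proof (intro ballI impI equals0I)
      fix I J z assume *: "I \<in> P" "J \<in> P" "I \<noteq> J" "z \<in> G I \<inter> G J"
      obtain x y where z: "z = (x, y)" by (cases z)
      have "y \<le> x" using sep[of I J x y x y] * z by auto
      moreover have "x < y" using interval_packingD(3)[OF G[of "fst I" "snd I"]] * z by auto
      ultimately show False by simp
    qed
  qed
qed

text \<open>
  Almost everywhere differentiability follows Botsko: if both steep ascents and steep descents occur
  near the points of a non-negligible set, then each interval of a nearly optimal partition can be
  refined by intervals on which the function moves in the opposite direction, which would increase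
  the variation beyond its supremum.
\<close>

lemma negligible_opposite_slopes_aux:
  fixes f :: "real \<Rightarrow> real"
  assumes bv: "\<And>D. interval_packing \<alpha> \<beta> D \<Longrightarrow> (\<Sum>(u, v)\<in>D. \<bar>f v - f u\<bar>) \<le> B"
    and k: "k > 0" and ab: "\<alpha> < \<beta>"
  shows "negligible {x\<in>{\<alpha><..<\<beta>}. \<forall>e>0.
     (\<exists>u v. \<alpha> \<le> u \<and> u \<le> x \<and> x \<le> v \<and> v \<le> \<beta> \<and> u < v \<and> v - u < e \<and> k * (v - u) \<le> f v - f u) \<and>
     (\<exists>u v. \<alpha> \<le> u \<and> u \<le> x \<and> x \<le> v \<and> v \<le> \<beta> \<and> u < v \<and> v - u < e \<and> f v - f u \<le> - k * (v - u))}"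
    (is "negligible ?E")
proof (rule negligible_Vitali_packing[of \<alpha> \<beta>])
  fix e :: real assume e: "e > 0"
  define S where "S = {(\<Sum>(u, v)\<in>D. \<bar>f v - f u\<bar>) |D. interval_packing \<alpha> \<beta> D}"
  have "interval_packing \<alpha> \<beta> {}" by (simp add: interval_packing_def)
  then have Sne: "S \<noteq> {}" unfolding S_def by blast
  have Sb: "bdd_above S" unfolding S_def using bv by (intro bdd_aboveI) blast
  \<comment> \<open>The defect \<open>2 * k * e\<close> is tuned to the final count: each unit
    length of movement against the direction of its cell raises the variation by at least
    \<open>2 * k\<close>, and the total gain cannot exceed the defect.\<close>
  have "Sup S - 2 * k * e < Sup S" using e k by simp
  then obtain s where "s \<in> S" "Sup S - 2 * k * e < s" using Sne less_cSupE by blast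
  then obtain P0 where P0: "interval_packing \<alpha> \<beta> P0" "Sup S - 2 * k * e < (\<Sum>(u, v)\<in>P0. \<bar>f v - f u\<bar>)"
    unfolding S_def by auto
  obtain P0' where P0': "interval_packing \<alpha> \<beta> (P0 \<union> P0')" "\<And>x. x \<in> {\<alpha>..\<beta>} \<Longrightarrow> \<alpha> < \<beta> \<Longrightarrow> \<exists>(u, v)\<in>P0 \<union> P0'. u \<le> x \<and> x \<le> v"
    using interval_packing_complete[OF P0(1)] ab by (metis less_imp_le)
  define P where "P = P0 \<union> P0'"
  have P: "interval_packing \<alpha> \<beta> P" unfolding P_def by (rule P0')
  note p = interval_packingD[OF P]
  have "(\<Sum>(u, v)\<in>P0. \<bar>f v - f u\<bar>) \<le> (\<Sum>(u, v)\<in>P. \<bar>f v - f u\<bar>)"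
    unfolding P_def using interval_packingD(1)[OF P0'(1)] by (intro sum_mono2) auto
  then have Pgt: "Sup S - 2 * k * e < (\<Sum>(u, v)\<in>P. \<bar>f v - f u\<bar>)" using P0 by simp
  \<comment> \<open>\<open>sg\<close> records whether \<open>f\<close> rises or falls over a cell of
    the partition; multiplied by it, the increment over the cell becomes its modulus.\<close>
  define sg where "sg = (\<lambda>(c, d). if f c \<le> f d then 1 else - 1 :: real)"
  have sg: "\<bar>sg I\<bar> = 1" for I unfolding sg_def by (cases I) simp
  have sg': "sg (c, d) * (f d - f c) = \<bar>f d - f c\<bar>" for c d unfolding sg_def by simp
  define K where "K = {(u, v). u < v \<and> (\<exists>c d. (c, d) \<in> P \<and> c \<le> u \<and> v \<le> d \<and> sg (c, d) * (f v - f u) \<le> - k * (v - u))}"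
  \<comment> \<open>Away from the division points every point of \<open>(\<alpha>,\<beta>)\<close>
    lies in the interior of a cell, so sufficiently short intervals around it stay in that
    cell.\<close>
  define N where "N = fst ` P \<union> snd ` P"
  show "\<exists>K N. K \<subseteq> {(u, v). \<alpha> \<le> u \<and> u < v \<and> v \<le> \<beta>} \<and> negligible N \<and>
     (\<forall>x\<in>?E - N. \<forall>d>0. \<exists>u v. (u, v) \<in> K \<and> u \<le> x \<and> x \<le> v \<and> v - u < d) \<and>
     (\<forall>D\<subseteq>K. interval_packing \<alpha> \<beta> D \<longrightarrow> (\<Sum>(u, v)\<in>D. v - u) \<le> e)"
  proof (intro exI conjI)
    show "K \<subseteq> {(u, v). \<alpha> \<le> u \<and> u < v \<and> v \<le> \<beta>}"
      unfolding K_def using p(2,4) by (auto, meson order_trans, meson order_trans)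
    show "negligible N" unfolding N_def using p(1) by (intro negligible_finite) auto
    show "\<forall>x\<in>?E - N. \<forall>d>0. \<exists>u v. (u, v) \<in> K \<and> u \<le> x \<and> x \<le> v \<and> v - u < d"
    proof (intro ballI allI impI)
      fix x \<delta> :: real assume x: "x \<in> ?E - N" and \<delta>: "\<delta> > 0"
      then obtain c d where cd: "(c, d) \<in> P" "c \<le> x" "x \<le> d"
        using P0'(2)[of x] ab unfolding P_def by auto
      have "x \<noteq> c" "x \<noteq> d" using x cd unfolding N_def by (auto intro: rev_image_eqI)
      then have "c < x" "x < d" using cd by auto
      define \<eta> where "\<eta> = min \<delta> (min (x - c) (d - x))"
      have \<eta>: "\<eta> > 0" using \<delta> \<open>c < x\<close> \<open>x < d\<close> by (simp add: \<eta>_def)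
      have "\<exists>u v. u \<le> x \<and> x \<le> v \<and> u < v \<and> v - u < \<eta> \<and> sg (c, d) * (f v - f u) \<le> - k * (v - u)"
      proof (cases "f c \<le> f d")
        case True
        then have 1: "sg (c, d) = 1" unfolding sg_def by simp
        obtain u v where "u \<le> x" "x \<le> v" "u < v" "v - u < \<eta>" "f v - f u \<le> - k * (v - u)" using x \<eta> by blast
        then show ?thesis unfolding 1 by (intro exI[of _ u] exI[of _ v]) auto
      next
        case False
        then have 1: "sg (c, d) = - 1" unfolding sg_def by simp
        obtain u v where "u \<le> x" "x \<le> v" "u < v" "v - u < \<eta>" "k * (v - u) \<le> f v - f u" using x \<eta> by blast
        then show ?thesis unfolding 1 by (intro exI[of _ u] exI[of _ v]) auto
      qed
      then obtain u v where uv: "u \<le> x" "x \<le> v" "u < v" "v - u < \<eta>" "sg (c, d) * (f v - f u) \<le> - k * (v - u)"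
        by blast
      have "c \<le> u" "v \<le> d" "v - u < \<delta>" using uv \<eta>_def by auto
      then have "(u, v) \<in> K" unfolding K_def using uv cd by blast
      then show "\<exists>u v. (u, v) \<in> K \<and> u \<le> x \<and> x \<le> v \<and> v - u < \<delta>" using uv \<open>v - u < \<delta>\<close> by blast
    qed
    show "\<forall>D\<subseteq>K. interval_packing \<alpha> \<beta> D \<longrightarrow> (\<Sum>(u, v)\<in>D. v - u) \<le> e"
    proof (intro allI impI)
      fix D assume DK: "D \<subseteq> K" and D: "interval_packing \<alpha> \<beta> D"
      define DI where "DI = (\<lambda>(c, d). {(u, v). (u, v) \<in> D \<and> c \<le> u \<and> v \<le> d \<and> sg (c, d) * (f v - f u) \<le> - k * (v - u)})"
      have DI: "interval_packing c d (DI (c, d))" if "(c, d) \<in> P" for c d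
        unfolding DI_def
      proof (rule interval_packingI)
        have "{(u, v). (u, v) \<in> D \<and> c \<le> u \<and> v \<le> d \<and> sg (c, d) * (f v - f u) \<le> - k * (v - u)} \<subseteq> D" by auto
        then show "finite (case (c, d) of (c, d) \<Rightarrow> {(u, v). (u, v) \<in> D \<and> c \<le> u \<and> v \<le> d \<and> sg (c, d) * (f v - f u) \<le> - k * (v - u)})"
          using interval_packingD(1)[OF D] finite_subset by auto
      qed (use interval_packingD(3,5)[OF D] in auto)
      have Deq: "D = (\<Union>I\<in>P. DI I)"
      proof (intro equalityI subsetI)
        fix i assume i: "i \<in> D"
        obtain u v where uv: "i = (u, v)" by (cases i)
        then have "(u, v) \<in> K" using i DK by auto
        then obtain c d where "(c, d) \<in> P" "c \<le> u \<and> v \<le> d \<and> sg (c, d) * (f v - f u) \<le> - k * (v - u)"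
          unfolding K_def by auto
        then have "(u, v) \<in> DI (c, d)" using i uv unfolding DI_def by auto
        then show "i \<in> (\<Union>I\<in>P. DI I)" using \<open>(c, d) \<in> P\<close> uv by blast
      qed (auto simp: DI_def)
      have "\<exists>G. \<forall>I\<in>P. interval_packing (fst I) (snd I) (DI I \<union> G I) \<and> DI I \<inter> G I = {} \<and>
         (\<Sum>(u, v)\<in>DI I \<union> G I. f v - f u) = f (snd I) - f (fst I)"
      proof (rule bchoice, intro ballI)
        fix I assume I: "I \<in> P"
        obtain c d where [simp]: "I = (c, d)" by (cases I)
        show "\<exists>G. interval_packing (fst I) (snd I) (DI I \<union> G) \<and> DI I \<inter> G = {} \<and>
         (\<Sum>(u, v)\<in>DI I \<union> G. f v - f u) = f (snd I) - f (fst I)"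
        proof -
          have cd: "(c, d) \<in> P" "c \<le> d" using p(3)[of c d] I by auto
          show ?thesis
          proof (rule interval_packing_complete[OF DI[OF cd(1)] cd(2)])
            fix G assume "interval_packing c d (DI (c, d) \<union> G)" "DI (c, d) \<inter> G = {}"
              and "\<And>h :: real \<Rightarrow> real. (\<Sum>(u, v)\<in>DI (c, d) \<union> G. h v - h u) = h d - h c"
            then show ?thesis by (intro exI[of _ G]) simp
          qed
        qed
      qed
      then obtain G where G: "\<And>I. I \<in> P \<Longrightarrow> interval_packing (fst I) (snd I) (DI I \<union> G I)"
        "\<And>I. I \<in> P \<Longrightarrow> DI I \<inter> G I = {}"
        "\<And>I. I \<in> P \<Longrightarrow> (\<Sum>(u, v)\<in>DI I \<union> G I. f v - f u) = f (snd I) - f (fst I)" by blast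
      have pk: "interval_packing \<alpha> \<beta> (\<Union>I\<in>P. DI I \<union> G I)"
        "(\<Sum>i\<in>(\<Union>I\<in>P. DI I \<union> G I). h i) = (\<Sum>I\<in>P. \<Sum>i\<in>DI I \<union> G I. h i)" for h :: "real \<times> real \<Rightarrow> real"
        by (rule interval_packing_UN[OF P, of "\<lambda>I. DI I \<union> G I"]; use G(1) in force)+
      \<comment> \<open>On the intervals of \<open>DI\<close> the signed increment is at most
        \<open>- k * (v - u)\<close>, so passing to moduli gains at least
        \<open>2 * k * (v - u)\<close>; on the filling intervals passing to moduli loses
        nothing.\<close>
      have each: "\<bar>f d - f c\<bar> + 2 * k * (\<Sum>(u, v)\<in>DI (c, d). v - u) \<le> (\<Sum>(u, v)\<in>DI (c, d) \<union> G (c, d). \<bar>f v - f u\<bar>)"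
        if cd: "(c, d) \<in> P" for c d
      proof -
        let ?s = "sg (c, d)" and ?X = "DI (c, d)" and ?Y = "G (c, d)"
        have fin: "finite ?X" "finite ?Y" using interval_packingD(1)[OF G(1)[OF cd]] by auto
        have sp: "sum h (?X \<union> ?Y) = sum h ?X + sum h ?Y" for h :: "real \<times> real \<Rightarrow> real"
          using fin G(2)[OF cd] by (rule sum.union_disjoint)
        have bd: "?s * t \<le> \<bar>t\<bar>" "- (?s * t) \<le> \<bar>t\<bar>" for t
          using sg[of "(c, d)"] abs_ge_self[of "?s * t"] abs_ge_minus_self[of "?s * t"] by (simp_all add: abs_mult)
        have "\<bar>f d - f c\<bar> = ?s * (\<Sum>(u, v)\<in>?X \<union> ?Y. f v - f u)" using G(3)[OF cd] sg' by simp
        also have "\<dots> = (\<Sum>(u, v)\<in>?X. ?s * (f v - f u)) + (\<Sum>(u, v)\<in>?Y. ?s * (f v - f u))"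
          unfolding sp by (simp add: sum_distrib_left distrib_left split_def)
        finally have 1: "\<bar>f d - f c\<bar> = (\<Sum>(u, v)\<in>?X. ?s * (f v - f u)) + (\<Sum>(u, v)\<in>?Y. ?s * (f v - f u))" .
        have 2: "(\<Sum>(u, v)\<in>?X. ?s * (f v - f u)) + 2 * k * (\<Sum>(u, v)\<in>?X. v - u) \<le> (\<Sum>(u, v)\<in>?X. \<bar>f v - f u\<bar>)"
        proof -
          have "?s * (f v - f u) + 2 * k * (v - u) \<le> \<bar>f v - f u\<bar>" if "(u, v) \<in> ?X" for u v
          proof -
            have "?s * (f v - f u) \<le> - k * (v - u)" using that unfolding DI_def by auto
            then show ?thesis using bd(2)[of "f v - f u"] by linarith
          qed
          then have "(\<Sum>(u, v)\<in>?X. ?s * (f v - f u) + 2 * k * (v - u)) \<le> (\<Sum>(u, v)\<in>?X. \<bar>f v - f u\<bar>)"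
            by (intro sum_mono) auto
          then show ?thesis by (simp add: sum.distrib sum_distrib_left split_def)
        qed
        have 3: "(\<Sum>(u, v)\<in>?Y. ?s * (f v - f u)) \<le> (\<Sum>(u, v)\<in>?Y. \<bar>f v - f u\<bar>)"
          using bd by (intro sum_mono) auto
        show ?thesis unfolding sp using 1 2 3 by linarith
      qed
      have sumD: "(\<Sum>(u, v)\<in>D. v - u) = (\<Sum>I\<in>P. \<Sum>(u, v)\<in>DI I. v - u)"
        by (subst Deq, rule interval_packing_UN(2)[OF P]) (rule DI)
      have "(\<Sum>(c, d)\<in>P. \<bar>f d - f c\<bar>) + 2 * k * (\<Sum>(u, v)\<in>D. v - u)
          = (\<Sum>I\<in>P. (case I of (c, d) \<Rightarrow> \<bar>f d - f c\<bar>) + 2 * k * (\<Sum>(u, v)\<in>DI I. v - u))"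
        unfolding sumD by (simp add: sum.distrib sum_distrib_left)
      also have "\<dots> \<le> (\<Sum>I\<in>P. \<Sum>(u, v)\<in>DI I \<union> G I. \<bar>f v - f u\<bar>)"
        using each by (intro sum_mono) auto
      also have "\<dots> = (\<Sum>(u, v)\<in>(\<Union>I\<in>P. DI I \<union> G I). \<bar>f v - f u\<bar>)" by (rule pk(2)[symmetric])
      also have "\<dots> \<le> Sup S" using pk(1) unfolding S_def
        by (intro cSup_upper) (use Sb S_def in auto)
      finally have "2 * k * (\<Sum>(u, v)\<in>D. v - u) \<le> 2 * k * e" using Pgt by linarith
      then show "(\<Sum>(u, v)\<in>D. v - u) \<le> e" using k by simp
    qed
  qed
qed

text \<open>Subtracting the line of slope \<open>m\<close> shifts all slopes by \<open>m\<close> and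
  reduces to the symmetric case; the variation grows by at most
  \<open>\<bar>m\<bar> * (\<beta> - \<alpha>)\<close>.\<close>

lemma negligible_opposite_slopes:
  fixes f :: "real \<Rightarrow> real"
  assumes bv: "\<And>D. interval_packing \<alpha> \<beta> D \<Longrightarrow> (\<Sum>(u, v)\<in>D. \<bar>f v - f u\<bar>) \<le> B"
    and k: "k > 0" and ab: "\<alpha> < \<beta>"
  shows "negligible {x\<in>{\<alpha><..<\<beta>}. \<forall>e>0.
     (\<exists>u v. \<alpha> \<le> u \<and> u \<le> x \<and> x \<le> v \<and> v \<le> \<beta> \<and> u < v \<and> v - u < e \<and> (m + k) * (v - u) \<le> f v - f u) \<and>
     (\<exists>u v. \<alpha> \<le> u \<and> u \<le> x \<and> x \<le> v \<and> v \<le> \<beta> \<and> u < v \<and> v - u < e \<and> f v - f u \<le> (m - k) * (v - u))}"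
proof -
  define g where "g = (\<lambda>x. f x - m * x)"
  have "(\<Sum>(u, v)\<in>D. \<bar>g v - g u\<bar>) \<le> B + \<bar>m\<bar> * (\<beta> - \<alpha>)" if D: "interval_packing \<alpha> \<beta> D" for D
  proof -
    have "(\<Sum>(u, v)\<in>D. \<bar>g v - g u\<bar>) \<le> (\<Sum>(u, v)\<in>D. \<bar>f v - f u\<bar> + \<bar>m\<bar> * (v - u))"
    proof (intro sum_mono, clarify)
      fix u v assume "(u, v) \<in> D"
      then have "u < v" using interval_packingD[OF D] by blast
      then have "\<bar>m * (v - u)\<bar> = \<bar>m\<bar> * (v - u)" by (simp add: abs_mult)
      moreover have "g v - g u = (f v - f u) - m * (v - u)" by (simp add: g_def algebra_simps)
      ultimately show "\<bar>g v - g u\<bar> \<le> \<bar>f v - f u\<bar> + \<bar>m\<bar> * (v - u)" by linarith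
    qed
    also have "\<dots> = (\<Sum>(u, v)\<in>D. \<bar>f v - f u\<bar>) + \<bar>m\<bar> * (\<Sum>(u, v)\<in>D. v - u)"
      by (simp add: sum.distrib sum_distrib_left split_def)
    also have "\<dots> \<le> B + \<bar>m\<bar> * (\<beta> - \<alpha>)"
      using bv[OF D] interval_packing_length_le[OF D] ab by (intro add_mono mult_left_mono) auto
    finally show ?thesis .
  qed
  from negligible_opposite_slopes_aux[OF this k ab]
  show ?thesis by (rule negligible_subset) (auto simp: g_def algebra_simps)
qed

text \<open>Intervals over which \<open>f\<close> has slope at least \<open>M\<close> in modulus
  each contribute at least \<open>M\<close> times their length to the variation, so a packing of
  them has total length at most \<open>B / M\<close>.\<close>

lemma negligible_unbounded_slopes:
  fixes f :: "real \<Rightarrow> real"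
  assumes bv: "\<And>D. interval_packing \<alpha> \<beta> D \<Longrightarrow> (\<Sum>(u, v)\<in>D. \<bar>f v - f u\<bar>) \<le> B"
  shows "negligible {x. \<forall>M>0. \<forall>e>0.
     \<exists>u v. \<alpha> \<le> u \<and> u \<le> x \<and> x \<le> v \<and> v \<le> \<beta> \<and> u < v \<and> v - u < e \<and> M * (v - u) \<le> \<bar>f v - f u\<bar>}"
    (is "negligible ?E")
proof (rule negligible_Vitali_packing[of \<alpha> \<beta>])
  fix e :: real assume e: "e > 0"
  \<comment> \<open>The choice makes \<open>M * e\<close> exceed \<open>B\<close>, and the added 1
    keeps \<open>M\<close> positive even for \<open>B = 0\<close>.\<close>
  define M where "M = (\<bar>B\<bar> + 1) / e"
  have M: "M > 0" "M * e = \<bar>B\<bar> + 1" using e by (auto simp: M_def)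
  define K where "K = {(u, v). \<alpha> \<le> u \<and> v \<le> \<beta> \<and> u < v \<and> M * (v - u) \<le> \<bar>f v - f u\<bar>}"
  show "\<exists>K N. K \<subseteq> {(u, v). \<alpha> \<le> u \<and> u < v \<and> v \<le> \<beta>} \<and> negligible N \<and>
     (\<forall>x\<in>?E - N. \<forall>d>0. \<exists>u v. (u, v) \<in> K \<and> u \<le> x \<and> x \<le> v \<and> v - u < d) \<and>
     (\<forall>D\<subseteq>K. interval_packing \<alpha> \<beta> D \<longrightarrow> (\<Sum>(u, v)\<in>D. v - u) \<le> e)"
  proof (intro exI[of _ K] exI[of _ "{}"] conjI)
    show "K \<subseteq> {(u, v). \<alpha> \<le> u \<and> u < v \<and> v \<le> \<beta>}" by (auto simp: K_def)
    show "\<forall>x\<in>?E - {}. \<forall>d>0. \<exists>u v. (u, v) \<in> K \<and> u \<le> x \<and> x \<le> v \<and> v - u < d"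
    proof (intro ballI allI impI)
      fix x d assume "x \<in> ?E - {}" "(0::real) < d"
      then obtain u v where "\<alpha> \<le> u \<and> u \<le> x \<and> x \<le> v \<and> v \<le> \<beta> \<and> u < v \<and> v - u < d \<and> M * (v - u) \<le> \<bar>f v - f u\<bar>"
        using M by blast
      then show "\<exists>u v. (u, v) \<in> K \<and> u \<le> x \<and> x \<le> v \<and> v - u < d"
        unfolding K_def by (intro exI[of _ u] exI[of _ v]) simp
    qed
    show "\<forall>D\<subseteq>K. interval_packing \<alpha> \<beta> D \<longrightarrow> (\<Sum>(u, v)\<in>D. v - u) \<le> e"
    proof (intro allI impI)
      fix D assume DK: "D \<subseteq> K" and D: "interval_packing \<alpha> \<beta> D"
      have "M * (\<Sum>(u, v)\<in>D. v - u) = (\<Sum>(u, v)\<in>D. M * (v - u))" by (simp add: sum_distrib_left split_def)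
      also have "\<dots> \<le> (\<Sum>(u, v)\<in>D. \<bar>f v - f u\<bar>)" using DK by (intro sum_mono) (auto simp: K_def)
      also have "\<dots> \<le> M * e" using bv[OF D] M by linarith
      finally show "(\<Sum>(u, v)\<in>D. v - u) \<le> e" using mult_le_cancel_left_pos[OF M(1)] by blast
    qed
  qed auto
qed

text \<open>All difference quotients are taken over intervals containing \<open>x\<close>, not
  necessarily as an endpoint. Off the exceptional sets these are eventually bounded, and for
  rational \<open>m\<close> and \<open>k > 0\<close> they are eventually all below
  \<open>m + k\<close> or all above \<open>m - k\<close>. Hence the infimum of the eventual upper
  bounds is also approached by eventual lower bounds, so it is the derivative. Rational parameters
  keep the union of exceptional sets countable.\<close>

lemma bounded_variation_differentiable_ae:
  fixes f :: "real \<Rightarrow> real"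
  assumes bv: "\<And>D. interval_packing \<alpha> \<beta> D \<Longrightarrow> (\<Sum>(u, v)\<in>D. \<bar>f v - f u\<bar>) \<le> B" and ab: "\<alpha> < \<beta>"
  shows "negligible {x\<in>{\<alpha><..<\<beta>}. \<not> f field_differentiable at x}"
proof -
  let ?S = "\<lambda>x e u v. \<alpha> \<le> u \<and> u \<le> x \<and> x \<le> v \<and> v \<le> \<beta> \<and> u < v \<and> v - u < e"
  define E where "E = (\<lambda>(m, k). {x\<in>{\<alpha><..<\<beta>}. \<forall>e>0.
     (\<exists>u v. ?S x e u v \<and> (m + k) * (v - u) \<le> f v - f u) \<and> (\<exists>u v. ?S x e u v \<and> f v - f u \<le> (m - k) * (v - u))})"
  define U where "U = {x. \<forall>M>0. \<forall>e>0. \<exists>u v. ?S x e u v \<and> M * (v - u) \<le> \<bar>f v - f u\<bar>}"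
  let ?Q = "{(m, k). m \<in> \<rat> \<and> k \<in> \<rat> \<and> 0 < (k :: real)}"
  have "countable ?Q"
    by (rule countable_subset[of _ "\<rat> \<times> \<rat>"]) (auto intro: countable_SIGMA simp: countable_rat)
  moreover have "negligible (E q)" if "q \<in> ?Q" for q
    using negligible_opposite_slopes[OF bv _ ab, of "snd q" "fst q"] that
    unfolding E_def by (auto simp: conj_assoc)
  ultimately have "negligible (\<Union> (E ` ?Q))"
    by (intro negligible_countable_Union) auto
  moreover have "negligible U"
    using negligible_unbounded_slopes[OF bv] unfolding U_def by (simp add: conj_assoc)
  ultimately have "negligible (\<Union> (E ` ?Q) \<union> U)" by (rule negligible_Un)
  then show ?thesis
  proof (rule negligible_subset)
    show "{x\<in>{\<alpha><..<\<beta>}. \<not> f field_differentiable at x} \<subseteq> \<Union> (E ` ?Q) \<union> U"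
    proof (intro subsetI, rule ccontr)
      fix x assume *: "x \<in> {x\<in>{\<alpha><..<\<beta>}. \<not> f field_differentiable at x}" "x \<notin> \<Union> (E ` ?Q) \<union> U"
      then have x: "x \<in> {\<alpha><..<\<beta>}" and nd: "\<not> f field_differentiable at x"
        and nE: "x \<notin> \<Union> (E ` ?Q)" and nU: "x \<notin> U" by auto
      define up where "up = (\<lambda>t. \<exists>e>0. \<forall>u v. ?S x e u v \<longrightarrow> f v - f u < t * (v - u))"
      define lo where "lo = (\<lambda>t. \<exists>e>0. \<forall>u v. ?S x e u v \<longrightarrow> t * (v - u) < f v - f u)"
      have alt: "up (m + k) \<or> lo (m - k)" if "m \<in> \<rat>" "k \<in> \<rat>" "k > 0" for m k
      proof -
        have "x \<notin> E (m, k)" using nE that by blast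
        then obtain e where "e > 0" "(\<forall>u v. ?S x e u v \<longrightarrow> \<not> (m + k) * (v - u) \<le> f v - f u) \<or>
          (\<forall>u v. ?S x e u v \<longrightarrow> \<not> f v - f u \<le> (m - k) * (v - u))"
          unfolding E_def using x by auto
        then show ?thesis unfolding up_def lo_def not_le by blast
      qed
      have "\<exists>M>0. \<exists>e>0. \<forall>u v. ?S x e u v \<longrightarrow> \<not> M * (v - u) \<le> \<bar>f v - f u\<bar>"
        using nU unfolding U_def by blast
      then obtain M e0 where M: "M > 0" "e0 > 0" "\<And>u v. ?S x e0 u v \<Longrightarrow> \<bar>f v - f u\<bar> < M * (v - u)"
        unfolding not_le by blast
      have M': "- M * (v - u) < f v - f u \<and> f v - f u < M * (v - u)" if "?S x e0 u v" for u v
        using M(3)[OF that] by linarith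
      have upM: "up M" "lo (- M)" unfolding up_def lo_def using M(2) M' by blast+
        have lt: "t' < t" if "up t" "lo t'" for t t'
      proof -
        obtain e where e: "e > 0" "\<And>u v. ?S x e u v \<Longrightarrow> f v - f u < t * (v - u)" using \<open>up t\<close> up_def by blast
        obtain e' where e': "e' > 0" "\<And>u v. ?S x e' u v \<Longrightarrow> t' * (v - u) < f v - f u" using \<open>lo t'\<close> lo_def by blast
        define v where "v = min \<beta> (x + min e e' / 2)"
        have v: "x < v" "v \<le> \<beta>" "v - x < e" "v - x < e'" using x e(1) e'(1) by (auto simp: v_def min_def field_simps)
        have S: "?S x e x v" "?S x e' x v" using v x by auto
        have "t' * (v - x) < t * (v - x)" by (rule order.strict_trans[OF e'(2)[OF S(2)] e(2)[OF S(1)]])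
        then show ?thesis using v(1) by simp
      qed
      have upmono: "up t'" if "up t" "t \<le> t'" for t t'
      proof -
        obtain e where e: "e > 0" "\<And>u v. ?S x e u v \<Longrightarrow> f v - f u < t * (v - u)" using \<open>up t\<close> up_def by blast
        have "f v - f u < t' * (v - u)" if "?S x e u v" for u v
        proof -
          have "t * (v - u) \<le> t' * (v - u)" using that \<open>t \<le> t'\<close> by (intro mult_right_mono) auto
          then show ?thesis using e(2)[OF that] by linarith
        qed
        then show ?thesis unfolding up_def using e(1) by blast
      qed
      have lomono: "lo t'" if "lo t" "t' \<le> t" for t t'
      proof -
        obtain e where e: "e > 0" "\<And>u v. ?S x e u v \<Longrightarrow> t * (v - u) < f v - f u" using \<open>lo t\<close> lo_def by blast
        have "t' * (v - u) < f v - f u" if "?S x e u v" for u v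
        proof -
          have "t' * (v - u) \<le> t * (v - u)" using that \<open>t' \<le> t\<close> by (intro mult_right_mono) auto
          then show ?thesis using e(2)[OF that] by linarith
        qed
        then show ?thesis unfolding lo_def using e(1) by blast
      qed
      define L where "L = Inf (Collect up)"
      have bdd: "bdd_below (Collect up)" using lt[OF _ upM(2)] by (intro bdd_belowI[of _ "- M"]) (auto intro: less_imp_le)
      have upL: "up (L + \<epsilon>)" if "\<epsilon> > 0" for \<epsilon>
      proof -
        have "Inf (Collect up) < L + \<epsilon>" using that by (simp add: L_def)
        then obtain t where "up t" "t < L + \<epsilon>" using cInf_lessD[of "Collect up"] upM(1) by blast
        then show ?thesis using upmono by (meson less_imp_le)
      qed
      have loL: "lo (L - \<epsilon>)" if \<epsilon>: "\<epsilon> > 0" for \<epsilon>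
      proof -
        \<comment> \<open>With these choices \<open>m + k < L\<close>, so \<open>m + k\<close> is no
          eventual upper bound and the alternative yields the lower bound
          \<open>m - k > L - \<epsilon>\<close>.\<close>
        obtain m where m: "m \<in> \<rat>" "L - \<epsilon> / 2 < m" "m < L - \<epsilon> / 4" using Rats_dense_in_real[of "L - \<epsilon> / 2" "L - \<epsilon> / 4"] \<epsilon> by auto
        obtain k where k: "k \<in> \<rat>" "0 < k" "k < \<epsilon> / 4" using Rats_dense_in_real[of 0 "\<epsilon> / 4"] \<epsilon> by auto
        have "\<not> up (m + k)"
        proof
          assume "up (m + k)"
          then have "L \<le> m + k" unfolding L_def by (intro cInf_lower bdd) simp
          then show False using m k by simp
        qed
        then have "lo (m - k)" using alt m k by blast
        then show ?thesis using m k \<epsilon> by (elim lomono) simp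
      qed
      have "(f has_field_derivative L) (at x)"
        unfolding has_field_derivative_iff
      proof (rule tendstoI)
        fix \<epsilon> :: real assume \<epsilon>: "\<epsilon> > 0"
        obtain e where e: "e > 0" "\<And>u v. ?S x e u v \<Longrightarrow> f v - f u < (L + \<epsilon>) * (v - u)"
          using upL[OF \<epsilon>] up_def by blast
        obtain e' where e': "e' > 0" "\<And>u v. ?S x e' u v \<Longrightarrow> (L - \<epsilon>) * (v - u) < f v - f u"
          using loL[OF \<epsilon>] lo_def by blast
        define \<eta> where "\<eta> = min (min e e') (min (x - \<alpha>) (\<beta> - x))"
        have \<eta>: "\<eta> > 0" using e e' x by (auto simp: \<eta>_def)
        have "dist ((f y - f x) / (y - x)) L < \<epsilon>" if y: "y \<noteq> x" "dist y x < \<eta>" for y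
        proof -
          have slope: "\<bar>(f v - f u) / (v - u) - L\<bar> < \<epsilon>" if "?S x (min e e') u v" for u v
            using e(2)[of u v] e'(2)[of u v] that by (auto simp: abs_less_iff field_simps)
          have sym: "(f y - f x) / (y - x) = (f x - f y) / (x - y)"
            by (metis minus_diff_eq minus_divide_divide)
          have "\<bar>y - x\<bar> < \<eta>" using y by (simp add: dist_real_def)
          then have "\<bar>(f y - f x) / (y - x) - L\<bar> < \<epsilon>"
            using slope[of x y] slope[of y x] y(1) x unfolding sym \<eta>_def
            by (cases "x < y") (auto simp: sym[symmetric])
          then show ?thesis by (simp add: dist_real_def)
        qed
        then show "\<forall>\<^sub>F y in at x. dist ((f y - f x) / (y - x)) L < \<epsilon>"
          unfolding eventually_at using \<eta> by (intro exI[of _ \<eta>]) auto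
      qed
      then show False using nd unfolding field_differentiable_def by blast
    qed
  qed
qed

section \<open>Localisation of null sets and absolute continuity in terms of packings\<close>

text \<open>Lebesgue measure is complete, so the exceptional set inside \<open>S\<close> is itself
  null rather than merely contained in a null set. The equivalence links the almost everywhere
  statements of the definitions with negligibility in gauge integration.\<close>

lemma AE_lebesgue_iff_negligible:
  "(AE x\<in>S in lebesgue. P x) \<longleftrightarrow> negligible {x\<in>S. \<not> P x}"
proof
  assume "AE x\<in>S in lebesgue. P x"
  then obtain N where "N \<in> null_sets lebesgue" "{x. \<not> (x \<in> S \<longrightarrow> P x)} \<subseteq> N"
    by (auto simp: eventually_ae_filter)
  then have "{x\<in>S. \<not> P x} \<subseteq> N" "negligible N" by (auto simp: negligible_iff_null_sets)
  then show "negligible {x\<in>S. \<not> P x}" using negligible_subset by blast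
next
  assume "negligible {x\<in>S. \<not> P x}"
  then have "{x\<in>S. \<not> P x} \<in> null_sets lebesgue" by (simp add: negligible_iff_null_sets)
  then show "AE x\<in>S in lebesgue. P x" by (rule AE_I') auto
qed

text \<open>Negligibility is a local property. Restricting to intervals shorter than
  \<open>\<delta>\<close> suits absolute continuity, which bounds the variation directly only on
  short intervals.\<close>

lemma negligible_locally:
  fixes S :: "real set"
  assumes S: "open S" and \<delta>: "\<delta> > 0"
    and loc: "\<And>c d. \<lbrakk>c < d; {c..d} \<subseteq> S; d - c < \<delta>\<rbrakk> \<Longrightarrow> negligible {x\<in>{c<..<d}. \<not> P x}"
  shows "negligible {x\<in>S. \<not> P x}"
  unfolding locally_negligible_alt[of "{x\<in>S. \<not> P x}"]
proof
  fix x assume x: "x \<in> {x\<in>S. \<not> P x}"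
  then obtain e where e: "e > 0" "cball x e \<subseteq> S" using S open_contains_cball by blast
  \<comment> \<open>One third of \<open>\<delta>\<close>, because the interval used has length
    \<open>2 * r\<close>.\<close>
  define r where "r = min e (\<delta> / 3)"
  have r: "r > 0" "2 * r < \<delta>" "{x - r..x + r} \<subseteq> S"
    using e \<delta> by (auto simp: r_def cball_eq_atLeastAtMost min_def)
  show "\<exists>U. openin (top_of_set {x\<in>S. \<not> P x}) U \<and> x \<in> U \<and> negligible U"
  proof (intro exI conjI)
    show "openin (top_of_set {x\<in>S. \<not> P x}) ({x\<in>S. \<not> P x} \<inter> {x - r<..<x + r})"
      by (intro openin_open_Int) simp
    have "negligible {y\<in>{x - r<..<x + r}. \<not> P y}" using r by (intro loc) auto
    then show "negligible ({x\<in>S. \<not> P x} \<inter> {x - r<..<x + r})" by (rule negligible_subset) auto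
  qed (use x r in auto)
qed

text \<open>Degenerate pairs contribute nothing to either sum, so they may be dropped; nondegenerate
  open intervals are disjoint exactly when they are ordered. The same \<open>\<delta>\<close>
  therefore serves both formulations.\<close>

lemma abs_continuous_iff_packing:
  "abs_continuous_on_interval \<alpha> \<beta> f \<longleftrightarrow>
    (\<forall>\<epsilon>>0. \<exists>\<delta>>0. \<forall>D. interval_packing \<alpha> \<beta> D \<and> (\<Sum>(x, y)\<in>D. y - x) < \<delta> \<longrightarrow> (\<Sum>(x, y)\<in>D. \<bar>f y - f x\<bar>) < \<epsilon>)"
    (is "_ \<longleftrightarrow> ?rhs")
proof
  have pk: "finite D \<and> (\<forall>(x, y)\<in>D. \<alpha> \<le> x \<and> x \<le> y \<and> y \<le> \<beta>) \<and> disjoint_family_on (\<lambda>(x, y). {x<..<y}) D"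
    if D: "interval_packing \<alpha> \<beta> D" for D
  proof (intro conjI)
    show "finite D" by (rule interval_packingD(1)[OF D])
    show "\<forall>(x, y)\<in>D. \<alpha> \<le> x \<and> x \<le> y \<and> y \<le> \<beta>" using interval_packingD(2-4)[OF D] by force
    show "disjoint_family_on (\<lambda>(x, y). {x<..<y}) D"
      unfolding disjoint_family_on_def
    proof (intro ballI impI)
      fix i j assume *: "i \<in> D" "j \<in> D" "i \<noteq> j"
      obtain x y x' y' where ij: "i = (x, y)" "j = (x', y')" by (cases i; cases j)
      have "{x<..<y} \<inter> {x'<..<y'} = {}"
        using interval_packingD(5)[OF D, of x y x' y'] interval_packingD(3)[OF D, of x y]
          interval_packingD(3)[OF D, of x' y'] * unfolding ij
        by (subst open_intervals_disjoint_iff) auto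
      then show "(case i of (x, y) \<Rightarrow> {x<..<y}) \<inter> (case j of (x, y) \<Rightarrow> {x<..<y}) = {}" unfolding ij by simp
    qed
  qed
  assume L: "abs_continuous_on_interval \<alpha> \<beta> f"
  show ?rhs
  proof (intro allI impI)
    fix \<epsilon> :: real assume "\<epsilon> > 0"
    with L obtain \<delta> where "\<delta> > 0" and \<delta>: "\<forall>D. finite D \<and> (\<forall>(x, y)\<in>D. \<alpha> \<le> x \<and> x \<le> y \<and> y \<le> \<beta>) \<and>
       disjoint_family_on (\<lambda>(x, y). {x<..<y}) D \<and> (\<Sum>(x, y)\<in>D. y - x) < \<delta> \<longrightarrow>
       (\<Sum>(x, y)\<in>D. \<bar>f y - f x\<bar>) < \<epsilon>" unfolding abs_continuous_on_interval_def by meson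
    show "\<exists>\<delta>>0. \<forall>D. interval_packing \<alpha> \<beta> D \<and> (\<Sum>(x, y)\<in>D. y - x) < \<delta> \<longrightarrow> (\<Sum>(x, y)\<in>D. \<bar>f y - f x\<bar>) < \<epsilon>"
    proof (intro exI[of _ \<delta>] conjI allI impI)
      fix D assume "interval_packing \<alpha> \<beta> D \<and> (\<Sum>(x, y)\<in>D. y - x) < \<delta>"
      then have D: "interval_packing \<alpha> \<beta> D" "(\<Sum>(x, y)\<in>D. y - x) < \<delta>" by blast+
      show "(\<Sum>(x, y)\<in>D. \<bar>f y - f x\<bar>) < \<epsilon>"
        by (rule \<delta>[THEN spec, THEN mp], insert pk[OF D(1)] D(2), elim conjE, intro conjI)
    qed fact
  qed
next
  assume R: ?rhs
  show "abs_continuous_on_interval \<alpha> \<beta> f"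
    unfolding abs_continuous_on_interval_def
  proof (intro allI impI)
    fix \<epsilon> :: real assume "\<epsilon> > 0"
    with R obtain \<delta> where "\<delta> > 0" and \<delta>: "\<And>D. interval_packing \<alpha> \<beta> D \<Longrightarrow> (\<Sum>(x, y)\<in>D. y - x) < \<delta> \<Longrightarrow>
       (\<Sum>(x, y)\<in>D. \<bar>f y - f x\<bar>) < \<epsilon>" by meson
    show "\<exists>\<delta>>0. \<forall>D :: (real \<times> real) set. finite D \<and> (\<forall>(x, y)\<in>D. \<alpha> \<le> x \<and> x \<le> y \<and> y \<le> \<beta>) \<and>
       disjoint_family_on (\<lambda>(x, y). {x<..<y}) D \<and> (\<Sum>(x, y)\<in>D. y - x) < \<delta> \<longrightarrow>
       (\<Sum>(x, y)\<in>D. \<bar>f y - f x\<bar>) < \<epsilon>"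
    proof (intro exI[of _ \<delta>] conjI allI impI)
      fix D :: "(real \<times> real) set"
      assume *: "finite D \<and> (\<forall>(x, y)\<in>D. \<alpha> \<le> x \<and> x \<le> y \<and> y \<le> \<beta>) \<and>
        disjoint_family_on (\<lambda>(x, y). {x<..<y}) D \<and> (\<Sum>(x, y)\<in>D. y - x) < \<delta>"
      note D = conjunct1[OF *] conjunct1[OF conjunct2[OF *]] conjunct1[OF conjunct2[OF conjunct2[OF *]]]
        conjunct2[OF conjunct2[OF conjunct2[OF *]]]
      define D' where "D' = {i \<in> D. fst i < snd i}"
      have eq: "fst i = snd i" if "i \<in> D - D'" for i using that D(2) unfolding D'_def by force
      have "interval_packing \<alpha> \<beta> D'"
      proof (rule interval_packingI)
        show "finite D'" using D(1) by (simp add: D'_def)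
        show "\<alpha> \<le> x \<and> x < y \<and> y \<le> \<beta>" if "(x, y) \<in> D'" for x y using that D(2) unfolding D'_def by auto
        show "y \<le> x' \<or> y' \<le> x" if xy: "(x, y) \<in> D'" "(x', y') \<in> D'" "(x, y) \<noteq> (x', y')" for x y x' y'
        proof -
          have "{x<..<y} \<inter> {x'<..<y'} = {}"
            using D(3)[unfolded disjoint_family_on_def, rule_format, of "(x, y)" "(x', y')"] xy
            unfolding D'_def by (simp del: Int_greaterThanLessThan)
          then show ?thesis using xy unfolding D'_def by (subst (asm) open_intervals_disjoint_iff) auto
        qed
      qed
      moreover have "(\<Sum>(x, y)\<in>D'. y - x) = (\<Sum>(x, y)\<in>D. y - x)"
      proof (intro sum.mono_neutral_left ballI)
        show "(case i of (x, y) \<Rightarrow> y - x) = 0" if "i \<in> D - D'" for i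
          using eq[OF that] by (cases i) simp
      qed (auto simp: D'_def D(1))
      moreover have "(\<Sum>(x, y)\<in>D'. \<bar>f y - f x\<bar>) = (\<Sum>(x, y)\<in>D. \<bar>f y - f x\<bar>)"
      proof (intro sum.mono_neutral_left ballI)
        show "(case i of (x, y) \<Rightarrow> \<bar>f y - f x\<bar>) = 0" if "i \<in> D - D'" for i
          using eq[OF that] by (cases i) simp
      qed (auto simp: D'_def D(1))
      ultimately show "(\<Sum>(x, y)\<in>D. \<bar>f y - f x\<bar>) < \<epsilon>" using \<delta>[of D'] D(4) by simp
    qed fact
  qed
qed

lemma abs_continuousE:
  assumes "abs_continuous_on_interval \<alpha> \<beta> f" "\<epsilon> > 0"
  obtains \<delta> where "\<delta> > 0" "\<And>D. interval_packing \<alpha> \<beta> D \<Longrightarrow> (\<Sum>(x, y)\<in>D. y - x) < \<delta> \<Longrightarrow> (\<Sum>(x, y)\<in>D. \<bar>f y - f x\<bar>) < \<epsilon>"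
  using assms unfolding abs_continuous_iff_packing by meson

lemma interval_packing_mono:
  "interval_packing c d D \<Longrightarrow> \<alpha> \<le> c \<Longrightarrow> d \<le> \<beta> \<Longrightarrow> interval_packing \<alpha> \<beta> D"
  unfolding interval_packing_def by force

lemma interval_packing_singleton: "\<alpha> \<le> x \<Longrightarrow> x < y \<Longrightarrow> y \<le> \<beta> \<Longrightarrow> interval_packing \<alpha> \<beta> {(x, y)}"
  by (simp add: interval_packing_def)

lemma abs_continuous_imp_continuous_on:
  assumes "abs_continuous_on_interval \<alpha> \<beta> f"
  shows "continuous_on {\<alpha>..\<beta>} f"
proof (rule uniformly_continuous_imp_continuous, unfold uniformly_continuous_on_def, intro allI impI)
  fix e :: real assume "e > 0"
  with assms obtain \<delta> where \<delta>: "\<delta> > 0" "\<And>D. interval_packing \<alpha> \<beta> D \<Longrightarrow> (\<Sum>(x, y)\<in>D. y - x) < \<delta> \<Longrightarrow> (\<Sum>(x, y)\<in>D. \<bar>f y - f x\<bar>) < e"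
    using abs_continuousE by blast
  have *: "\<bar>f y - f x\<bar> < e" if "\<alpha> \<le> x" "x < y" "y \<le> \<beta>" "y - x < \<delta>" for x y
    using \<delta>(2)[OF interval_packing_singleton[OF that(1-3)]] that by simp
  have "dist (f x') (f x) < e" if "x \<in> {\<alpha>..\<beta>}" "x' \<in> {\<alpha>..\<beta>}" "dist x' x < \<delta>" for x x'
    using *[of x x'] *[of x' x] that \<open>e > 0\<close> by (cases x x' rule: linorder_cases) (auto simp: dist_real_def)
  then show "\<exists>d>0. \<forall>x\<in>{\<alpha>..\<beta>}. \<forall>x'\<in>{\<alpha>..\<beta>}. dist x' x < d \<longrightarrow> dist (f x') (f x) < e"
    using \<delta>(1) by blast
qed

text \<open>For \<open>\<epsilon> = 1\<close> absolute continuity gives variation at most 1 on every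
  interval shorter than the corresponding \<open>\<delta>\<close>, and differentiability almost
  everywhere is local.\<close>

lemma abs_continuous_differentiable_ae:
  assumes ac: "abs_continuous_on_interval \<alpha> \<beta> f"
  shows "negligible {x\<in>{\<alpha><..<\<beta>}. \<not> f field_differentiable at x}"
proof -
  obtain \<delta> where \<delta>: "\<delta> > 0" "\<And>D. interval_packing \<alpha> \<beta> D \<Longrightarrow> (\<Sum>(x, y)\<in>D. y - x) < \<delta> \<Longrightarrow> (\<Sum>(x, y)\<in>D. \<bar>f y - f x\<bar>) < 1"
    using abs_continuousE[OF ac zero_less_one] by blast
  show ?thesis
  proof (rule negligible_locally[OF _ \<delta>(1)])
    fix c d :: real assume cd: "c < d" "{c..d} \<subseteq> {\<alpha><..<\<beta>}" "d - c < \<delta>"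
    have "c \<in> {c..d}" "d \<in> {c..d}" using cd by auto
    then have "c \<in> {\<alpha><..<\<beta>}" "d \<in> {\<alpha><..<\<beta>}" using cd(2) by blast+
    then have le: "\<alpha> \<le> c" "d \<le> \<beta>" by auto
    show "negligible {x\<in>{c<..<d}. \<not> f field_differentiable at x}"
    proof (rule bounded_variation_differentiable_ae[OF _ cd(1)])
      fix D assume D: "interval_packing c d D"
      have "(\<Sum>(x, y)\<in>D. y - x) < \<delta>" using interval_packing_length_le[OF D] cd by simp
      then show "(\<Sum>(u, v)\<in>D. \<bar>f v - f u\<bar>) \<le> 1"
        using \<delta>(2)[OF interval_packing_mono[OF D le]] by simp
    qed
  qed simp
qed

text \<open>Sums, products and reciprocals of absolutely continuous functions have increments
  controlled in this way, with \<open>L\<close> coming from bounds for the factors; this is the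
  common source of those closure properties.\<close>

lemma abs_continuous_dominated:
  assumes g: "abs_continuous_on_interval \<alpha> \<beta> g" and h: "abs_continuous_on_interval \<alpha> \<beta> h"
    and le: "\<And>x y. \<lbrakk>\<alpha> \<le> x; x < y; y \<le> \<beta>\<rbrakk> \<Longrightarrow> \<bar>f y - f x\<bar> \<le> L * (\<bar>g y - g x\<bar> + \<bar>h y - h x\<bar>)"
  shows "abs_continuous_on_interval \<alpha> \<beta> f"
  unfolding abs_continuous_iff_packing
proof (intro allI impI)
  fix \<epsilon> :: real assume \<epsilon>: "\<epsilon> > 0"
  \<comment> \<open>The added 1 makes the divisor \<open>2 * M\<close> positive whatever
    \<open>L\<close> is.\<close>
  define M where "M = \<bar>L\<bar> + 1"
  have M: "M > 0" "L \<le> M" by (auto simp: M_def)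
  have e: "\<epsilon> / (2 * M) > 0" using \<epsilon> M by simp
  obtain \<delta>1 where \<delta>1: "\<delta>1 > 0" "\<And>D. interval_packing \<alpha> \<beta> D \<Longrightarrow> (\<Sum>(x, y)\<in>D. y - x) < \<delta>1 \<Longrightarrow> (\<Sum>(x, y)\<in>D. \<bar>g y - g x\<bar>) < \<epsilon> / (2 * M)"
    using abs_continuousE[OF g e] by blast
  obtain \<delta>2 where \<delta>2: "\<delta>2 > 0" "\<And>D. interval_packing \<alpha> \<beta> D \<Longrightarrow> (\<Sum>(x, y)\<in>D. y - x) < \<delta>2 \<Longrightarrow> (\<Sum>(x, y)\<in>D. \<bar>h y - h x\<bar>) < \<epsilon> / (2 * M)"
    using abs_continuousE[OF h e] by blast
  show "\<exists>\<delta>>0. \<forall>D. interval_packing \<alpha> \<beta> D \<and> (\<Sum>(x, y)\<in>D. y - x) < \<delta> \<longrightarrow> (\<Sum>(x, y)\<in>D. \<bar>f y - f x\<bar>) < \<epsilon>"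
  proof (intro exI[of _ "min \<delta>1 \<delta>2"] conjI allI impI)
    fix D assume "interval_packing \<alpha> \<beta> D \<and> (\<Sum>(x, y)\<in>D. y - x) < min \<delta>1 \<delta>2"
    then have D: "interval_packing \<alpha> \<beta> D" and len: "(\<Sum>(x, y)\<in>D. y - x) < min \<delta>1 \<delta>2" by blast+
    have "(\<Sum>(x, y)\<in>D. \<bar>f y - f x\<bar>) \<le> (\<Sum>(x, y)\<in>D. M * (\<bar>g y - g x\<bar> + \<bar>h y - h x\<bar>))"
    proof (intro sum_mono, clarify)
      fix x y assume xy: "(x, y) \<in> D"
      have "\<bar>f y - f x\<bar> \<le> L * (\<bar>g y - g x\<bar> + \<bar>h y - h x\<bar>)" using interval_packingD(2-4)[OF D xy] by (rule le)
      also have "\<dots> \<le> M * (\<bar>g y - g x\<bar> + \<bar>h y - h x\<bar>)" using M by (intro mult_right_mono) auto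
      finally show "\<bar>f y - f x\<bar> \<le> M * (\<bar>g y - g x\<bar> + \<bar>h y - h x\<bar>)" .
    qed
    also have "\<dots> = M * ((\<Sum>(x, y)\<in>D. \<bar>g y - g x\<bar>) + (\<Sum>(x, y)\<in>D. \<bar>h y - h x\<bar>))"
      by (simp add: sum_distrib_left[symmetric] sum.distrib split_def)
    also have "\<dots> < M * (\<epsilon> / (2 * M) + \<epsilon> / (2 * M))"
      using \<delta>1(2)[OF D] \<delta>2(2)[OF D] len M by (intro mult_strict_left_mono add_strict_mono) auto
    also have "\<dots> = \<epsilon>" using M by (simp add: field_simps)
    finally show "(\<Sum>(x, y)\<in>D. \<bar>f y - f x\<bar>) < \<epsilon>" .
  qed (use \<delta>1 \<delta>2 in auto)
qed

text \<open>Used with \<open>T\<close> an open set of small measure around a null set, this supplies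
  the length bound that absolute continuity requires.\<close>

lemma interval_packing_length_le_measure:
  assumes D: "interval_packing \<alpha> \<beta> D" and T: "T \<in> lmeasurable" and sub: "\<And>u v. (u, v) \<in> D \<Longrightarrow> {u<..<v} \<subseteq> T"
  shows "(\<Sum>(u, v)\<in>D. v - u) \<le> measure lebesgue T"
proof -
  have "(\<Sum>(u, v)\<in>D. v - u) = (\<Sum>i\<in>D. measure lebesgue {fst i<..<snd i})"
    using interval_packingD(3)[OF D] by (intro sum.cong) (force simp: split_def)+
  also have "\<dots> = measure lebesgue (\<Union>i\<in>D. {fst i<..<snd i})"
  proof (rule measure_finite_Union[symmetric])
    show "disjoint_family_on (\<lambda>i. {fst i<..<snd i}) D"
      unfolding disjoint_family_on_def
    proof (intro ballI impI)
      fix i j assume ij: "i \<in> D" "j \<in> D" "i \<noteq> j"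
      then show "{fst i<..<snd i} \<inter> {fst j<..<snd j} = {}"
        using interval_packingD(3)[OF D, of "fst i" "snd i"] interval_packingD(3)[OF D, of "fst j" "snd j"]
          interval_packingD(5)[OF D, of "fst i" "snd i" "fst j" "snd j"]
        by (subst open_intervals_disjoint_iff) auto
    qed
    show "emeasure lebesgue {fst i<..<snd i} \<noteq> \<infinity>" for i :: "real \<times> real"
    proof -
      have "{fst i<..<snd i} \<in> lmeasurable"
        using lmeasurable_box[of "fst i" "snd i"] by (simp only: box_real)
      then show ?thesis unfolding infinity_ennreal_def by (rule fmeasurableD2)
    qed
  qed (use interval_packingD(1)[OF D] in auto)
  also have "\<dots> \<le> measure lebesgue T"
  proof (rule measure_mono_fmeasurable[OF _ _ T])
    show "(\<Union>i\<in>D. {fst i<..<snd i}) \<subseteq> T" using sub by fastforce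
    show "(\<Union>i\<in>D. {fst i<..<snd i}) \<in> sets lebesgue"
      using interval_packingD(1)[OF D] by (intro sets.finite_UN) auto
  qed
  finally show ?thesis .
qed

section \<open>The fundamental theorem of calculus for absolutely continuous functions\<close>

text \<open>The gauge is adapted to \<open>f\<close>: at tags outside \<open>N\<close> it enforces
  the linear approximation, whose errors add up to at most
  \<open>\<eta> * (\<beta> - \<alpha>)\<close>; at tags in \<open>N\<close> it confines the
  intervals to an open set of measure below \<open>\<delta>\<close>, where absolute continuity makes
  the increments of \<open>f\<close> small. Each kind of tag accounts for half of
  \<open>e\<close>.\<close>

lemma abs_continuous_FTC:
  assumes ac: "abs_continuous_on_interval \<alpha> \<beta> f" and ab: "\<alpha> \<le> \<beta>" and N: "negligible N"
    and der: "\<And>x. x \<in> {\<alpha>..\<beta>} - N \<Longrightarrow> (f has_real_derivative g x) (at x within {\<alpha>..\<beta>})"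
  shows "(g has_integral f \<beta> - f \<alpha>) {\<alpha>..\<beta>}"
proof -
  \<comment> \<open>The value 0 on \<open>N\<close> removes the Riemann terms with tags in
    \<open>N\<close>, so only increments of \<open>f\<close> remain there.\<close>
  define g' where "g' = (\<lambda>x. if x \<in> N then 0 else g x)"
  have "(g' has_integral f \<beta> - f \<alpha>) (cbox \<alpha> \<beta>)"
    unfolding has_integral
  proof (intro allI impI)
    fix e :: real assume e: "e > 0"
    \<comment> \<open>The summand 1 covers the degenerate case
      \<open>\<alpha> = \<beta>\<close>.\<close>
    define \<eta> where "\<eta> = e / (2 * (\<beta> - \<alpha> + 1))"
    have \<eta>: "\<eta> > 0" "\<eta> * (\<beta> - \<alpha>) \<le> e / 2"
      using e ab by (auto simp: \<eta>_def field_simps)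
    obtain \<delta> where \<delta>: "\<delta> > 0" "\<And>D. interval_packing \<alpha> \<beta> D \<Longrightarrow> (\<Sum>(x, y)\<in>D. y - x) < \<delta> \<Longrightarrow> (\<Sum>(x, y)\<in>D. \<bar>f y - f x\<bar>) < e / 2"
      using abs_continuousE[OF ac, of "e / 2"] e by auto
    obtain T where T: "open T" "N \<subseteq> T" "T - N \<in> lmeasurable" "emeasure lebesgue (T - N) < ennreal \<delta>"
      using sets_lebesgue_outer_open[OF negligible_imp_sets[OF N] \<delta>(1)] by blast
    have "T = (T - N) \<union> N" using T(2) by blast
    then have Tm: "T \<in> lmeasurable" using T(3) N by (metis fmeasurable.Un negligible_imp_measurable)
    have "measure lebesgue T \<le> measure lebesgue (T - N) + measure lebesgue N"
      using \<open>T = (T - N) \<union> N\<close> T(3) N by (metis fmeasurableD measure_Un_le negligible_imp_sets)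
    also have "\<dots> < \<delta>"
      using T(3,4) \<delta>(1) negligible_imp_measure0[OF N] by (simp add: emeasure_eq_measure2 ennreal_less_iff)
    finally have T\<delta>: "measure lebesgue T < \<delta>" .
    have "\<exists>d>0. \<forall>y\<in>{\<alpha>..\<beta>}. \<bar>y - x\<bar> < d \<longrightarrow> \<bar>f y - f x - g x * (y - x)\<bar> \<le> \<eta> * \<bar>y - x\<bar>" if "x \<in> {\<alpha>..\<beta>} - N" for x
      using der[OF that] \<eta>(1) unfolding has_field_derivative_def has_derivative_within_alt
      by (auto simp: bounded_linear_mult_right)
    then obtain d where d: "\<And>x. x \<in> {\<alpha>..\<beta>} - N \<Longrightarrow> d x > 0"
      "\<And>x y. \<lbrakk>x \<in> {\<alpha>..\<beta>} - N; y \<in> {\<alpha>..\<beta>}; \<bar>y - x\<bar> < d x\<rbrakk> \<Longrightarrow> \<bar>f y - f x - g x * (y - x)\<bar> \<le> \<eta> * \<bar>y - x\<bar>"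
      by metis
    define \<gamma> where "\<gamma> = (\<lambda>x. if x \<in> N then T else if x \<in> {\<alpha>..\<beta>} then ball x (d x) else ball x 1)"
    have \<gamma>: "gauge \<gamma>" unfolding gauge_def \<gamma>_def using T d(1) by auto
    have main: "norm ((\<Sum>(x, K)\<in>p. measure lborel K *\<^sub>R g' x) - (f \<beta> - f \<alpha>)) < e"
      if p: "p tagged_division_of cbox \<alpha> \<beta>" and fine: "\<gamma> fine p" for p
    proof -
      note pd = tagged_division_ofD[OF p]
      have K: "\<exists>u v. K = {u..v} \<and> u \<le> v \<and> \<alpha> \<le> u \<and> v \<le> \<beta> \<and> u \<le> x \<and> x \<le> v" if xK: "(x, K) \<in> p" for x K
      proof -
        obtain u v where uv: "K = {u..v}" using pd(4)[OF xK] by (auto simp: cbox_interval)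
        have "x \<in> {u..v}" "{u..v} \<subseteq> {\<alpha>..\<beta>}" using pd(2,3)[OF xK] uv by (auto simp: cbox_interval)
        then show ?thesis using uv by auto
      qed
      define p1 where "p1 = {i \<in> p. fst i \<notin> N}"
      define p2 where "p2 = {i \<in> p. fst i \<in> N}"
      have fin: "finite p1" "finite p2" using pd(1) by (auto simp: p1_def p2_def)
      have split: "sum h p = sum h p1 + sum h p2" for h :: "_ \<Rightarrow> real"
      proof -
        have "p = p1 \<union> p2" "p1 \<inter> p2 = {}" by (auto simp: p1_def p2_def)
        then show ?thesis using sum.union_disjoint[OF fin] by auto
      qed
      let ?t = "\<lambda>(x, K). measure lborel K * g' x - (f (Sup K) - f (Inf K))"
      have tel: "(\<Sum>(x, K)\<in>p. h (Sup K) - h (Inf K)) = h \<beta> - h \<alpha>" for h :: "real \<Rightarrow> real"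
        using additive_tagged_division_1[OF ab, of p h] p by (simp add: cbox_interval)
      have b1: "\<bar>sum ?t p1\<bar> \<le> e / 2"
      proof -
        have each: "\<bar>?t i\<bar> \<le> (case i of (x, K) \<Rightarrow> \<eta> * (Sup K - Inf K))" if i: "i \<in> p1" for i
        proof -
          obtain x K where xK: "i = (x, K)" "(x, K) \<in> p" "x \<notin> N" using i by (cases i) (auto simp: p1_def)
          obtain u v where uv: "K = {u..v}" "u \<le> v" "\<alpha> \<le> u" "v \<le> \<beta>" "u \<le> x" "x \<le> v" using K[OF xK(2)] by blast
          have x: "x \<in> {\<alpha>..\<beta>} - N" using uv xK by auto
          have "{u..v} \<subseteq> ball x (d x)" using fineD[OF fine xK(2)] uv x by (simp add: \<gamma>_def)
          moreover have "u \<in> {u..v}" "v \<in> {u..v}" using uv by auto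
          ultimately have "u \<in> ball x (d x)" "v \<in> ball x (d x)" by blast+
          then have near: "\<bar>u - x\<bar> < d x" "\<bar>v - x\<bar> < d x" by (auto simp: dist_real_def)
          \<comment> \<open>The tag lies inside the interval, so the errors on its two sides add up
            to \<open>\<eta>\<close> times the length: this is the straddle lemma.\<close>
          define A B where "A = f u - f x - g x * (u - x)" and "B = f v - f x - g x * (v - x)"
          have "\<bar>A\<bar> \<le> \<eta> * \<bar>u - x\<bar>" "\<bar>B\<bar> \<le> \<eta> * \<bar>v - x\<bar>"
            unfolding A_def B_def by (intro d(2)[OF x] near; use uv in simp)+
          moreover have "\<eta> * \<bar>u - x\<bar> + \<eta> * \<bar>v - x\<bar> = \<eta> * (v - u)" using uv by (simp add: algebra_simps)
          moreover have "(v - u) * g x - (f v - f u) = A - B" by (simp add: A_def B_def algebra_simps)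
          ultimately have "\<bar>(v - u) * g x - (f v - f u)\<bar> \<le> \<eta> * (v - u)" using abs_triangle_ineq4[of A B] by linarith
          then show ?thesis using uv xK by (simp add: g'_def)
        qed
        have "\<bar>sum ?t p1\<bar> \<le> (\<Sum>i\<in>p1. \<bar>?t i\<bar>)" by (rule sum_abs)
        also have "\<dots> \<le> (\<Sum>(x, K)\<in>p1. \<eta> * (Sup K - Inf K))" by (rule sum_mono) (rule each)
        also have "\<dots> \<le> (\<Sum>(x, K)\<in>p. \<eta> * (Sup K - Inf K))"
        proof (rule sum_mono2[OF pd(1)])
          show "0 \<le> (case i of (x, K) \<Rightarrow> \<eta> * (Sup K - Inf K))" if i: "i \<in> p - p1" for i
          proof -
            obtain x L where xL: "i = (x, L)" "(x, L) \<in> p" using i by (cases i) auto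
            then obtain u v where "L = {u..v}" "u \<le> v" using K by blast
            then show ?thesis using \<eta>(1) xL by simp
          qed
        qed (auto simp: p1_def)
        also have "\<dots> = \<eta> * (\<Sum>(x, K)\<in>p. Sup K - Inf K)" by (simp add: sum_distrib_left split_def)
        also have "\<dots> \<le> e / 2" using tel[of "\<lambda>x. x"] \<eta>(2) by simp
        finally show ?thesis .
      qed
      have b2: "\<bar>sum ?t p2\<bar> < e / 2"
      proof -
        \<comment> \<open>Only intervals of positive length are kept: they determine their tags
          within the division and form a packing, while degenerate ones have increment zero.\<close>
        define q where "q = {i \<in> p2. Inf (snd i) < Sup (snd i)}"
        let ?\<phi> = "\<lambda>i :: real \<times> real set. (Inf (snd i), Sup (snd i))"
        have q: "\<exists>u v. snd i = {u..v} \<and> u < v \<and> \<alpha> \<le> u \<and> v \<le> \<beta> \<and> i \<in> p \<and> fst i \<in> N" if i: "i \<in> q" for i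
        proof -
          have ip: "(fst i, snd i) \<in> p" "i \<in> p" "fst i \<in> N" "Inf (snd i) < Sup (snd i)" using i by (auto simp: q_def p2_def)
          obtain u v where "snd i = {u..v}" "u \<le> v" "\<alpha> \<le> u" "v \<le> \<beta>" using K[OF ip(1)] by blast
          then show ?thesis using ip by auto
        qed
        have disj: "Sup (snd i) \<le> Inf (snd j) \<or> Sup (snd j) \<le> Inf (snd i)" if ij: "i \<in> q" "j \<in> q" "i \<noteq> j" for i j
        proof -
          obtain u v where uv: "snd i = {u..v}" "u < v" "i \<in> p" using q[OF ij(1)] by blast
          obtain u' v' where uv': "snd j = {u'..v'}" "u' < v'" "j \<in> p" using q[OF ij(2)] by blast
          have "interior (snd i) \<inter> interior (snd j) = {}"
            using pd(5)[of "fst i" "snd i" "fst j" "snd j"] uv(3) uv'(3) ij(3) by (auto simp: prod_eq_iff)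
          then have "{u<..<v} \<inter> {u'<..<v'} = {}" using uv uv' by (simp add: interior_atLeastAtMost_real)
          then show ?thesis using uv uv' by (subst (asm) open_intervals_disjoint_iff) auto
        qed
        have inj: "inj_on ?\<phi> q"
        proof (rule inj_onI, rule ccontr)
          fix i j assume ij: "i \<in> q" "j \<in> q" "?\<phi> i = ?\<phi> j" "i \<noteq> j"
          then show False using disj[of i j] by (auto simp: q_def)
        qed
        have pack: "interval_packing \<alpha> \<beta> (?\<phi> ` q)"
        proof (rule interval_packingI)
          show "finite (?\<phi> ` q)" using fin by (simp add: q_def)
          show "\<alpha> \<le> x \<and> x < y \<and> y \<le> \<beta>" if "(x, y) \<in> ?\<phi> ` q" for x y
            using that q by fastforce
          show "y \<le> x' \<or> y' \<le> x" if xy: "(x, y) \<in> ?\<phi> ` q" "(x', y') \<in> ?\<phi> ` q" "(x, y) \<noteq> (x', y')" for x y x' y'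
          proof -
            obtain i j where "i \<in> q" "j \<in> q" "(x, y) = ?\<phi> i" "(x', y') = ?\<phi> j" using xy by blast
            then show ?thesis using disj[of i j] xy(3) by auto
          qed
        qed
        have "(\<Sum>(u, v)\<in>?\<phi> ` q. v - u) \<le> measure lebesgue T"
        proof (rule interval_packing_length_le_measure[OF pack Tm])
          fix u v assume "(u, v) \<in> ?\<phi> ` q"
          then obtain i where i: "i \<in> q" "u = Inf (snd i)" "v = Sup (snd i)" by auto
          then obtain u' v' where uv: "snd i = {u'..v'}" "u' < v'" "i \<in> p" "fst i \<in> N" using q by blast
          have "(fst i, snd i) \<in> p" using uv(3) by simp
          then have "snd i \<subseteq> \<gamma> (fst i)" by (rule fineD[OF fine])
          then have "snd i \<subseteq> T" using uv(4) by (simp add: \<gamma>_def)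
          then show "{u<..<v} \<subseteq> T" using uv i by auto
        qed
        then have "(\<Sum>(u, v)\<in>?\<phi> ` q. \<bar>f v - f u\<bar>) < e / 2" using T\<delta> by (intro \<delta>(2)[OF pack]) simp
        then have qb: "(\<Sum>i\<in>q. \<bar>f (Sup (snd i)) - f (Inf (snd i))\<bar>) < e / 2"
          unfolding sum.reindex[OF inj] by simp
        have "\<bar>sum ?t p2\<bar> \<le> (\<Sum>i\<in>p2. \<bar>?t i\<bar>)" by (rule sum_abs)
        also have "\<dots> = (\<Sum>i\<in>p2. \<bar>f (Sup (snd i)) - f (Inf (snd i))\<bar>)"
          by (intro sum.cong) (auto simp: p2_def g'_def)
        also have "\<dots> = (\<Sum>i\<in>q. \<bar>f (Sup (snd i)) - f (Inf (snd i))\<bar>)"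
        proof (rule sum.mono_neutral_right[OF fin(2)])
          show "\<forall>i\<in>p2 - q. \<bar>f (Sup (snd i)) - f (Inf (snd i))\<bar> = 0"
          proof
            fix i assume i: "i \<in> p2 - q"
            then have ip: "(fst i, snd i) \<in> p" "\<not> Inf (snd i) < Sup (snd i)" by (auto simp: p2_def q_def)
            obtain u v where "snd i = {u..v}" "u \<le> v" using K[OF ip(1)] by blast
            then show "\<bar>f (Sup (snd i)) - f (Inf (snd i))\<bar> = 0" using ip by auto
          qed
        qed (auto simp: q_def)
        finally show ?thesis using qb by linarith
      qed
      have "(\<Sum>(x, K)\<in>p. measure lborel K *\<^sub>R g' x) - (f \<beta> - f \<alpha>) = sum ?t p"
        using tel[of f] by (simp add: split_def sum_subtractf)
      then show ?thesis using b1 b2 unfolding split by simp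
    qed
    show "\<exists>\<gamma>. gauge \<gamma> \<and> (\<forall>\<D>. \<D> tagged_division_of cbox \<alpha> \<beta> \<and> \<gamma> fine \<D> \<longrightarrow>
      norm ((\<Sum>(x, k)\<in>\<D>. measure lborel k *\<^sub>R g' x) - (f \<beta> - f \<alpha>)) < e)"
      using \<gamma> by (intro exI[of _ \<gamma>] conjI allI impI main) simp_all
  qed
  then have "(g' has_integral f \<beta> - f \<alpha>) {\<alpha>..\<beta>}" by (simp add: cbox_interval)
  then show ?thesis by (rule has_integral_spike[OF N, rotated]) (simp add: g'_def)
qed

text \<open>By Henstock's lemma the discrepancies
  \<open>\<bar>(v - u) * f x - integral {u..v} f\<bar>\<close> over a fine partial division have
  small sum. On a bad interval of level \<open>n\<close> the discrepancy is at least its length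
  divided by \<open>Suc n\<close>, so disjoint bad intervals have small total length and
  \<open>E n\<close> is negligible.\<close>

lemma indefinite_integral_has_derivative_ae:
  fixes f :: "real \<Rightarrow> real"
  assumes f: "f integrable_on {\<alpha>..\<beta>}"
  shows "negligible {x\<in>{\<alpha><..<\<beta>}. \<not> ((\<lambda>y. integral {\<alpha>..y} f) has_real_derivative f x) (at x)}"
proof -
  let ?bad = "\<lambda>n x u v. \<alpha> \<le> u \<and> u \<le> x \<and> x \<le> v \<and> v \<le> \<beta> \<and> u < v \<and>
    (v - u) / Suc n \<le> \<bar>(v - u) * f x - integral {u..v} f\<bar>"
  define E where "E = (\<lambda>n. {x. \<forall>d>0. \<exists>u v. v - u < d \<and> ?bad n x u v})"
  have "negligible (E n)" for n
  proof (rule negligible_Vitali_packing[of \<alpha> \<beta>])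
    fix e :: real assume "e > 0"
    \<comment> \<open>The tolerance is divided by \<open>Suc n\<close> because the length of a bad
      interval exceeds its discrepancy by at most this factor.\<close>
    then have e: "e / Suc n > 0" by simp
    have fc: "f integrable_on cbox \<alpha> \<beta>" using f by (simp add: cbox_interval)
    obtain \<gamma> where \<gamma>: "gauge \<gamma>" "\<And>p. \<lbrakk>p tagged_partial_division_of cbox \<alpha> \<beta>; \<gamma> fine p\<rbrakk> \<Longrightarrow>
        (\<Sum>(x, K)\<in>p. norm (measure lborel K *\<^sub>R f x - integral K f)) < e / Suc n"
      using Henstock_lemma[OF fc e] by blast
    \<comment> \<open>The tag is quantified inside \<open>K\<close>, since the covering criterion
      handles bare intervals; a tag for each selected interval is recovered by choice.\<close>
    define K where "K = {(u, v). \<exists>x. {u..v} \<subseteq> \<gamma> x \<and> ?bad n x u v}"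
    show "\<exists>K N. K \<subseteq> {(u, v). \<alpha> \<le> u \<and> u < v \<and> v \<le> \<beta>} \<and> negligible N \<and>
     (\<forall>x\<in>E n - N. \<forall>d>0. \<exists>u v. (u, v) \<in> K \<and> u \<le> x \<and> x \<le> v \<and> v - u < d) \<and>
     (\<forall>D\<subseteq>K. interval_packing \<alpha> \<beta> D \<longrightarrow> (\<Sum>(u, v)\<in>D. v - u) \<le> e)"
    proof (intro exI[of _ K] exI[of _ "{}"] conjI)
      show "K \<subseteq> {(u, v). \<alpha> \<le> u \<and> u < v \<and> v \<le> \<beta>}" by (auto simp: K_def)
      show "\<forall>x\<in>E n - {}. \<forall>d>0. \<exists>u v. (u, v) \<in> K \<and> u \<le> x \<and> x \<le> v \<and> v - u < d"
      proof (intro ballI allI impI)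
        fix x d :: real assume x: "x \<in> E n - {}" and d: "0 < d"
        have "open (\<gamma> x)" "x \<in> \<gamma> x" using \<gamma>(1) by (auto simp: gauge_def)
        then obtain r where r: "r > 0" "ball x r \<subseteq> \<gamma> x" using open_contains_ball by blast
        have "min d r > 0" using d r by simp
        moreover have "\<forall>d>0. \<exists>u v. v - u < d \<and> ?bad n x u v" using x by (simp add: E_def)
        ultimately obtain u v where uv: "v - u < min d r" "?bad n x u v" by blast
        have "{u..v} \<subseteq> ball x r" using uv by (auto simp: dist_real_def)
        then have "(u, v) \<in> K" unfolding K_def using r uv(2) by blast
        then show "\<exists>u v. (u, v) \<in> K \<and> u \<le> x \<and> x \<le> v \<and> v - u < d"
          using uv by (intro exI[of _ u] exI[of _ v]) simp
      qed
      show "\<forall>D\<subseteq>K. interval_packing \<alpha> \<beta> D \<longrightarrow> (\<Sum>(u, v)\<in>D. v - u) \<le> e"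
      proof (intro allI impI)
        fix D assume DK: "D \<subseteq> K" and D: "interval_packing \<alpha> \<beta> D"
        have "\<exists>t. \<forall>i\<in>D. {fst i..snd i} \<subseteq> \<gamma> (t i) \<and> ?bad n (t i) (fst i) (snd i)"
          using DK by (intro bchoice) (auto simp: K_def)
        then obtain t where t: "\<And>i. i \<in> D \<Longrightarrow> {fst i..snd i} \<subseteq> \<gamma> (t i)" "\<And>i. i \<in> D \<Longrightarrow> ?bad n (t i) (fst i) (snd i)"
          by blast
        let ?\<phi> = "\<lambda>i. (t i, {fst i..snd i})"
        have inj: "inj_on ?\<phi> D"
        proof (rule inj_onI)
          fix i j assume ij: "i \<in> D" "j \<in> D" "?\<phi> i = ?\<phi> j"
          then have "fst i < snd i" "fst j < snd j" using t(2) by blast+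
          then show "i = j" using ij(3) by (auto simp: Icc_eq_Icc prod_eq_iff)
        qed
        have "?\<phi> ` D tagged_partial_division_of cbox \<alpha> \<beta>"
          unfolding tagged_partial_division_of_def
        proof (intro conjI allI impI)
          show "finite (?\<phi> ` D)" using interval_packingD(1)[OF D] by simp
          fix x K assume "(x, K) \<in> ?\<phi> ` D"
          then obtain i where i: "i \<in> D" "x = t i" "K = {fst i..snd i}" by auto
          show "x \<in> K" "K \<subseteq> cbox \<alpha> \<beta>" "\<exists>a b. K = cbox a b"
            using t(2)[OF i(1)] i by (auto simp: cbox_interval)
        next
          fix x1 K1 x2 K2 assume *: "(x1, K1) \<in> ?\<phi> ` D \<and> (x2, K2) \<in> ?\<phi> ` D \<and> (x1, K1) \<noteq> (x2, K2)"
          then obtain i j where i: "i \<in> D" "K1 = {fst i..snd i}" and j: "j \<in> D" "K2 = {fst j..snd j}" and "i \<noteq> j"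
            by auto
          then have "{fst i<..<snd i} \<inter> {fst j<..<snd j} = {}"
            using interval_packingD(3)[OF D, of "fst i" "snd i"] interval_packingD(3)[OF D, of "fst j" "snd j"]
              interval_packingD(5)[OF D, of "fst i" "snd i" "fst j" "snd j"]
            by (subst open_intervals_disjoint_iff) auto
          then show "interior K1 \<inter> interior K2 = {}" unfolding i j interior_atLeastAtMost_real .
        qed
        moreover have "\<gamma> fine ?\<phi> ` D" using t(1) by (auto simp: fine_def)
        ultimately have "(\<Sum>(x, K)\<in>?\<phi> ` D. norm (measure lborel K *\<^sub>R f x - integral K f)) < e / Suc n"
          by (rule \<gamma>(2))
        then have *: "(\<Sum>i\<in>D. \<bar>measure lborel {fst i..snd i} * f (t i) - integral {fst i..snd i} f\<bar>) < e / Suc n"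
          by (subst (asm) sum.reindex[OF inj]) simp
        have "(\<Sum>(u, v)\<in>D. (v - u) / Suc n) \<le> (\<Sum>i\<in>D. \<bar>measure lborel {fst i..snd i} * f (t i) - integral {fst i..snd i} f\<bar>)"
        proof (rule sum_mono)
          fix i assume i: "i \<in> D"
          show "(case i of (u, v) \<Rightarrow> (v - u) / Suc n) \<le> \<bar>measure lborel {fst i..snd i} * f (t i) - integral {fst i..snd i} f\<bar>"
            using t(2)[OF i] by (simp add: split_def)
        qed
        also have "(\<Sum>(u, v)\<in>D. (v - u) / Suc n) = (\<Sum>(u, v)\<in>D. v - u) / Suc n"
          by (simp add: sum_divide_distrib split_def)
        finally have "(\<Sum>(u, v)\<in>D. v - u) / Suc n < e / Suc n" using * by linarith
        then show "(\<Sum>(u, v)\<in>D. v - u) \<le> e" by (simp add: divide_less_cancel)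
      qed
    qed auto
  qed
  then have "negligible (\<Union>n. E n)" by (intro negligible_countable_Union) auto
  then show ?thesis
  proof (rule negligible_subset)
    show "{x\<in>{\<alpha><..<\<beta>}. \<not> ((\<lambda>y. integral {\<alpha>..y} f) has_real_derivative f x) (at x)} \<subseteq> (\<Union>n. E n)"
    proof (intro subsetI, rule ccontr)
      fix x assume *: "x \<in> {x\<in>{\<alpha><..<\<beta>}. \<not> ((\<lambda>y. integral {\<alpha>..y} f) has_real_derivative f x) (at x)}" "x \<notin> (\<Union>n. E n)"
      let ?F = "\<lambda>y. integral {\<alpha>..y} f"
      have x: "\<alpha> < x" "x < \<beta>" using * by auto
      have F: "?F v - ?F u = integral {u..v} f" if "\<alpha> \<le> u" "u \<le> v" "v \<le> \<beta>" for u v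
      proof -
        have "f integrable_on {\<alpha>..v}" using f by (rule integrable_on_subinterval) (use that in auto)
        then show ?thesis using Henstock_Kurzweil_Integration.integral_combine[of \<alpha> u v f] that by simp
      qed
      have "(?F has_real_derivative f x) (at x)"
        unfolding has_field_derivative_iff
      proof (rule tendstoI)
        fix \<epsilon> :: real assume "\<epsilon> > 0"
        then obtain n where n: "1 / Suc n < \<epsilon>" using nat_approx_posE by blast
        have "x \<notin> E n" using * by blast
        then obtain d where d: "d > 0" "\<And>u v. v - u < d \<Longrightarrow> \<not> ?bad n x u v" unfolding E_def by blast
        define \<eta> where "\<eta> = min d (min (x - \<alpha>) (\<beta> - x))"
        have \<eta>: "\<eta> > 0" using d x by (auto simp: \<eta>_def)
        have slope: "\<bar>(?F v - ?F u) / (v - u) - f x\<bar> < \<epsilon>" if uv: "\<alpha> \<le> u" "u \<le> x" "x \<le> v" "v \<le> \<beta>" "u < v" "v - u < d" for u v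
        proof -
          have "\<bar>(v - u) * f x - integral {u..v} f\<bar> < (v - u) / Suc n" using d(2)[OF uv(6)] uv by auto
          moreover have "\<bar>(?F v - ?F u) / (v - u) - f x\<bar> = \<bar>(v - u) * f x - integral {u..v} f\<bar> / (v - u)"
          proof -
            have "(?F v - ?F u) / (v - u) - f x = - (((v - u) * f x - integral {u..v} f) / (v - u))"
              using F[of u v] uv by (simp add: field_simps)
            then show ?thesis using uv by simp
          qed
          moreover have "0 < v - u" using uv by simp
          ultimately have "\<bar>(?F v - ?F u) / (v - u) - f x\<bar> < ((v - u) / Suc n) / (v - u)"
            by (simp only: divide_strict_right_mono)
          also have "\<dots> = 1 / Suc n" using uv by simp
          finally show ?thesis using n by simp
        qed
        have "dist ((?F y - ?F x) / (y - x)) (f x) < \<epsilon>" if y: "y \<noteq> x" "dist y x < \<eta>" for y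
        proof -
          have sym: "(?F y - ?F x) / (y - x) = (?F x - ?F y) / (x - y)"
            by (metis minus_diff_eq minus_divide_divide)
          have y': "\<bar>y - x\<bar> < \<eta>" using y by (simp add: dist_real_def)
          have "\<bar>(?F y - ?F x) / (y - x) - f x\<bar> < \<epsilon>"
          proof (cases "x < y")
            case True
            then show ?thesis using y' x by (intro slope) (auto simp: \<eta>_def)
          next
            case False
            then show ?thesis unfolding sym using y' x y(1) by (intro slope) (auto simp: \<eta>_def)
          qed
          then show ?thesis by (simp add: dist_real_def)
        qed
        then show "\<forall>\<^sub>F y in at x. dist ((?F y - ?F x) / (y - x)) (f x) < \<epsilon>"
          unfolding eventually_at using \<eta> by (intro exI[of _ \<eta>]) auto
      qed
      then show False using * by blast
    qed
  qed
qed

text \<open>Truncation: \<open>\<bar>f\<bar>\<close> is at most \<open>h n + n\<close>, where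
  \<open>h n\<close> is the excess of \<open>\<bar>f\<bar>\<close> over the height \<open>n\<close>.
  The integral of \<open>h n\<close> tends to 0, which controls the first part over any packing at
  once, and the second part contributes at most \<open>n\<close> times the total length.\<close>

lemma abs_continuous_indefinite_integral:
  fixes f :: "real \<Rightarrow> real"
  assumes f: "f absolutely_integrable_on {\<alpha>..\<beta>}"
    and F: "\<And>u v. \<lbrakk>\<alpha> \<le> u; u \<le> v; v \<le> \<beta>\<rbrakk> \<Longrightarrow> F v - F u = integral {u..v} f"
  shows "abs_continuous_on_interval \<alpha> \<beta> F"
proof (cases "\<alpha> \<le> \<beta>")
  case False
  \<comment> \<open>A reversed interval admits only the empty packing.\<close>
  then have "D = {}" if "interval_packing \<alpha> \<beta> D" for D
    using interval_packingD(2-4)[OF that] by fastforce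
  then show ?thesis unfolding abs_continuous_iff_packing by (metis sum.empty zero_less_one)
next
  case ab: True
  have absf: "(\<lambda>x. \<bar>f x\<bar>) absolutely_integrable_on {\<alpha>..\<beta>}" using f by (rule set_integrable_abs)
  define h where "h = (\<lambda>n x. max 0 (\<bar>f x\<bar> - real n))"
  have h: "h n integrable_on {\<alpha>..\<beta>}" for n
  proof -
    have c: "(\<lambda>x. c) absolutely_integrable_on {\<alpha>..\<beta>}" for c :: real
      by (intro absolutely_integrable_on_const) simp
    have "h n absolutely_integrable_on {\<alpha>..\<beta>}"
      unfolding h_def using c[of 0] set_integral_diff(1)[OF absf c[of "real n"]] by (rule absolutely_integrable_max_1)
    then show ?thesis by (rule set_lebesgue_integral_eq_integral)
  qed
  have absf': "(\<lambda>x. \<bar>f x\<bar>) integrable_on {\<alpha>..\<beta>}" using absf by (rule set_lebesgue_integral_eq_integral)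
  have "(\<lambda>n. integral {\<alpha>..\<beta>} (h n)) \<longlonglongrightarrow> integral {\<alpha>..\<beta>} (\<lambda>x. 0)"
  proof (rule dominated_convergence(2)[OF h absf'])
    show "norm (h n x) \<le> \<bar>f x\<bar>" for n x by (auto simp: h_def)
    show "(\<lambda>n. h n x) \<longlonglongrightarrow> 0" for x
    proof (rule tendsto_eventually)
      obtain N where "\<bar>f x\<bar> \<le> real N" using real_arch_simple by blast
      then show "\<forall>\<^sub>F n in sequentially. h n x = 0"
        unfolding h_def by (intro eventually_sequentiallyI[of N]) auto
    qed
  qed
  then have lim: "(\<lambda>n. integral {\<alpha>..\<beta>} (h n)) \<longlonglongrightarrow> 0" by simp
  show ?thesis
    unfolding abs_continuous_iff_packing
  proof (intro allI impI)
    fix \<epsilon> :: real assume \<epsilon>: "\<epsilon> > 0"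
    then have "\<forall>\<^sub>F n in sequentially. integral {\<alpha>..\<beta>} (h n) < \<epsilon> / 2" using lim by (intro order_tendstoD(2)) auto
    then obtain n where n: "integral {\<alpha>..\<beta>} (h n) < \<epsilon> / 2" unfolding eventually_sequentially by blast
    \<comment> \<open>The \<open>+ 1\<close> avoids division by zero when \<open>n = 0\<close>; the
      choice gives \<open>real n * \<delta> \<le> \<epsilon> / 2\<close>.\<close>
    define \<delta> where "\<delta> = \<epsilon> / (2 * (real n + 1))"
    have \<delta>: "\<delta> > 0" "real n * \<delta> \<le> \<epsilon> / 2" using \<epsilon> by (auto simp: \<delta>_def field_simps)
    show "\<exists>\<delta>>0. \<forall>D. interval_packing \<alpha> \<beta> D \<and> (\<Sum>(x, y)\<in>D. y - x) < \<delta> \<longrightarrow> (\<Sum>(x, y)\<in>D. \<bar>F y - F x\<bar>) < \<epsilon>"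
    proof (intro exI[of _ \<delta>] conjI allI impI)
      fix D assume "interval_packing \<alpha> \<beta> D \<and> (\<Sum>(x, y)\<in>D. y - x) < \<delta>"
      then have D: "interval_packing \<alpha> \<beta> D" and len: "(\<Sum>(x, y)\<in>D. y - x) < \<delta>" by blast+
      define H where "H = (\<lambda>x. integral {\<alpha>..x} (h n))"
      have sub: "g integrable_on {u..v}" if "g integrable_on {\<alpha>..\<beta>}" "\<alpha> \<le> u" "v \<le> \<beta>" for g :: "real \<Rightarrow> real" and u v
        using that(1) by (rule integrable_on_subinterval) (use that in auto)
      have H: "H v - H u = integral {u..v} (h n)" if "\<alpha> \<le> u" "u \<le> v" "v \<le> \<beta>" for u v
        using Henstock_Kurzweil_Integration.integral_combine[of \<alpha> u v "h n"] sub[OF h[of n], of \<alpha> v] that by (simp add: H_def)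
      have Hpos: "0 \<le> H v - H u" if "\<alpha> \<le> u" "u \<le> v" "v \<le> \<beta>" for u v
        unfolding H[OF that]
        by (rule Henstock_Kurzweil_Integration.integral_nonneg[OF sub[OF h that(1,3)]]) (simp add: h_def)
      have each: "\<bar>F v - F u\<bar> \<le> (H v - H u) + real n * (v - u)" if uv: "\<alpha> \<le> u" "u < v" "v \<le> \<beta>" for u v
      proof -
        have le: "u \<le> v" using uv by simp
        have fi: "f integrable_on {u..v}" by (rule sub[OF set_lebesgue_integral_eq_integral(1)[OF f] uv(1,3)])
        have hi: "h n integrable_on {u..v}" by (rule sub[OF h uv(1,3)])
        have "\<bar>integral {u..v} f\<bar> \<le> integral {u..v} (\<lambda>x. h n x + real n)"
          using Henstock_Kurzweil_Integration.integral_norm_bound_integral[OF fi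
              Henstock_Kurzweil_Integration.integrable_add[OF hi integrable_const_ivl[of "real n"]]]
          by (simp add: h_def)
        also have "\<dots> = integral {u..v} (h n) + real n * (v - u)"
          using hi le by (subst Henstock_Kurzweil_Integration.integral_add) auto
        finally show ?thesis using F[of u v] H[of u v] uv by simp
      qed
      obtain D' where D': "interval_packing \<alpha> \<beta> (D \<union> D')" "D \<inter> D' = {}"
        "\<And>f :: real \<Rightarrow> real. (\<Sum>(u, v)\<in>D \<union> D'. f v - f u) = f \<beta> - f \<alpha>"
        by (rule interval_packing_complete[OF D ab]) metis
      have "(\<Sum>(x, y)\<in>D. \<bar>F y - F x\<bar>) \<le> (\<Sum>(u, v)\<in>D. (H v - H u) + real n * (v - u))"
        using each interval_packingD(2-4)[OF D] by (intro sum_mono) auto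
      also have "\<dots> = (\<Sum>(u, v)\<in>D. H v - H u) + real n * (\<Sum>(u, v)\<in>D. v - u)"
        by (simp add: sum.distrib sum_distrib_left split_def)
      \<comment> \<open>\<open>H\<close> is nondecreasing, so completing the packing to a partition
        can only increase the sum, which then telescopes to the full integral of
        \<open>h n\<close>.\<close>
      also have "(\<Sum>(u, v)\<in>D. H v - H u) \<le> (\<Sum>(u, v)\<in>D \<union> D'. H v - H u)"
      proof (rule sum_mono2)
        show "0 \<le> (case i of (u, v) \<Rightarrow> H v - H u)" if i: "i \<in> D \<union> D' - D" for i
        proof -
          obtain u v where uv: "i = (u, v)" by (cases i)
          then have "(u, v) \<in> D \<union> D'" using i by auto
          then show ?thesis using Hpos[of u v] interval_packingD(2-4)[OF D'(1), of u v] uv by simp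
        qed
      qed (use interval_packingD(1)[OF D'(1)] in auto)
      also have "\<dots> = H \<beta> - H \<alpha>" by (rule D'(3))
      also have "\<dots> = integral {\<alpha>..\<beta>} (h n)" using H ab by simp
      finally have "(\<Sum>(x, y)\<in>D. \<bar>F y - F x\<bar>) \<le> integral {\<alpha>..\<beta>} (h n) + real n * (\<Sum>(u, v)\<in>D. v - u)" by simp
      moreover have "real n * (\<Sum>(u, v)\<in>D. v - u) \<le> real n * \<delta>" using len by (intro mult_left_mono) auto
      ultimately show "(\<Sum>(x, y)\<in>D. \<bar>F y - F x\<bar>) < \<epsilon>" using n \<delta>(2) by linarith
    qed (rule \<delta>)
  qed
qed

section \<open>Closure of absolute continuity under algebraic operations\<close>

lemma abs_continuous_const: "abs_continuous_on_interval \<alpha> \<beta> (\<lambda>x. c)"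
  unfolding abs_continuous_iff_packing by (auto intro: exI[of _ 1])

lemma abs_continuous_bounded:
  assumes "abs_continuous_on_interval \<alpha> \<beta> f"
  obtains M where "M > 0" "\<And>x. x \<in> {\<alpha>..\<beta>} \<Longrightarrow> \<bar>f x\<bar> \<le> M"
proof -
  have "bounded (f ` {\<alpha>..\<beta>})"
    by (intro compact_imp_bounded compact_continuous_image abs_continuous_imp_continuous_on assms) simp
  then show thesis using that unfolding bounded_pos by force
qed

lemma abs_continuous_add:
  assumes "abs_continuous_on_interval \<alpha> \<beta> f" "abs_continuous_on_interval \<alpha> \<beta> g"
  shows "abs_continuous_on_interval \<alpha> \<beta> (\<lambda>x. f x + g x)"
  by (rule abs_continuous_dominated[OF assms, of _ 1]) simp

lemma abs_continuous_mult:
  assumes f: "abs_continuous_on_interval \<alpha> \<beta> f" and g: "abs_continuous_on_interval \<alpha> \<beta> g"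
  shows "abs_continuous_on_interval \<alpha> \<beta> (\<lambda>x. f x * g x)"
proof -
  obtain M where M: "M > 0" "\<And>x. x \<in> {\<alpha>..\<beta>} \<Longrightarrow> \<bar>f x\<bar> \<le> M" using abs_continuous_bounded[OF f] by blast
  obtain M' where M': "M' > 0" "\<And>x. x \<in> {\<alpha>..\<beta>} \<Longrightarrow> \<bar>g x\<bar> \<le> M'" using abs_continuous_bounded[OF g] by blast
  show ?thesis
  proof (rule abs_continuous_dominated[OF f g, of _ "max M M'"])
    fix x y assume xy: "\<alpha> \<le> x" "x < y" "y \<le> \<beta>"
    have "f y * g y - f x * g x = (f y - f x) * g y + f x * (g y - g x)" by (simp add: algebra_simps)
    then have "\<bar>f y * g y - f x * g x\<bar> \<le> \<bar>g y\<bar> * \<bar>f y - f x\<bar> + \<bar>f x\<bar> * \<bar>g y - g x\<bar>"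
      by (metis abs_mult abs_triangle_ineq mult.commute)
    also have "\<dots> \<le> max M M' * \<bar>f y - f x\<bar> + max M M' * \<bar>g y - g x\<bar>"
      using M(2)[of x] M'(2)[of y] xy by (intro add_mono mult_right_mono) auto
    finally show "\<bar>f y * g y - f x * g x\<bar> \<le> max M M' * (\<bar>f y - f x\<bar> + \<bar>g y - g x\<bar>)" by (simp add: algebra_simps)
  qed
qed

lemma abs_continuous_inverse:
  assumes f: "abs_continuous_on_interval \<alpha> \<beta> f" and nz: "\<And>x. x \<in> {\<alpha>..\<beta>} \<Longrightarrow> f x \<noteq> 0"
  shows "abs_continuous_on_interval \<alpha> \<beta> (\<lambda>x. inverse (f x))"
proof -
  have "continuous_on {\<alpha>..\<beta>} (\<lambda>x. inverse (f x))"
    using nz by (intro continuous_on_inverse abs_continuous_imp_continuous_on f) auto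
  then have "bounded ((\<lambda>x. inverse (f x)) ` {\<alpha>..\<beta>})"
    by (intro compact_imp_bounded compact_continuous_image) auto
  then obtain M where M: "M > 0" "\<And>x. x \<in> {\<alpha>..\<beta>} \<Longrightarrow> \<bar>inverse (f x)\<bar> \<le> M"
    unfolding bounded_pos by force
  show ?thesis
  proof (rule abs_continuous_dominated[OF f abs_continuous_const[of _ _ 0], of _ "M * M"])
    fix x y assume xy: "\<alpha> \<le> x" "x < y" "y \<le> \<beta>"
    have "inverse (f y) - inverse (f x) = - (inverse (f y) * inverse (f x) * (f y - f x))"
      using nz[of x] nz[of y] xy by (simp add: field_simps)
    then have "\<bar>inverse (f y) - inverse (f x)\<bar> = \<bar>inverse (f y)\<bar> * \<bar>inverse (f x)\<bar> * \<bar>f y - f x\<bar>"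
      by (simp only: abs_minus_cancel abs_mult)
    also have "\<dots> \<le> M * M * \<bar>f y - f x\<bar>"
      using M(2)[of x] M(2)[of y] M(1) xy by (intro mult_right_mono mult_mono) auto
    finally show "\<bar>inverse (f y) - inverse (f x)\<bar> \<le> M * M * (\<bar>f y - f x\<bar> + \<bar>0 - 0\<bar>)" by simp
  qed
qed

section \<open>Locally absolutely continuous functions and primitives\<close>

lemma einterval_Icc_subset: "\<lbrakk>u \<in> einterval a b; v \<in> einterval a b\<rbrakk> \<Longrightarrow> {u..v} \<subseteq> einterval a b"
  by (auto simp: einterval_iff) (meson ereal_less_eq(3) less_le_trans le_less_trans)+

text \<open>Membership in \<open>AC_loc\<close> also speaks of reversed endpoints, where
  \<open>{u..v}\<close> is empty and the only packing is the empty one, so genuine intervals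
  suffice.\<close>

lemma AC_locI:
  assumes "\<And>u v. \<lbrakk>u \<in> einterval a b; v \<in> einterval a b; u \<le> v\<rbrakk> \<Longrightarrow> abs_continuous_on_interval u v f"
  shows "f \<in> AC_loc a b"
  unfolding AC_loc_def
proof (intro CollectI allI impI)
  fix u v assume sub: "{u..v} \<subseteq> einterval a b"
  show "abs_continuous_on_interval u v f"
  proof (cases "u \<le> v")
    case True
    then have "u \<in> {u..v}" "v \<in> {u..v}" by auto
    then show ?thesis using sub True assms by blast
  next
    case False
    then have "D = {}" if "interval_packing u v D" for D
      using interval_packingD(2-4)[OF that] by fastforce
    then show ?thesis unfolding abs_continuous_iff_packing by (metis sum.empty zero_less_one)
  qed
qed

lemma AC_locD:
  "\<lbrakk>f \<in> AC_loc a b; u \<in> einterval a b; v \<in> einterval a b\<rbrakk> \<Longrightarrow> abs_continuous_on_interval u v f"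
  unfolding AC_loc_def using einterval_Icc_subset by blast

lemma AC_loc_const: "(\<lambda>x. c) \<in> AC_loc a b"
  by (intro AC_locI abs_continuous_const)

lemma AC_loc_add: "f \<in> AC_loc a b \<Longrightarrow> g \<in> AC_loc a b \<Longrightarrow> (\<lambda>x. f x + g x) \<in> AC_loc a b"
  by (rule AC_locI, rule abs_continuous_add) (rule AC_locD; assumption)+

lemma AC_loc_mult: "f \<in> AC_loc a b \<Longrightarrow> g \<in> AC_loc a b \<Longrightarrow> (\<lambda>x. f x * g x) \<in> AC_loc a b"
  by (rule AC_locI, rule abs_continuous_mult) (rule AC_locD; assumption)+

lemma AC_loc_cmult: "f \<in> AC_loc a b \<Longrightarrow> (\<lambda>x. c * f x) \<in> AC_loc a b"
  by (intro AC_loc_mult AC_loc_const)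

lemma AC_loc_diff: "f \<in> AC_loc a b \<Longrightarrow> g \<in> AC_loc a b \<Longrightarrow> (\<lambda>x. f x - g x) \<in> AC_loc a b"
  using AC_loc_add[OF _ AC_loc_cmult[of g a b "- 1"], of f] by simp

lemma AC_loc_power: "f \<in> AC_loc a b \<Longrightarrow> (\<lambda>x. f x ^ n) \<in> AC_loc a b"
  by (induction n) (auto intro: AC_loc_const AC_loc_mult)

lemma AC_loc_divide:
  assumes "f \<in> AC_loc a b" "g \<in> AC_loc a b" "\<And>x. x \<in> einterval a b \<Longrightarrow> g x \<noteq> 0"
  shows "(\<lambda>x. f x / g x) \<in> AC_loc a b"
proof -
  have "(\<lambda>x. inverse (g x)) \<in> AC_loc a b"
  proof (rule AC_locI)
    fix u v assume uv: "u \<in> einterval a b" "v \<in> einterval a b"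
    show "abs_continuous_on_interval u v (\<lambda>x. inverse (g x))"
      by (rule abs_continuous_inverse[OF AC_locD[OF assms(2) uv]]) (use assms(3) einterval_Icc_subset[OF uv] in blast)
  qed
  then show ?thesis unfolding divide_inverse by (intro AC_loc_mult assms)
qed

lemma AC_loc_mono: "f \<in> AC_loc a b \<Longrightarrow> einterval a' b' \<subseteq> einterval a b \<Longrightarrow> f \<in> AC_loc a' b'"
  by (rule AC_locI, rule AC_locD[of f a b]) auto

lemma AC_loc_continuous_on:
  assumes "f \<in> AC_loc a b"
  shows "continuous_on (einterval a b) f"
proof (intro continuous_at_imp_continuous_on ballI)
  fix x assume "x \<in> einterval a b"
  then obtain e where e: "e > 0" "cball x e \<subseteq> einterval a b"
    using open_contains_cball[of "einterval a b"] by auto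
  then have "x - e \<in> einterval a b" "x + e \<in> einterval a b" by (auto simp: subset_iff dist_real_def)
  then have "continuous_on {x - e..x + e} f" by (intro abs_continuous_imp_continuous_on AC_locD[OF assms])
  then show "isCont f x" using e(1) by (auto simp: continuous_on_interior)
qed

lemma AC_loc_has_deriv_ae:
  assumes "f \<in> AC_loc a b"
  shows "AE x\<in>einterval a b in lebesgue. (f has_real_derivative deriv f x) (at x)"
proof -
  have "negligible {x\<in>einterval a b. \<not> f field_differentiable at x}"
  proof (rule negligible_locally[OF _ zero_less_one])
    fix c d :: real assume cd: "c < d" "{c..d} \<subseteq> einterval a b"
    have "c \<in> {c..d}" "d \<in> {c..d}" using cd by auto
    then have "abs_continuous_on_interval c d f" using cd(2) by (intro AC_locD[OF assms]) blast+
    then show "negligible {x\<in>{c<..<d}. \<not> f field_differentiable at x}"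
      by (rule abs_continuous_differentiable_ae)
  qed simp
  then have "AE x\<in>einterval a b in lebesgue. f field_differentiable at x"
    by (simp add: AE_lebesgue_iff_negligible)
  then show ?thesis by eventually_elim (simp add: DERIV_deriv_iff_field_differentiable)
qed

lemma AC_loc_FTC:
  assumes F: "F \<in> AC_loc a b" and der: "AE x\<in>einterval a b in lebesgue. (F has_real_derivative f x) (at x)"
    and uv: "u \<in> einterval a b" "v \<in> einterval a b" "u \<le> v"
  shows "(f has_integral F v - F u) {u..v}"
proof (rule abs_continuous_FTC[OF AC_locD[OF F uv(1,2)] uv(3)])
  show "negligible {x\<in>einterval a b. \<not> (F has_real_derivative f x) (at x)}"
    using der by (simp add: AE_lebesgue_iff_negligible)
  fix x assume "x \<in> {u..v} - {x\<in>einterval a b. \<not> (F has_real_derivative f x) (at x)}"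
  then have "(F has_real_derivative f x) (at x)" using einterval_Icc_subset[OF uv(1,2)] by blast
  then show "(F has_real_derivative f x) (at x within {u..v})" by (rule has_field_derivative_at_within)
qed

text \<open>By the fundamental theorem all increments are integrals of 0. This is how Wronskians are
  shown to be constant.\<close>

lemma AC_loc_constant:
  assumes F: "F \<in> AC_loc a b" and der: "AE x\<in>einterval a b in lebesgue. (F has_real_derivative 0) (at x)"
    and uv: "u \<in> einterval a b" "v \<in> einterval a b"
  shows "F u = F v"
proof -
  have "F y = F x" if "x \<in> einterval a b" "y \<in> einterval a b" "x \<le> y" for x y
    using AC_loc_FTC[OF F der that] by (auto simp: has_integral_0_eq)
  then show ?thesis using uv by (metis linear)
qed

section \<open>Local integrability\<close>

text \<open>A nonempty compact subset lies between its minimum and its maximum, both of which belong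
  to the interval.\<close>

lemma locally_integrable_onI:
  assumes "\<And>u v. \<lbrakk>u \<in> einterval a b; v \<in> einterval a b; u \<le> v\<rbrakk> \<Longrightarrow> f absolutely_integrable_on {u..v}"
  shows "locally_integrable_on f (einterval a b)"
  unfolding locally_integrable_on_def
proof (intro allI impI, elim conjE)
  fix K :: "real set" assume K: "compact K" "K \<subseteq> einterval a b"
  show "f absolutely_integrable_on K"
  proof (cases "K = {}")
    case False
    obtain u where u: "u \<in> K" "\<And>x. x \<in> K \<Longrightarrow> u \<le> x" using compact_attains_inf[OF K(1) False] by blast
    obtain v where v: "v \<in> K" "\<And>x. x \<in> K \<Longrightarrow> x \<le> v" using compact_attains_sup[OF K(1) False] by blast
    have "f absolutely_integrable_on {u..v}" using u v K(2) by (intro assms) auto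
    then show ?thesis
      by (rule set_integrable_subset) (use u v K in \<open>auto simp: lmeasurable_compact fmeasurableD\<close>)
  qed simp
qed

lemma locally_integrable_onD:
  "\<lbrakk>locally_integrable_on f (einterval a b); u \<in> einterval a b; v \<in> einterval a b\<rbrakk> \<Longrightarrow> f absolutely_integrable_on {u..v}"
  unfolding locally_integrable_on_def using einterval_Icc_subset by (metis compact_Icc)

lemma locally_integrable_on_add:
  assumes "locally_integrable_on f (einterval a b)" "locally_integrable_on g (einterval a b)"
  shows "locally_integrable_on (\<lambda>x. f x + g x) (einterval a b)"
  by (rule locally_integrable_onI, rule set_integral_add) (rule locally_integrable_onD, rule assms, assumption+)+

lemma locally_integrable_on_abs:
  fixes f :: "real \<Rightarrow> real"
  assumes "locally_integrable_on f (einterval a b)"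
  shows "locally_integrable_on (\<lambda>x. \<bar>f x\<bar>) (einterval a b)"
  by (rule locally_integrable_onI, rule set_integrable_abs, rule locally_integrable_onD, rule assms)

lemma locally_integrable_on_mult:
  assumes "continuous_on (einterval a b) g" "locally_integrable_on f (einterval a b)"
  shows "locally_integrable_on (\<lambda>x. g x * f x) (einterval a b)"
proof (rule locally_integrable_onI)
  fix u v assume uv: "u \<in> einterval a b" "v \<in> einterval a b" "u \<le> v"
  have c: "continuous_on {u..v} g" by (rule continuous_on_subset[OF assms(1) einterval_Icc_subset[OF uv(1,2)]])
  show "(\<lambda>x. g x * f x) absolutely_integrable_on {u..v}"
  proof (rule absolutely_integrable_bounded_measurable_product_real)
    show "g \<in> borel_measurable (lebesgue_on {u..v})" using c by (intro continuous_imp_measurable_on_sets_lebesgue) auto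
    show "bounded (g ` {u..v})" using c by (intro compact_imp_bounded compact_continuous_image) auto
    show "f absolutely_integrable_on {u..v}" by (rule locally_integrable_onD[OF assms(2) uv(1,2)])
  qed simp
qed

lemma locally_integrable_on_cmult:
  "locally_integrable_on f (einterval a b) \<Longrightarrow> locally_integrable_on (\<lambda>x. c * f x) (einterval a b)"
  by (intro locally_integrable_on_mult) simp_all

section \<open>Primitives and their growth under iteration\<close>

definition primitive :: "real \<Rightarrow> (real \<Rightarrow> real) \<Rightarrow> real \<Rightarrow> real"
  where "primitive x0 f x = (if x0 \<le> x then integral {x0..x} f else - integral {x..x0} f)"

lemma primitive_self [simp]: "primitive x0 f x0 = 0"
  by (simp add: primitive_def)

lemma primitive_diff:
  assumes f: "locally_integrable_on f (einterval a b)" and x0: "x0 \<in> einterval a b"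
    and uv: "u \<in> einterval a b" "v \<in> einterval a b" "u \<le> v"
  shows "primitive x0 f v - primitive x0 f u = integral {u..v} f"
proof -
  have i: "f integrable_on {x..y}" if "x \<in> einterval a b" "y \<in> einterval a b" for x y
    using locally_integrable_onD[OF f that] by (rule set_lebesgue_integral_eq_integral)
  note c = Henstock_Kurzweil_Integration.integral_combine
  consider "x0 \<le> u" | "u < x0" "x0 \<le> v" | "v < x0" by linarith
  then show ?thesis
  proof cases
    case 1
    then show ?thesis using c[of x0 u v f] i[OF x0 uv(2)] uv(3) by (simp add: primitive_def)
  next
    case 2
    then show ?thesis using c[of u x0 v f] i[OF uv(1,2)] by (simp add: primitive_def)
  next
    case 3
    then show ?thesis using c[of u v x0 f] i[OF uv(1) x0] uv(3) by (simp add: primitive_def)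
  qed
qed

lemma primitive_AC_loc:
  assumes "locally_integrable_on f (einterval a b)" "x0 \<in> einterval a b"
  shows "primitive x0 f \<in> AC_loc a b"
proof (intro AC_locI abs_continuous_indefinite_integral)
  fix u v assume uv: "u \<in> einterval a b" "v \<in> einterval a b"
  show "f absolutely_integrable_on {u..v}" by (rule locally_integrable_onD[OF assms(1) uv])
  fix u' v' assume "u \<le> u'" "u' \<le> v'" "v' \<le> v"
  then show "primitive x0 f v' - primitive x0 f u' = integral {u'..v'} f"
    using einterval_Icc_subset[OF uv] by (intro primitive_diff[OF assms]) auto
qed

lemma primitive_has_derivative_ae:
  assumes f: "locally_integrable_on f (einterval a b)" and x0: "x0 \<in> einterval a b"
  shows "AE x\<in>einterval a b in lebesgue. (primitive x0 f has_real_derivative f x) (at x)"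
  unfolding AE_lebesgue_iff_negligible
proof (rule negligible_locally[OF _ zero_less_one])
  fix c d :: real assume cd: "c < d" "{c..d} \<subseteq> einterval a b"
  have "c \<in> {c..d}" "d \<in> {c..d}" using cd by auto
  then have cd': "c \<in> einterval a b" "d \<in> einterval a b" using cd(2) by blast+
  have "f integrable_on {c..d}" using locally_integrable_onD[OF f cd'] by (rule set_lebesgue_integral_eq_integral)
  then have "negligible {x\<in>{c<..<d}. \<not> ((\<lambda>y. integral {c..y} f) has_real_derivative f x) (at x)}"
    by (rule indefinite_integral_has_derivative_ae)
  then show "negligible {x\<in>{c<..<d}. \<not> (primitive x0 f has_real_derivative f x) (at x)}"
  proof (rule negligible_subset, intro subsetI)
    fix x assume x: "x \<in> {x\<in>{c<..<d}. \<not> (primitive x0 f has_real_derivative f x) (at x)}"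
    have "(primitive x0 f has_real_derivative f x) (at x)"
      if der: "((\<lambda>y. integral {c..y} f) has_real_derivative f x) (at x)"
    proof -
      have "((\<lambda>y. primitive x0 f c + integral {c..y} f) has_real_derivative 0 + f x) (at x)"
        by (intro DERIV_add DERIV_const der)
      then have d': "((\<lambda>y. primitive x0 f c + integral {c..y} f) has_real_derivative f x) (at x)" by simp
      show ?thesis
      proof (rule has_field_derivative_transform_within_open[OF d'])
        show "x \<in> {c<..<d}" using x by simp
        fix y assume "y \<in> {c<..<d}"
        then have "y \<in> einterval a b" "c \<le> y" using cd(2) by auto
        then show "primitive x0 f c + integral {c..y} f = primitive x0 f y"
          using primitive_diff[OF f x0 cd'(1), of y] by simp
      qed simp
    qed
    then show "x \<in> {x\<in>{c<..<d}. \<not> ((\<lambda>y. integral {c..y} f) has_real_derivative f x) (at x)}" using x by blast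
  qed
qed simp

text \<open>\<open>H ^ Suc n / Suc n\<close> is locally absolutely continuous with derivative
  \<open>h * H ^ n\<close> almost everywhere. Iterating this rule produces the factorials in the
  Picard bound.\<close>

lemma primitive_power:
  assumes h: "locally_integrable_on h (einterval a b)" and x0: "x0 \<in> einterval a b" and x: "x \<in> einterval a b"
  shows "primitive x0 (\<lambda>t. h t * primitive x0 h t ^ n) x = primitive x0 h x ^ Suc n / Suc n"
proof -
  let ?H = "primitive x0 h"
  have AC: "(\<lambda>t. 1 / Suc n * ?H t ^ Suc n) \<in> AC_loc a b"
    by (intro AC_loc_cmult AC_loc_power primitive_AC_loc h x0)
  have der: "AE t\<in>einterval a b in lebesgue. ((\<lambda>t. 1 / Suc n * ?H t ^ Suc n) has_real_derivative h t * ?H t ^ n) (at t)"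
    using primitive_has_derivative_ae[OF h x0]
  proof eventually_elim
    case (elim t)
    show ?case
    proof
      assume "t \<in> einterval a b"
      then have d: "(?H has_real_derivative h t) (at t)" using elim by blast
      show "((\<lambda>t. 1 / Suc n * ?H t ^ Suc n) has_real_derivative h t * ?H t ^ n) (at t)"
        by (rule DERIV_cong[OF DERIV_cmult[OF DERIV_power[OF d]]]) (simp add: field_simps)
    qed
  qed
  note F = AC_loc_FTC[OF AC der, THEN integral_unique]
  show ?thesis
  proof (cases "x0 \<le> x")
    case True
    then show ?thesis using F[OF x0 x True] by (simp add: primitive_def)
  next
    case False
    then have "x \<le> x0" by simp
    then show ?thesis using F[OF x x0 \<open>x \<le> x0\<close>] False by (simp add: primitive_def)
  qed
qed

lemma primitive_nonneg:
  assumes h: "locally_integrable_on h (einterval a b)" and x0: "x0 \<in> einterval a b" and x: "x \<in> einterval a b"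
    and pos: "\<And>t. 0 \<le> h t"
  shows "x0 \<le> x \<Longrightarrow> 0 \<le> primitive x0 h x" "x \<le> x0 \<Longrightarrow> primitive x0 h x \<le> 0"
proof -
  have i: "h integrable_on {x..y}" if "x \<in> einterval a b" "y \<in> einterval a b" for x y
    using locally_integrable_onD[OF h that] by (rule set_lebesgue_integral_eq_integral)
  show "x0 \<le> x \<Longrightarrow> 0 \<le> primitive x0 h x" "x \<le> x0 \<Longrightarrow> primitive x0 h x \<le> 0"
    using Henstock_Kurzweil_Integration.integral_nonneg[OF i[OF x0 x]]
      Henstock_Kurzweil_Integration.integral_nonneg[OF i[OF x x0]] pos
    by (auto simp: primitive_def)
qed

text \<open>One Picard step: a bound by \<open>h\<close> times the \<open>n\<close>-th power of
  \<open>\<bar>H\<bar>\<close> integrates to the next power divided by \<open>Suc n\<close>. The two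
  sides of \<open>x0\<close> are treated separately because \<open>H\<close> is nonnegative to the
  right and nonpositive to the left.\<close>

lemma primitive_power_bound:
  assumes h: "locally_integrable_on h (einterval a b)" and x0: "x0 \<in> einterval a b" and x: "x \<in> einterval a b"
    and pos: "\<And>t. 0 \<le> h t" and w: "locally_integrable_on w (einterval a b)"
    and le: "\<And>t. t \<in> einterval a b \<Longrightarrow> \<bar>w t\<bar> \<le> M * (h t * \<bar>primitive x0 h t\<bar> ^ n)"
  shows "\<bar>primitive x0 w x\<bar> \<le> M * (\<bar>primitive x0 h x\<bar> ^ Suc n / Suc n)"
proof -
  let ?H = "primitive x0 h"
  have cont: "continuous_on (einterval a b) ?H" by (intro AC_loc_continuous_on primitive_AC_loc h x0)
  have "locally_integrable_on (\<lambda>t. ?H t ^ n * h t) (einterval a b)"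
    by (intro locally_integrable_on_mult h continuous_intros cont)
  then have hH: "locally_integrable_on (\<lambda>t. h t * ?H t ^ n) (einterval a b)" by (simp add: mult.commute)
  have i: "f integrable_on {x..y}" if "locally_integrable_on f (einterval a b)" "x \<in> einterval a b" "y \<in> einterval a b" for f x y
    using locally_integrable_onD[OF that] by (rule set_lebesgue_integral_eq_integral)
  show ?thesis
  proof (cases "x0 \<le> x")
    case True
    have "\<bar>primitive x0 w x\<bar> = norm (integral {x0..x} w)" using True by (simp add: primitive_def)
    also have "\<dots> \<le> integral {x0..x} (\<lambda>t. M * (h t * ?H t ^ n))"
    proof (rule Henstock_Kurzweil_Integration.integral_norm_bound_integral)
      show "w integrable_on {x0..x}" by (rule i[OF w x0 x])
      show "(\<lambda>t. M * (h t * ?H t ^ n)) integrable_on {x0..x}" by (rule i[OF locally_integrable_on_cmult[OF hH] x0 x])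
      fix t assume t: "t \<in> {x0..x}"
      then have tS: "t \<in> einterval a b" using einterval_Icc_subset[OF x0 x] by blast
      have "0 \<le> ?H t" using primitive_nonneg(1)[OF h x0 tS pos] t by simp
      then show "norm (w t) \<le> M * (h t * ?H t ^ n)" using le[OF tS] by simp
    qed
    also have "\<dots> = M * primitive x0 (\<lambda>t. h t * ?H t ^ n) x" using True by (simp add: primitive_def)
    also have "\<dots> = M * (\<bar>?H x\<bar> ^ Suc n / Suc n)"
      unfolding primitive_power[OF h x0 x] using primitive_nonneg(1)[OF h x0 x pos True] by simp
    finally show ?thesis .
  next
    case False
    then have xx0: "x \<le> x0" by simp
    have "\<bar>primitive x0 w x\<bar> = norm (integral {x..x0} w)" using False by (simp add: primitive_def)
    \<comment> \<open>Left of the base point \<open>H \<le> 0\<close>, and \<open>(- 1) ^ n\<close>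
      turns \<open>H ^ n\<close> into \<open>\<bar>H\<bar> ^ n\<close>, which keeps
      \<open>primitive_power\<close> applicable.\<close>
    also have "\<dots> \<le> integral {x..x0} (\<lambda>t. M * (- 1) ^ n * (h t * ?H t ^ n))"
    proof (rule Henstock_Kurzweil_Integration.integral_norm_bound_integral)
      show "w integrable_on {x..x0}" by (rule i[OF w x x0])
      show "(\<lambda>t. M * (- 1) ^ n * (h t * ?H t ^ n)) integrable_on {x..x0}"
        by (rule i[OF locally_integrable_on_cmult[OF hH] x x0])
      fix t assume t: "t \<in> {x..x0}"
      then have tS: "t \<in> einterval a b" using einterval_Icc_subset[OF x x0] by blast
      have "?H t \<le> 0" using primitive_nonneg(2)[OF h x0 tS pos] t by simp
      then have "\<bar>?H t\<bar> ^ n = (- 1) ^ n * ?H t ^ n" by (simp add: power_mult_distrib[symmetric])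
      then show "norm (w t) \<le> M * (- 1) ^ n * (h t * ?H t ^ n)" using le[OF tS] by (simp add: ac_simps)
    qed
    also have "\<dots> = - (M * (- 1) ^ n * primitive x0 (\<lambda>t. h t * ?H t ^ n) x)" using False by (simp add: primitive_def)
    also have "\<dots> = M * ((- 1) ^ Suc n * ?H x ^ Suc n / Suc n)"
      unfolding primitive_power[OF h x0 x] by simp
    also have "(- 1) ^ Suc n * ?H x ^ Suc n = \<bar>?H x\<bar> ^ Suc n"
      using primitive_nonneg(2)[OF h x0 x pos xx0] by (simp only: power_mult_distrib[symmetric] abs_of_nonpos) simp
    finally show ?thesis .
  qed
qed

lemma primitive_add:
  assumes "locally_integrable_on f (einterval a b)" "locally_integrable_on g (einterval a b)"
    and "x0 \<in> einterval a b" "x \<in> einterval a b"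
  shows "primitive x0 (\<lambda>t. f t + g t) x = primitive x0 f x + primitive x0 g x"
proof -
  have i: "h integrable_on {x..y}" if "locally_integrable_on h (einterval a b)" "x \<in> einterval a b" "y \<in> einterval a b" for h x y
    using locally_integrable_onD[OF that] by (rule set_lebesgue_integral_eq_integral)
  show ?thesis
    using Henstock_Kurzweil_Integration.integral_add[OF i[OF assms(1,3,4)] i[OF assms(2,3,4)]]
      Henstock_Kurzweil_Integration.integral_add[OF i[OF assms(1,4,3)] i[OF assms(2,4,3)]]
    by (simp add: primitive_def)
qed

text \<open>Dominated convergence on compact subintervals. It carries the integral equation from the
  Picard partial sums to their limit; the domination passes to the limit function and makes it
  absolutely integrable there.\<close>

lemma primitive_dominated_convergence:
  assumes f: "\<And>n. locally_integrable_on (f n) (einterval a b)" and h: "locally_integrable_on h (einterval a b)"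
    and le: "\<And>n t. t \<in> einterval a b \<Longrightarrow> \<bar>f n t\<bar> \<le> h t"
    and lim: "\<And>t. t \<in> einterval a b \<Longrightarrow> (\<lambda>n. f n t) \<longlonglongrightarrow> g t"
  shows "locally_integrable_on g (einterval a b)"
    and "\<lbrakk>x0 \<in> einterval a b; x \<in> einterval a b\<rbrakk> \<Longrightarrow> (\<lambda>n. primitive x0 (f n) x) \<longlonglongrightarrow> primitive x0 g x"
proof -
  have i: "w integrable_on {x..y}" if "locally_integrable_on w (einterval a b)" "x \<in> einterval a b" "y \<in> einterval a b" for w x y
    using locally_integrable_onD[OF that] by (rule set_lebesgue_integral_eq_integral)
  have dc: "g integrable_on {u..v}" "(\<lambda>n. integral {u..v} (f n)) \<longlonglongrightarrow> integral {u..v} g"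
    if uv: "u \<in> einterval a b" "v \<in> einterval a b" for u v
    by (rule dominated_convergence[OF i[OF f uv] i[OF h uv]]; use le lim einterval_Icc_subset[OF uv] in force)+
  show "locally_integrable_on g (einterval a b)"
  proof (rule locally_integrable_onI)
    fix u v assume uv: "u \<in> einterval a b" "v \<in> einterval a b"
    show "g absolutely_integrable_on {u..v}"
    proof (rule absolutely_integrable_integrable_bound[OF _ dc(1)[OF uv] i[OF h uv]])
      fix t assume "t \<in> {u..v}"
      then have t: "t \<in> einterval a b" using einterval_Icc_subset[OF uv] by blast
      have "(\<lambda>n. \<bar>f n t\<bar>) \<longlonglongrightarrow> \<bar>g t\<bar>" by (intro tendsto_rabs lim t)
      then show "norm (g t) \<le> h t" using le[OF t] by (simp add: LIMSEQ_le_const2)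
    qed
  qed
  show "(\<lambda>n. primitive x0 (f n) x) \<longlonglongrightarrow> primitive x0 g x" if "x0 \<in> einterval a b" "x \<in> einterval a b"
    unfolding primitive_def using dc(2)[OF that] tendsto_minus[OF dc(2)[OF that(2,1)]] by simp
qed

section \<open>Linear systems with locally integrable coefficients\<close>

text \<open>Despite the name these are the terms of the Picard series, the differences of successive
  approximations: no initial value is added after step 0, and the solution is the sum over
  \<open>n\<close>.\<close>

primrec picard_iterate :: "real \<Rightarrow> (real \<Rightarrow> real) \<Rightarrow> (real \<Rightarrow> real) \<Rightarrow> (real \<Rightarrow> real) \<Rightarrow> (real \<Rightarrow> real)
    \<Rightarrow> real \<Rightarrow> real \<Rightarrow> nat \<Rightarrow> (real \<Rightarrow> real) \<times> (real \<Rightarrow> real)"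
  where
    "picard_iterate x0 A B C D c1 c2 0 = (\<lambda>_. c1, \<lambda>_. c2)"
  | "picard_iterate x0 A B C D c1 c2 (Suc n) =
      (primitive x0 (\<lambda>t. A t * fst (picard_iterate x0 A B C D c1 c2 n) t + B t * snd (picard_iterate x0 A B C D c1 c2 n) t),
       primitive x0 (\<lambda>t. C t * fst (picard_iterate x0 A B C D c1 c2 n) t + D t * snd (picard_iterate x0 A B C D c1 c2 n) t))"

text \<open>The summed integral equation is obtained by dominated convergence with majorant
  \<open>h * M\<close>, which is locally integrable because \<open>M\<close> is continuous. The
  factorial decay holds at every point of \<open>(a,b)\<close>, so the solution is global without
  patching.\<close>

lemma linear_system_solution_exists:
  assumes A: "locally_integrable_on A (einterval a b)" and B: "locally_integrable_on B (einterval a b)"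
    and C: "locally_integrable_on C (einterval a b)" and D: "locally_integrable_on D (einterval a b)"
    and x0: "x0 \<in> einterval a b"
  obtains u v where "u \<in> AC_loc a b" "v \<in> AC_loc a b" "u x0 = c1" "v x0 = c2"
    "AE x\<in>einterval a b in lebesgue. (u has_real_derivative A x * u x + B x * v x) (at x)"
    "AE x\<in>einterval a b in lebesgue. (v has_real_derivative C x * u x + D x * v x) (at x)"
proof -
  let ?S = "einterval a b"
  define u v where "u = (\<lambda>n. fst (picard_iterate x0 A B C D c1 c2 n))" and "v = (\<lambda>n. snd (picard_iterate x0 A B C D c1 c2 n))"
  have u0: "u 0 = (\<lambda>_. c1)" and v0: "v 0 = (\<lambda>_. c2)"
    and uS: "\<And>n. u (Suc n) = primitive x0 (\<lambda>t. A t * u n t + B t * v n t)"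
    and vS: "\<And>n. v (Suc n) = primitive x0 (\<lambda>t. C t * u n t + D t * v n t)"
    by (simp_all add: u_def v_def)
  \<comment> \<open>Summing all four moduli gives one coefficient bound that serves both rows of the
    system.\<close>
  define h where "h = (\<lambda>t. \<bar>A t\<bar> + \<bar>B t\<bar> + \<bar>C t\<bar> + \<bar>D t\<bar>)"
  define H where "H = primitive x0 h"
  define K where "K = \<bar>c1\<bar> + \<bar>c2\<bar>"
  have h: "locally_integrable_on h ?S"
    unfolding h_def by (intro locally_integrable_on_add locally_integrable_on_abs A B C D)
  have hpos: "0 \<le> h t" for t by (simp add: h_def)
  have K: "0 \<le> K" by (simp add: K_def)
  have loc: "locally_integrable_on (\<lambda>t. F t * y t + G t * z t) ?S"
    if "locally_integrable_on F ?S" "locally_integrable_on G ?S" "y \<in> AC_loc a b" "z \<in> AC_loc a b" for F G y z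
  proof -
    have "locally_integrable_on (\<lambda>t. y t * F t + z t * G t) ?S"
      by (intro locally_integrable_on_add locally_integrable_on_mult AC_loc_continuous_on that)
    then show ?thesis by (simp add: mult.commute)
  qed
  have AC: "u n \<in> AC_loc a b \<and> v n \<in> AC_loc a b" for n
  proof (induction n)
    case 0
    then show ?case by (simp add: u0 v0 AC_loc_const)
  next
    case (Suc n)
    then show ?case unfolding uS vS by (intro conjI primitive_AC_loc loc A B C D x0) auto
  qed
  have comb: "\<bar>F * y + G * z\<bar> \<le> k * M"
    if "\<bar>y\<bar> \<le> M" "\<bar>z\<bar> \<le> M" "\<bar>F\<bar> + \<bar>G\<bar> \<le> k" for F G y z k M :: real
  proof -
    have "\<bar>F * y + G * z\<bar> \<le> \<bar>F\<bar> * \<bar>y\<bar> + \<bar>G\<bar> * \<bar>z\<bar>" by (metis abs_mult abs_triangle_ineq)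
    also have "\<dots> \<le> \<bar>F\<bar> * M + \<bar>G\<bar> * M" using that by (intro add_mono mult_left_mono) auto
    also have "\<dots> \<le> k * M" using that mult_right_mono[OF that(3), of M] by (simp add: distrib_right)
    finally show ?thesis .
  qed
  have ABh: "\<bar>A t\<bar> + \<bar>B t\<bar> \<le> h t" and CDh: "\<bar>C t\<bar> + \<bar>D t\<bar> \<le> h t" for t by (auto simp: h_def)
  have bound: "\<forall>x\<in>?S. \<bar>u n x\<bar> \<le> K * (\<bar>H x\<bar> ^ n / fact n) \<and> \<bar>v n x\<bar> \<le> K * (\<bar>H x\<bar> ^ n / fact n)" for n
  proof (induction n)
    case 0
    then show ?case by (simp add: u0 v0 K_def)
  next
    case (Suc n)
    have step: "\<bar>primitive x0 (\<lambda>t. F t * u n t + G t * v n t) x\<bar> \<le> K * (\<bar>H x\<bar> ^ Suc n / fact (Suc n))"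
      if x: "x \<in> ?S" and FG: "locally_integrable_on F ?S" "locally_integrable_on G ?S" "\<And>t. \<bar>F t\<bar> + \<bar>G t\<bar> \<le> h t" for F G x
    proof -
      have "\<bar>primitive x0 (\<lambda>t. F t * u n t + G t * v n t) x\<bar> \<le> K / fact n * (\<bar>primitive x0 h x\<bar> ^ Suc n / Suc n)"
      proof (rule primitive_power_bound[OF h x0 x hpos])
        show "locally_integrable_on (\<lambda>t. F t * u n t + G t * v n t) ?S" using AC by (intro loc FG) auto
        fix t assume t: "t \<in> ?S"
        have "\<bar>F t * u n t + G t * v n t\<bar> \<le> h t * (K * (\<bar>H t\<bar> ^ n / fact n))" using Suc t FG(3) by (intro comb) auto
        then show "\<bar>F t * u n t + G t * v n t\<bar> \<le> K / fact n * (h t * \<bar>primitive x0 h t\<bar> ^ n)"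
          by (simp add: H_def field_simps)
      qed
      then show ?thesis by (simp add: H_def field_simps)
    qed
    show ?case unfolding uS vS using step[OF _ A B ABh] step[OF _ C D CDh] by blast
  qed
  \<comment> \<open>The termwise majorants form an exponential series, and \<open>M\<close> is its
    sum.\<close>
  define M where "M = (\<lambda>t. K * exp \<bar>H t\<bar>)"
  have ser: "(\<lambda>n. K * (\<bar>H t\<bar> ^ n / fact n)) sums M t" for t
    unfolding M_def using exp_converges[of "\<bar>H t\<bar>"] by (intro sums_mult) (simp add: field_simps)
  define U V where "U = (\<lambda>N t. \<Sum>n<N. u n t)" and "V = (\<lambda>N t. \<Sum>n<N. v n t)"
  define uu vv where "uu = (\<lambda>t. \<Sum>n. u n t)" and "vv = (\<lambda>t. \<Sum>n. v n t)"
  have part: "\<bar>\<Sum>n<N. y n\<bar> \<le> M t" "(\<lambda>N. \<Sum>n<N. y n) \<longlonglongrightarrow> (\<Sum>n. y n)"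
    if y: "\<And>n. \<bar>y n\<bar> \<le> K * (\<bar>H t\<bar> ^ n / fact n)" for y t N
  proof -
    have "\<bar>\<Sum>n<N. y n\<bar> \<le> (\<Sum>n<N. \<bar>y n\<bar>)" by (rule sum_abs)
    also have "\<dots> \<le> (\<Sum>n<N. K * (\<bar>H t\<bar> ^ n / fact n))" by (intro sum_mono y)
    also have "\<dots> \<le> (\<Sum>n. K * (\<bar>H t\<bar> ^ n / fact n))"
      using ser[of t] K by (intro sum_le_suminf) (auto simp: sums_iff)
    finally show "\<bar>\<Sum>n<N. y n\<bar> \<le> M t" using ser[of t] by (simp add: sums_iff)
    have "summable y"
      by (rule summable_comparison_test'[OF sums_summable[OF ser[of t]], of 0]) (use y in simp)
    then show "(\<lambda>N. \<Sum>n<N. y n) \<longlonglongrightarrow> (\<Sum>n. y n)" by (rule summable_LIMSEQ)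
  qed
  have UV: "\<bar>U N t\<bar> \<le> M t" "\<bar>V N t\<bar> \<le> M t" "(\<lambda>N. U N t) \<longlonglongrightarrow> uu t" "(\<lambda>N. V N t) \<longlonglongrightarrow> vv t" if "t \<in> ?S" for N t
    unfolding U_def V_def uu_def vv_def using bound that by (intro part; blast)+
  have UVAC: "U N \<in> AC_loc a b" "V N \<in> AC_loc a b" for N
  proof -
    have "(\<lambda>t. \<Sum>n<N. y n t) \<in> AC_loc a b" if "\<And>n. y n \<in> AC_loc a b" for y
    proof (induction N)
      case 0
      then show ?case by (simp add: AC_loc_const)
    next
      case (Suc N)
      then show ?case using AC_loc_add[OF Suc that[of N]] by simp
    qed
    then show "U N \<in> AC_loc a b" "V N \<in> AC_loc a b" unfolding U_def V_def using AC by blast+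
  qed
  have Hcont: "continuous_on ?S H" unfolding H_def by (intro AC_loc_continuous_on primitive_AC_loc h x0)
  have Mh: "locally_integrable_on (\<lambda>t. h t * M t) ?S"
  proof -
    have "locally_integrable_on (\<lambda>t. M t * h t) ?S"
      unfolding M_def by (intro locally_integrable_on_mult h continuous_intros Hcont)
    then show ?thesis by (simp add: mult.commute)
  qed
  \<comment> \<open>Partial sums are shifted by one: \<open>Suc N\<close> terms on the left
    correspond to \<open>N\<close> terms under the integral, since the zeroth term is the
    constant.\<close>
  have rec: "(\<Sum>n<Suc N. y n x) = c + primitive x0 (\<lambda>t. F t * U N t + G t * V N t) x"
    if y: "\<And>t. y 0 t = c" "\<And>n. y (Suc n) = primitive x0 (\<lambda>t. F t * u n t + G t * v n t)"
      and FG: "locally_integrable_on F ?S" "locally_integrable_on G ?S" and x: "x \<in> ?S" for y c F G N x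
  proof (induction N)
    case 0
    then show ?case by (simp add: U_def V_def y primitive_def)
  next
    case (Suc N)
    have "primitive x0 (\<lambda>t. F t * U (Suc N) t + G t * V (Suc N) t) x
      = primitive x0 (\<lambda>t. (F t * U N t + G t * V N t) + (F t * u N t + G t * v N t)) x"
      by (simp add: U_def V_def algebra_simps)
    also have "\<dots> = primitive x0 (\<lambda>t. F t * U N t + G t * V N t) x + y (Suc N) x"
      unfolding y by (intro primitive_add[OF _ _ x0 x] loc FG UVAC AC[THEN conjunct1] AC[THEN conjunct2])
    finally show ?case using Suc by simp
  qed
  have lim: "locally_integrable_on (\<lambda>t. F t * uu t + G t * vv t) ?S"
    "x \<in> ?S \<Longrightarrow> (\<lambda>N. primitive x0 (\<lambda>t. F t * U N t + G t * V N t) x) \<longlonglongrightarrow> primitive x0 (\<lambda>t. F t * uu t + G t * vv t) x"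
    if FG: "locally_integrable_on F ?S" "locally_integrable_on G ?S" "\<And>t. \<bar>F t\<bar> + \<bar>G t\<bar> \<le> h t" for F G x
  proof -
    have l: "locally_integrable_on (\<lambda>t. F t * U N t + G t * V N t) ?S" for N by (intro loc FG UVAC)
    have b: "\<bar>F t * U N t + G t * V N t\<bar> \<le> h t * M t" if "t \<in> ?S" for N t
      using UV[OF that] FG(3) by (intro comb) auto
    have c: "(\<lambda>N. F t * U N t + G t * V N t) \<longlonglongrightarrow> F t * uu t + G t * vv t" if "t \<in> ?S" for t
      by (intro tendsto_intros UV that)
    show "locally_integrable_on (\<lambda>t. F t * uu t + G t * vv t) ?S"
      by (rule primitive_dominated_convergence(1)[OF l Mh b c])
    show "x \<in> ?S \<Longrightarrow> (\<lambda>N. primitive x0 (\<lambda>t. F t * U N t + G t * V N t) x) \<longlonglongrightarrow> primitive x0 (\<lambda>t. F t * uu t + G t * vv t) x"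
      by (rule primitive_dominated_convergence(2)[OF l Mh b c x0])
  qed
  \<comment> \<open>The solution is taken to be the right-hand side of the integral equation, which
    is locally absolutely continuous as it stands; it agrees with the sum of the series on
    \<open>(a,b)\<close>.\<close>
  define yu yv where "yu = (\<lambda>x. c1 + primitive x0 (\<lambda>t. A t * uu t + B t * vv t) x)"
    and "yv = (\<lambda>x. c2 + primitive x0 (\<lambda>t. C t * uu t + D t * vv t) x)"
  have eq: "uu x = yu x" "vv x = yv x" if x: "x \<in> ?S" for x
  proof -
    have "(\<lambda>N. \<Sum>n<Suc N. u n x) \<longlonglongrightarrow> uu x" using LIMSEQ_Suc[OF UV(3)[OF x]] by (simp only: U_def)
    moreover have "(\<lambda>N. \<Sum>n<Suc N. u n x) \<longlonglongrightarrow> yu x"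
      unfolding yu_def rec[of u c1 A B, OF fun_cong[OF u0] uS A B x] by (intro tendsto_intros lim(2)[OF A B ABh x])
    ultimately show "uu x = yu x" by (rule LIMSEQ_unique)
    have "(\<lambda>N. \<Sum>n<Suc N. v n x) \<longlonglongrightarrow> vv x" using LIMSEQ_Suc[OF UV(4)[OF x]] by (simp only: V_def)
    moreover have "(\<lambda>N. \<Sum>n<Suc N. v n x) \<longlonglongrightarrow> yv x"
      unfolding yv_def rec[of v c2 C D, OF fun_cong[OF v0] vS C D x] by (intro tendsto_intros lim(2)[OF C D CDh x])
    ultimately show "vv x = yv x" by (rule LIMSEQ_unique)
  qed
  have der: "AE x\<in>?S in lebesgue. ((\<lambda>x. c + primitive x0 (\<lambda>t. F t * uu t + G t * vv t) x) has_real_derivative F x * yu x + G x * yv x) (at x)"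
    if "locally_integrable_on F ?S" "locally_integrable_on G ?S" "\<And>t. \<bar>F t\<bar> + \<bar>G t\<bar> \<le> h t" for F G c
    using primitive_has_derivative_ae[OF lim(1)[OF that] x0]
  proof eventually_elim
    case (elim x)
    show ?case
    proof
      assume x: "x \<in> ?S"
      then have "(primitive x0 (\<lambda>t. F t * uu t + G t * vv t) has_real_derivative F x * uu x + G x * vv x) (at x)"
        using elim by blast
      then show "((\<lambda>x. c + primitive x0 (\<lambda>t. F t * uu t + G t * vv t) x) has_real_derivative F x * yu x + G x * yv x) (at x)"
        unfolding eq[OF x] using DERIV_add[OF DERIV_const] by fastforce
    qed
  qed
  show thesis
  proof (rule that)
    show "yu \<in> AC_loc a b" unfolding yu_def by (intro AC_loc_add AC_loc_const primitive_AC_loc lim(1) A B ABh x0)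
    show "yv \<in> AC_loc a b" unfolding yv_def by (intro AC_loc_add AC_loc_const primitive_AC_loc lim(1) C D CDh x0)
    show "yu x0 = c1" "yv x0 = c2" by (simp_all add: yu_def yv_def)
    show "AE x\<in>?S in lebesgue. (yu has_real_derivative A x * yu x + B x * yv x) (at x)"
      using der[OF A B ABh, of c1] by (simp only: yu_def[symmetric])
    show "AE x\<in>?S in lebesgue. (yv has_real_derivative C x * yu x + D x * yv x) (at x)"
      using der[OF C D CDh, of c2] by (simp only: yv_def[symmetric])
  qed
qed

text \<open>Here \<open>v\<close> plays the role of the quasi-derivative \<open>u\<^sup>[\<^sup>1\<^sup>]\<close>.\<close>

definition solution_pair ::
    "ereal \<Rightarrow> ereal \<Rightarrow> (real \<Rightarrow> real) \<Rightarrow> (real \<Rightarrow> real) \<Rightarrow> (real \<Rightarrow> real) \<Rightarrow> (real \<Rightarrow> real)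
      \<Rightarrow> real \<Rightarrow> (real \<Rightarrow> real) \<Rightarrow> (real \<Rightarrow> real) \<Rightarrow> bool"
  where "solution_pair a b p q r s lam u v \<longleftrightarrow> u \<in> AC_loc a b \<and> v \<in> AC_loc a b \<and>
    (AE x\<in>einterval a b in lebesgue. (u has_real_derivative v x / p x - s x * u x) (at x)) \<and>
    (AE x\<in>einterval a b in lebesgue. (v has_real_derivative s x * v x + (q x - lam * r x) * u x) (at x))"

section \<open>Quasi-derivatives, solution pairs and their Wronskians\<close>

text \<open>Both functions are continuous, so the set where they differ is open; an open negligible
  set is empty. This is what makes pointwise values of quasi-derivatives meaningful.\<close>

lemma AC_loc_eq_if_ae_eq:
  assumes AC: "g \<in> AC_loc a b" "h \<in> AC_loc a b" and ae: "AE x\<in>einterval a b in lebesgue. g x = h x"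
    and x: "x \<in> einterval a b"
  shows "g x = h x"
proof -
  let ?Z = "{x \<in> einterval a b. g x \<noteq> h x}"
  have "continuous_on (einterval a b) (\<lambda>x. g x - h x)"
    by (intro AC_loc_continuous_on AC_loc_diff AC)
  then have "open (einterval a b \<inter> (\<lambda>x. g x - h x) -` (- {0}))"
    by (intro continuous_open_preimage) auto
  moreover have "einterval a b \<inter> (\<lambda>x. g x - h x) -` (- {0}) = ?Z" by auto
  ultimately have op: "open ?Z" by simp
  have "negligible ?Z" using ae by (simp add: AE_lebesgue_iff_negligible)
  then have "?Z = {}" using open_not_negligible[OF op] by blast
  then show ?thesis using x by auto
qed

lemma is_quasi_deriv_unique:
  assumes "is_quasi_deriv a b p s f g" "is_quasi_deriv a b p s f h" "x \<in> einterval a b"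
  shows "g x = h x"
proof (rule AC_loc_eq_if_ae_eq[OF _ _ _ assms(3)])
  have "AE x\<in>einterval a b in lebesgue. g x = p x * (deriv f x + s x * f x)"
    "AE x\<in>einterval a b in lebesgue. h x = p x * (deriv f x + s x * f x)"
    using assms(1,2) unfolding is_quasi_deriv_def by auto
  then show "AE x\<in>einterval a b in lebesgue. g x = h x" by eventually_elim simp
qed (use assms in \<open>auto simp: is_quasi_deriv_def\<close>)

text \<open>Solving for the derivatives gives the first-order system: \<open>p x \<noteq> 0\<close>
  permits division by \<open>p\<close>, and \<open>r x > 0\<close> permits clearing the factor
  \<open>1 / r x\<close>.\<close>

lemma is_solution_imp_solution_pair:
  assumes "is_solution a b p q r s lam u"
    and r: "AE x\<in>einterval a b in lebesgue. r x > 0" and p: "AE x\<in>einterval a b in lebesgue. p x \<noteq> 0"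
  shows "solution_pair a b p q r s lam u (quasi_deriv a b p s u)"
proof -
  have u: "u \<in> AC_loc a b" and ex: "\<exists>g. is_quasi_deriv a b p s u g"
    and tau: "AE x\<in>einterval a b in lebesgue. tau a b p q r s u x - lam * u x = 0"
    using assms(1) unfolding is_solution_def tau_domain_def by auto
  define v where "v = quasi_deriv a b p s u"
  have "is_quasi_deriv a b p s u v" unfolding v_def quasi_deriv_def by (rule someI_ex[OF ex])
  then have v: "v \<in> AC_loc a b" and veq: "AE x\<in>einterval a b in lebesgue. v x = p x * (deriv u x + s x * u x)"
    unfolding is_quasi_deriv_def by auto
  have "AE x\<in>einterval a b in lebesgue. (u has_real_derivative v x / p x - s x * u x) (at x)"
    using AC_loc_has_deriv_ae[OF u] veq p
  proof eventually_elim
    case (elim x)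
    show ?case
    proof
      assume "x \<in> einterval a b"
      then have *: "(u has_real_derivative deriv u x) (at x)" "v x = p x * (deriv u x + s x * u x)" "p x \<noteq> 0"
        using elim by blast+
      then have "v x / p x - s x * u x = deriv u x" by simp
      then show "(u has_real_derivative v x / p x - s x * u x) (at x)" using *(1) by simp
    qed
  qed
  moreover have "AE x\<in>einterval a b in lebesgue. (v has_real_derivative s x * v x + (q x - lam * r x) * u x) (at x)"
    using AC_loc_has_deriv_ae[OF v] tau r
  proof eventually_elim
    case (elim x)
    show ?case
    proof
      assume "x \<in> einterval a b"
      then have *: "(v has_real_derivative deriv v x) (at x)"
        "1 / r x * (- deriv v x + s x * v x + q x * u x) - lam * u x = 0" "r x > 0"
        using elim by (auto simp: tau_def v_def)
      then have "- deriv v x + s x * v x + q x * u x = lam * u x * r x" by (simp add: field_simps)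
      then have "deriv v x = s x * v x + (q x - lam * r x) * u x" by (simp add: algebra_simps)
      then show "(v has_real_derivative s x * v x + (q x - lam * r x) * u x) (at x)" using *(1) by simp
    qed
  qed
  ultimately show ?thesis unfolding solution_pair_def v_def[symmetric] using u v by blast
qed

text \<open>The chosen \<open>quasi_deriv\<close> and \<open>v\<close> agree almost everywhere with
  the same expression, hence coincide at every point of \<open>(a,b)\<close>; off the interval they
  may differ.\<close>

lemma solution_pair_imp_is_solution:
  assumes "solution_pair a b p q r s lam u v"
    and r: "AE x\<in>einterval a b in lebesgue. r x > 0" and p: "AE x\<in>einterval a b in lebesgue. p x \<noteq> 0"
  shows "is_solution a b p q r s lam u" and "x \<in> einterval a b \<Longrightarrow> quasi_deriv a b p s u x = v x"
proof -
  have u: "u \<in> AC_loc a b" and v: "v \<in> AC_loc a b"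
    and du: "AE x\<in>einterval a b in lebesgue. (u has_real_derivative v x / p x - s x * u x) (at x)"
    and dv: "AE x\<in>einterval a b in lebesgue. (v has_real_derivative s x * v x + (q x - lam * r x) * u x) (at x)"
    using assms(1) unfolding solution_pair_def by auto
  have "AE x\<in>einterval a b in lebesgue. v x = p x * (deriv u x + s x * u x)"
    using du p by eventually_elim (auto dest!: DERIV_imp_deriv)
  then have qd: "is_quasi_deriv a b p s u v" unfolding is_quasi_deriv_def using v by blast
  then have "is_quasi_deriv a b p s u (quasi_deriv a b p s u)" 
    unfolding quasi_deriv_def by (rule someI[of "is_quasi_deriv a b p s u"])
  then have eq: "quasi_deriv a b p s u x = v x" if "x \<in> einterval a b" for x
    using is_quasi_deriv_unique qd that by blast
  then show "x \<in> einterval a b \<Longrightarrow> quasi_deriv a b p s u x = v x" .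
  have "AE x\<in>einterval a b in lebesgue. tau a b p q r s u x - lam * u x = 0"
    using dv r
  proof eventually_elim
    case (elim x)
    show ?case
    proof
      assume x: "x \<in> einterval a b"
      then have d: "(v has_real_derivative s x * v x + (q x - lam * r x) * u x) (at x)" and rx: "r x > 0"
        using elim by blast+
      \<comment> \<open>Agreement on the open interval transfers the derivative.\<close>
      have "(quasi_deriv a b p s u has_real_derivative s x * v x + (q x - lam * r x) * u x) (at x)"
        by (rule has_field_derivative_transform_within_open[OF d open_einterval x]) (simp add: eq)
      then have "deriv (quasi_deriv a b p s u) x = s x * v x + (q x - lam * r x) * u x" by (rule DERIV_imp_deriv)
      then show "tau a b p q r s u x - lam * u x = 0"
        using rx by (simp add: tau_def eq[OF x] field_simps)
    qed
  qed
  then show "is_solution a b p q r s lam u"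
    unfolding is_solution_def tau_domain_def using u qd by blast
qed

text \<open>The coefficient matrix of the system has rows \<open>- s\<close>, \<open>1 / p\<close>
  and \<open>q - lam * r\<close>, \<open>s\<close>; all entries are locally integrable.\<close>

lemma solution_pair_exists:
  assumes "locally_integrable_on (\<lambda>x. 1 / p x) (einterval a b)" "locally_integrable_on q (einterval a b)"
    "locally_integrable_on r (einterval a b)" "locally_integrable_on s (einterval a b)" "x0 \<in> einterval a b"
  obtains u v where "solution_pair a b p q r s lam u v" "u x0 = c1" "v x0 = c2"
proof -
  have 1: "locally_integrable_on (\<lambda>x. - 1 * s x) (einterval a b)" by (intro locally_integrable_on_cmult assms)
  have 2: "locally_integrable_on (\<lambda>x. q x + (- lam) * r x) (einterval a b)"
    by (intro locally_integrable_on_add locally_integrable_on_cmult assms)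
  obtain u v where uv: "u \<in> AC_loc a b" "v \<in> AC_loc a b" "u x0 = c1" "v x0 = c2"
    "AE x\<in>einterval a b in lebesgue. (u has_real_derivative (- 1 * s x) * u x + 1 / p x * v x) (at x)"
    "AE x\<in>einterval a b in lebesgue. (v has_real_derivative (q x + (- lam) * r x) * u x + s x * v x) (at x)"
    by (rule linear_system_solution_exists[OF 1 assms(1) 2 assms(4) assms(5)])
  have "solution_pair a b p q r s lam u v"
    unfolding solution_pair_def
  proof (intro conjI uv)
    show "AE x\<in>einterval a b in lebesgue. (u has_real_derivative v x / p x - s x * u x) (at x)"
      using uv(5) by (simp add: algebra_simps)
    show "AE x\<in>einterval a b in lebesgue. (v has_real_derivative s x * v x + (q x - lam * r x) * u x) (at x)"
      using uv(6) by (simp add: algebra_simps)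
  qed
  then show thesis using uv that by blast
qed

lemma solution_pair_linear:
  assumes "solution_pair a b p q r s lam u v" "solution_pair a b p q r s lam w z"
  shows "solution_pair a b p q r s lam (\<lambda>x. \<alpha> * u x + \<beta> * w x) (\<lambda>x. \<alpha> * v x + \<beta> * z x)"
  unfolding solution_pair_def
proof (intro conjI)
  note a = assms[unfolded solution_pair_def]
  show "(\<lambda>x. \<alpha> * u x + \<beta> * w x) \<in> AC_loc a b" "(\<lambda>x. \<alpha> * v x + \<beta> * z x) \<in> AC_loc a b"
    using a by (auto intro!: AC_loc_add AC_loc_cmult)
  have "AE x\<in>einterval a b in lebesgue. (u has_real_derivative v x / p x - s x * u x) (at x)"
    "AE x\<in>einterval a b in lebesgue. (w has_real_derivative z x / p x - s x * w x) (at x)" using a by auto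
  then show "AE x\<in>einterval a b in lebesgue. ((\<lambda>x. \<alpha> * u x + \<beta> * w x) has_real_derivative
      (\<alpha> * v x + \<beta> * z x) / p x - s x * (\<alpha> * u x + \<beta> * w x)) (at x)"
  proof eventually_elim
    case (elim x)
    show ?case
    proof
      assume "x \<in> einterval a b"
      then show "((\<lambda>x. \<alpha> * u x + \<beta> * w x) has_real_derivative
        (\<alpha> * v x + \<beta> * z x) / p x - s x * (\<alpha> * u x + \<beta> * w x)) (at x)"
        using elim by (intro DERIV_cong[OF DERIV_add[OF DERIV_cmult DERIV_cmult]]) (auto simp: algebra_simps add_divide_distrib)
    qed
  qed
  have "AE x\<in>einterval a b in lebesgue. (v has_real_derivative s x * v x + (q x - lam * r x) * u x) (at x)"
    "AE x\<in>einterval a b in lebesgue. (z has_real_derivative s x * z x + (q x - lam * r x) * w x) (at x)" using a by auto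
  then show "AE x\<in>einterval a b in lebesgue. ((\<lambda>x. \<alpha> * v x + \<beta> * z x) has_real_derivative
      s x * (\<alpha> * v x + \<beta> * z x) + (q x - lam * r x) * (\<alpha> * u x + \<beta> * w x)) (at x)"
  proof eventually_elim
    case (elim x)
    show ?case
    proof
      assume "x \<in> einterval a b"
      then show "((\<lambda>x. \<alpha> * v x + \<beta> * z x) has_real_derivative
        s x * (\<alpha> * v x + \<beta> * z x) + (q x - lam * r x) * (\<alpha> * u x + \<beta> * w x)) (at x)"
        using elim by (intro DERIV_cong[OF DERIV_add[OF DERIV_cmult DERIV_cmult]]) (auto simp: algebra_simps)
    qed
  qed
qed

text \<open>The coefficient matrix has trace zero, so the terms of the product rule cancel almost
  everywhere; absolute continuity turns the vanishing derivative into constancy.\<close>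

lemma solution_pair_wronskian_constant:
  assumes "solution_pair a b p q r s lam u v" "solution_pair a b p q r s lam w z"
    and "x \<in> einterval a b" "y \<in> einterval a b"
  shows "u x * z x - v x * w x = u y * z y - v y * w y"
proof -
  note a = assms(1,2)[unfolded solution_pair_def]
  have AC: "(\<lambda>x. u x * z x - v x * w x) \<in> AC_loc a b" using a by (auto intro!: AC_loc_diff AC_loc_mult)
  have d: "AE x\<in>einterval a b in lebesgue. (u has_real_derivative v x / p x - s x * u x) (at x)"
    "AE x\<in>einterval a b in lebesgue. (w has_real_derivative z x / p x - s x * w x) (at x)"
    "AE x\<in>einterval a b in lebesgue. (v has_real_derivative s x * v x + (q x - lam * r x) * u x) (at x)"
    "AE x\<in>einterval a b in lebesgue. (z has_real_derivative s x * z x + (q x - lam * r x) * w x) (at x)" using a by auto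
  then have "AE x\<in>einterval a b in lebesgue. ((\<lambda>x. u x * z x - v x * w x) has_real_derivative 0) (at x)"
  proof eventually_elim
    case (elim x)
    show ?case
    proof
      assume "x \<in> einterval a b"
      then show "((\<lambda>x. u x * z x - v x * w x) has_real_derivative 0) (at x)"
        using elim by (intro DERIV_cong[OF DERIV_diff[OF DERIV_mult DERIV_mult]]) (auto simp: algebra_simps)
    qed
  qed
  then show ?thesis by (rule AC_loc_constant[OF AC _ assms(3,4)])
qed

section \<open>Quotients of solutions near the right endpoint\<close>

lemma einterval_nested:
  assumes "d \<in> einterval a b" "x \<in> einterval d b"
  shows "x \<in> einterval a b"
proof -
  have "a < ereal d" "ereal d < ereal x" "ereal x < b" using assms by (simp_all add: einterval_iff)
  then show ?thesis using less_trans by (auto simp: einterval_iff simp del: less_ereal.simps)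
qed

text \<open>\<open>at_left b\<close> lives on the extended reals; its image on the reals treats
  finite and infinite \<open>b\<close> alike and allows limits of ordinary real functions.\<close>

definition right_end :: "ereal \<Rightarrow> real filter"
  where "right_end b = filtermap real_of_ereal (at_left b)"

text \<open>Any point below \<open>b\<close> can play the role of \<open>a\<close>, so the threshold
  can be required to lie in any prescribed end interval.\<close>

lemma eventually_right_end:
  assumes ab: "a < b"
  shows "eventually P (right_end b) \<longleftrightarrow> (\<exists>d\<in>einterval a b. \<forall>x\<in>einterval d b. P x)"
proof
  assume "eventually P (right_end b)"
  then obtain c where c: "c < b" "\<And>y. c < y \<Longrightarrow> y < b \<Longrightarrow> P (real_of_ereal y)"
    unfolding right_end_def eventually_filtermap eventually_at_left[OF ab] by blast
  have "max a c < b" using ab c by simp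
  then obtain d where d: "max a c < ereal d" "ereal d < b" using ereal_dense2 by blast
  have "P x" if x: "x \<in> einterval d b" for x
  proof -
    have "c < ereal d" "ereal d < ereal x" "ereal x < b" using d x by (simp_all add: einterval_iff)
    then have "c < ereal x" "ereal x < b" using less_trans by blast+
    then show ?thesis using c(2)[of "ereal x"] by simp
  qed
  then show "\<exists>d\<in>einterval a b. \<forall>x\<in>einterval d b. P x" using d by (intro bexI[of _ d]) (auto simp: einterval_iff)
next
  assume "\<exists>d\<in>einterval a b. \<forall>x\<in>einterval d b. P x"
  then obtain d where d: "d \<in> einterval a b" "\<And>x. x \<in> einterval d b \<Longrightarrow> P x" by blast
  have "P (real_of_ereal y)" if y: "ereal d < y" "y < b" for y
  proof -
    obtain t where "y = ereal t" using y by (cases y) auto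
    then show ?thesis using d(2)[of t] y by (simp add: einterval_iff)
  qed
  then show "eventually P (right_end b)"
    unfolding right_end_def eventually_filtermap eventually_at_left[OF ab]
    using d(1) by (intro exI[of _ "ereal d"]) (auto simp: einterval_iff)
qed

lemma right_end_neq_bot:
  assumes ab: "a < b"
  shows "right_end b \<noteq> bot"
proof
  assume "right_end b = bot"
  then have "eventually (\<lambda>x. False) (right_end b)" by simp
  then obtain d where d: "d \<in> einterval a b" "\<And>x. x \<notin> einterval d b"
    unfolding eventually_right_end[OF ab] by blast
  then have "ereal d < b" by (simp add: einterval_iff)
  then show False using einterval_nonempty d(2) by blast
qed

lemma tendsto_right_end_iff: "((\<lambda>x. f (real_of_ereal x)) \<longlongrightarrow> l) (at_left b) \<longleftrightarrow> (f \<longlongrightarrow> l) (right_end b)"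
  by (simp add: right_end_def filterlim_filtermap)

lemma einterval_subset_of_mem: "d \<in> einterval a b \<Longrightarrow> einterval d b \<subseteq> einterval a b"
  using einterval_nested by blast

text \<open>If the range is bounded, its supremum is the limit; if not, every bound is exceeded
  somewhere and, by monotonicity, from there on.\<close>

lemma increasing_tendsto_or_at_top:
  assumes d: "d \<in> einterval a b" and mono: "\<And>x y. \<lbrakk>x \<in> einterval d b; y \<in> einterval d b; x < y\<rbrakk> \<Longrightarrow> T x < (T y :: real)"
  shows "(\<exists>L. (T \<longlongrightarrow> L) (right_end b)) \<or> filterlim T at_top (right_end b)"
proof -
  have db: "ereal d < b" using d by (simp add: einterval_iff)
  note ev = eventually_right_end[OF db]
  have dom: "y \<in> einterval d b" if "x \<in> einterval d b" "y \<in> einterval x b" for x y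
    using einterval_nested that by blast
  show ?thesis
  proof (cases "bdd_above (T ` einterval d b)")
    case True
    obtain x1 where x1: "x1 \<in> einterval d b" using einterval_nonempty[OF db] by blast
    have "(T \<longlongrightarrow> Sup (T ` einterval d b)) (right_end b)"
    proof (rule order_tendstoI)
      fix l assume "l < Sup (T ` einterval d b)"
      then obtain x where x: "x \<in> einterval d b" "l < T x" using less_cSUP_iff[OF _ True] x1 by blast
      have "l < T y" if "y \<in> einterval x b" for y
        using mono[OF x(1) dom[OF x(1) that]] x(2) that by (simp add: einterval_iff)
      then show "\<forall>\<^sub>F x in right_end b. l < T x" unfolding ev using x(1) by blast
    next
      fix l assume l: "Sup (T ` einterval d b) < l"
      have "T y < l" if "y \<in> einterval d b" for y using cSUP_upper[OF that True] l by simp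
      then show "\<forall>\<^sub>F x in right_end b. T x < l" unfolding ev using x1 dom by blast
    qed
    then show ?thesis by blast
  next
    case False
    have "filterlim T at_top (right_end b)"
      unfolding filterlim_at_top
    proof
      fix Z
      obtain x where x: "x \<in> einterval d b" "Z < T x"
        using False unfolding bdd_above_def by (auto simp: not_le)
      have "Z \<le> T y" if "y \<in> einterval x b" for y
        using mono[OF x(1) dom[OF x(1) that]] x(2) that by (simp add: einterval_iff)
      then show "\<forall>\<^sub>F x in right_end b. Z \<le> T x" unfolding ev using x(1) by blast
    qed
    then show ?thesis ..
  qed
qed

text \<open>
  With \<open>\<sigma>\<close> the sign of \<open>p\<close> near \<open>b\<close>, the normalisation by \<open>\<sigma> / W\<close> makes the quotient of two
  solutions an antiderivative of \<open>1 / (\<bar>p\<bar> w\<^sup>2)\<close>.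
\<close>

locale solution_quotient =
  fixes a b :: ereal and p q r s :: "real \<Rightarrow> real" and lam \<sigma> d W :: real and u v w z :: "real \<Rightarrow> real"
  assumes uv: "solution_pair a b p q r s lam u v" and wz: "solution_pair a b p q r s lam w z"
    and d: "d \<in> einterval a b" and nz: "\<And>x. x \<in> einterval d b \<Longrightarrow> w x \<noteq> 0"
    and sgn_p: "AE x\<in>einterval d b in lebesgue. 0 < \<sigma> * p x" and \<sigma>: "\<bar>\<sigma>\<bar> = 1"
    and W: "\<And>x. x \<in> einterval a b \<Longrightarrow> w x * v x - z x * u x = W" and W_nz: "W \<noteq> 0"
begin

definition T :: "real \<Rightarrow> real" where "T x = \<sigma> / W * (u x / w x)"

lemma db: "ereal d < b" using d by (simp add: einterval_iff)

lemma sub: "einterval d b \<subseteq> einterval a b" by (rule einterval_subset_of_mem[OF d])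

lemma T_AC_loc: "T \<in> AC_loc d b"
proof -
  have "u \<in> AC_loc d b" "w \<in> AC_loc d b"
    using uv wz AC_loc_mono[OF _ sub] unfolding solution_pair_def by blast+
  then have "(\<lambda>x. \<sigma> / W * (u x / w x)) \<in> AC_loc d b" by (intro AC_loc_cmult AC_loc_divide nz)
  then show ?thesis unfolding T_def[abs_def] .
qed

text \<open>In the quotient rule the terms with \<open>s\<close> cancel and the numerator becomes
  \<open>W / p\<close>; the factor \<open>\<sigma> / W\<close> then leaves
  \<open>\<sigma> / p = 1 / \<bar>p\<bar>\<close>. The fact \<open>p x \<noteq> 0\<close> is carried
  along for strict monotonicity.\<close>

lemma T_has_derivative_ae:
  "AE x\<in>einterval d b in lebesgue. (T has_real_derivative 1 / (\<bar>p x\<bar> * (w x)\<^sup>2)) (at x) \<and> p x \<noteq> 0"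
proof -
  have "AE x\<in>einterval a b in lebesgue. (u has_real_derivative v x / p x - s x * u x) (at x)"
    "AE x\<in>einterval a b in lebesgue. (w has_real_derivative z x / p x - s x * w x) (at x)"
    using uv wz unfolding solution_pair_def by auto
  then show ?thesis using sgn_p
  proof eventually_elim
    case (elim x)
    show ?case
    proof (intro impI conjI)
      assume x: "x \<in> einterval d b"
      then have xS: "x \<in> einterval a b" using sub by blast
      have du: "(u has_real_derivative v x / p x - s x * u x) (at x)"
        and dw: "(w has_real_derivative z x / p x - s x * w x) (at x)" and px: "0 < \<sigma> * p x"
        using elim x xS by blast+
      show pnz: "p x \<noteq> 0" using px by auto
      have "\<bar>p x\<bar> = \<bar>\<sigma> * p x\<bar>" using \<sigma> by (simp add: abs_mult)
      then have pabs: "\<bar>p x\<bar> = \<sigma> * p x" using px by simp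
      have \<sigma>2: "\<sigma> * \<sigma> = 1" using \<sigma> by (metis abs_mult_self_eq mult_1)
      have inv: "1 / \<bar>p x\<bar> = \<sigma> / p x"
        unfolding pabs using \<sigma>2 pnz px by (simp add: divide_simps)
      have "(T has_real_derivative \<sigma> / W * (((v x / p x - s x * u x) * w x - u x * (z x / p x - s x * w x)) / (w x * w x))) (at x)"
        unfolding T_def[abs_def] by (intro DERIV_cmult DERIV_divide du dw nz x)
      also have "((v x / p x - s x * u x) * w x - u x * (z x / p x - s x * w x)) = W / p x"
        unfolding W[OF xS, symmetric] using pnz by (simp add: field_simps)
      also have "\<sigma> / W * (W / p x / (w x * w x)) = (\<sigma> / p x) / (w x)\<^sup>2"
        using W_nz by (simp add: power2_eq_square)
      also have "\<dots> = 1 / (\<bar>p x\<bar> * (w x)\<^sup>2)" unfolding inv[symmetric] by simp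
      finally show "(T has_real_derivative 1 / (\<bar>p x\<bar> * (w x)\<^sup>2)) (at x)" .
    qed
  qed
qed

lemma T_has_integral:
  assumes "x \<in> einterval d b" "y \<in> einterval d b" "x \<le> y"
  shows "((\<lambda>t. 1 / (\<bar>p t\<bar> * (w t)\<^sup>2)) has_integral T y - T x) {x..y}"
proof (rule AC_loc_FTC[OF T_AC_loc _ assms])
  show "AE x\<in>einterval d b in lebesgue. (T has_real_derivative 1 / (\<bar>p x\<bar> * (w x)\<^sup>2)) (at x)"
    using T_has_derivative_ae by eventually_elim blast
qed

lemma T_mono:
  assumes "x \<in> einterval d b" "y \<in> einterval d b" "x \<le> y"
  shows "T x \<le> T y"
  using has_integral_nonneg[OF T_has_integral[OF assms]] by simp

text \<open>Equality at the two ends would make \<open>T\<close> constant between them, while at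
  almost every point in between the derivative is strictly positive; a nonempty open interval is not
  negligible.\<close>

lemma T_strict_mono:
  assumes xy: "x \<in> einterval d b" "y \<in> einterval d b" "x < y"
  shows "T x < T y"
proof (rule ccontr)
  assume "\<not> T x < T y"
  then have le: "T y \<le> T x" by simp
  have eq: "T t = T x" if "t \<in> {x<..<y}" for t
  proof -
    have "t \<in> einterval d b" "x \<le> t" "t \<le> y" using einterval_Icc_subset[OF xy(1,2)] that by auto
    then have "T x \<le> T t" "T t \<le> T y" using T_mono xy by blast+
    then show ?thesis using le by simp
  qed
  let ?N = "{t\<in>einterval d b. \<not> ((T has_real_derivative 1 / (\<bar>p t\<bar> * (w t)\<^sup>2)) (at t) \<and> p t \<noteq> 0)}"
  have N: "negligible ?N" using T_has_derivative_ae by (simp add: AE_lebesgue_iff_negligible)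
  have "\<not> negligible {x<..<y}" using xy(3) by (intro open_not_negligible) auto
  then obtain t where t: "t \<in> {x<..<y}" "t \<notin> ?N" using negligible_subset[OF N] by blast
  then have tS: "t \<in> einterval d b" using einterval_Icc_subset[OF xy(1,2)] by auto
  have der: "(T has_real_derivative 1 / (\<bar>p t\<bar> * (w t)\<^sup>2)) (at t)" and pt: "p t \<noteq> 0" using t tS by auto
  have "((\<lambda>_. T x) has_real_derivative 1 / (\<bar>p t\<bar> * (w t)\<^sup>2)) (at t)"
    by (rule has_field_derivative_transform_within_open[OF der _ t(1)]) (auto simp: eq)
  then have "1 / (\<bar>p t\<bar> * (w t)\<^sup>2) = 0" using DERIV_const DERIV_unique by blast
  then show False using pt nz[OF tS] by simp
qed

text \<open>Passes from the gauge integral to the Lebesgue integral, which is possible because the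
  integrand is nonnegative.\<close>

lemma nn_integral_Icc:
  assumes "x \<in> einterval d b" "y \<in> einterval d b" "x \<le> y"
  shows "(\<integral>\<^sup>+t\<in>{x..y}. ennreal (1 / (\<bar>p t\<bar> * (w t)\<^sup>2)) \<partial>lebesgue) = ennreal (T y - T x)"
proof -
  have "(\<integral>\<^sup>+t. ennreal (indicator {x..y} t * (1 / (\<bar>p t\<bar> * (w t)\<^sup>2))) \<partial>lebesgue) = ennreal (T y - T x)"
    unfolding nn_integral_completion
    by (rule nn_integral_has_integral_lebesgue[OF _ T_has_integral[OF assms]]) simp
  moreover have "ennreal (indicator {x..y} t * (1 / (\<bar>p t\<bar> * (w t)\<^sup>2))) = ennreal (1 / (\<bar>p t\<bar> * (w t)\<^sup>2)) * indicator {x..y} t" for t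
    by (auto simp: indicator_def)
  ultimately show ?thesis by simp
qed

text \<open>An increasing sequence of compact intervals exhausts \<open>(x,b)\<close>, and the
  integral over each is an increment of \<open>T\<close>, hence at most \<open>M - T x\<close>;
  monotone convergence does the rest.\<close>

lemma int_to_end_finite:
  assumes M: "\<And>y. y \<in> einterval d b \<Longrightarrow> T y \<le> M" and x: "x \<in> einterval d b"
  shows "int_to_end b p w x < \<infinity>"
proof -
  let ?g = "\<lambda>t. ennreal (1 / (\<bar>p t\<bar> * (w t)\<^sup>2))"
  have xb: "ereal x < b" using x by (simp add: einterval_iff)
  obtain U L :: "nat \<Rightarrow> real" where approx: "einterval x b = (\<Union>i. {L i..U i})" "incseq U" "decseq L"
      "\<And>i. L i < U i" "\<And>i. ereal x < ereal (L i)" "\<And>i. ereal (U i) < b"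
    by (rule einterval_Icc_approximation[OF xb]) blast
  have mem: "L i \<in> einterval d b" "U i \<in> einterval d b" for i
  proof -
    have "ereal d < ereal x" using x by (simp add: einterval_iff)
    moreover have "ereal (L i) < b" using approx(4)[of i] approx(6)[of i] by (metis less_ereal.simps(1) less_trans)
    moreover have "ereal x < ereal (U i)" using approx(4)[of i] approx(5)[of i] by simp
    ultimately show "L i \<in> einterval d b" "U i \<in> einterval d b"
      using approx(5,6)[of i] by (auto simp: einterval_iff)
  qed
  have "int_to_end b p w x = (\<integral>\<^sup>+t. (SUP i. ?g t * indicator {L i..U i} t) \<partial>lebesgue)"
    unfolding int_to_end_def approx(1)
  proof (rule nn_integral_cong)
    fix t
    show "?g t * indicator (\<Union>i. {L i..U i}) t = (SUP i. ?g t * indicator {L i..U i} t)"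
    proof (rule antisym)
      show "?g t * indicator (\<Union>i. {L i..U i}) t \<le> (SUP i. ?g t * indicator {L i..U i} t)"
      proof (cases "\<exists>i. t \<in> {L i..U i}")
        case True
        then obtain i where "t \<in> {L i..U i}" by blast
        then have "?g t * indicator (\<Union>i. {L i..U i}) t = ?g t * indicator {L i..U i} t"
          by (auto simp: indicator_def)
        also have "\<dots> \<le> (SUP i. ?g t * indicator {L i..U i} t)" by (rule SUP_upper) simp
        finally show ?thesis .
      qed (auto simp: indicator_def)
      show "(SUP i. ?g t * indicator {L i..U i} t) \<le> ?g t * indicator (\<Union>i. {L i..U i}) t"
        by (intro SUP_least) (auto simp: indicator_def)
    qed
  qed
  also have "\<dots> = (SUP i. \<integral>\<^sup>+t. ?g t * indicator {L i..U i} t \<partial>lebesgue)"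
  proof (rule nn_integral_monotone_convergence_SUP)
    show "incseq (\<lambda>i t. ?g t * indicator {L i..U i} t)"
    proof (intro incseq_SucI le_funI mult_left_mono)
      fix i t
      have "{L i..U i} \<subseteq> {L (Suc i)..U (Suc i)}"
        using decseq_SucD[OF approx(3), of i] incseq_SucD[OF approx(2), of i] by auto
      then show "(indicator {L i..U i} t :: ennreal) \<le> indicator {L (Suc i)..U (Suc i)} t"
        by (auto simp: indicator_def)
    qed simp
    fix i
    \<comment> \<open>Measurability is obtained from gauge integrability on the compact
      piece.\<close>
    have "(\<lambda>t. 1 / (\<bar>p t\<bar> * (w t)\<^sup>2)) integrable_on {L i..U i}"
      using T_has_integral[OF mem] approx(4)[of i] by (meson has_integral_integrable less_imp_le)
    then have "(\<lambda>t. 1 / (\<bar>p t\<bar> * (w t)\<^sup>2)) \<in> borel_measurable (lebesgue_on {L i..U i})"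
      by (rule integrable_imp_measurable)
    then have "(\<lambda>t. (1 / (\<bar>p t\<bar> * (w t)\<^sup>2)) * indicator {L i..U i} t) \<in> borel_measurable lebesgue"
      by (subst (asm) borel_measurable_restrict_space_iff) (auto simp: mult.commute)
    then have "(\<lambda>t. ennreal ((1 / (\<bar>p t\<bar> * (w t)\<^sup>2)) * indicator {L i..U i} t)) \<in> borel_measurable lebesgue"
      by measurable
    moreover have "ennreal ((1 / (\<bar>p t\<bar> * (w t)\<^sup>2)) * indicator {L i..U i} t) = ?g t * indicator {L i..U i} t" for t
      by (auto simp: indicator_def)
    ultimately show "(\<lambda>t. ?g t * indicator {L i..U i} t) \<in> borel_measurable lebesgue" by (simp only:)
  qed
  also have "\<dots> \<le> ennreal (M - T x)"
  proof (rule SUP_least)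
    fix i
    have "T x \<le> T (L i)" using approx(5)[of i] by (intro T_mono x mem) simp
    then show "(\<integral>\<^sup>+t. ?g t * indicator {L i..U i} t \<partial>lebesgue) \<le> ennreal (M - T x)"
      using nn_integral_Icc[OF mem less_imp_le[OF approx(4)]] M[OF mem(2)[of i]] by (auto intro!: ennreal_leI)
  qed
  also have "\<dots> < \<infinity>" by simp
  finally show ?thesis .
qed

text \<open>A finite value \<open>K\<close> would bound all increments of \<open>T\<close> over
  compact subintervals of \<open>(x,b)\<close>.\<close>

lemma int_to_end_infinite:
  assumes lim: "filterlim T at_top (right_end b)" and x: "x \<in> einterval d b"
  shows "int_to_end b p w x = \<infinity>"
proof (rule ccontr)
  assume "int_to_end b p w x \<noteq> \<infinity>"
  then obtain K where K: "int_to_end b p w x = ennreal K" "K \<ge> 0"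
    by (cases "int_to_end b p w x") auto
  have xb: "ereal x < b" using x by (simp add: einterval_iff)
  \<comment> \<open>An interior base point keeps the closed interval from \<open>x'\<close> to
    \<open>y\<close> inside the open interval \<open>(x,b)\<close>.\<close>
  then obtain x' where x': "x' \<in> einterval x b" using einterval_nonempty by blast
  have x'b: "ereal x' < b" using x' by (simp add: einterval_iff)
  have "\<forall>\<^sub>F y in right_end b. T x' + K + 1 \<le> T y" using lim by (simp add: filterlim_at_top)
  then obtain e where e: "e \<in> einterval x' b" "\<And>y. y \<in> einterval e b \<Longrightarrow> T x' + K + 1 \<le> T y"
    unfolding eventually_right_end[OF x'b] by blast
  obtain y where y: "y \<in> einterval e b" using einterval_nonempty[of e b] e(1) by (auto simp: einterval_iff)
  have mem: "x' \<in> einterval d b" "y \<in> einterval d b" "x' \<le> y"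
    using einterval_nested[OF x x'] einterval_nested[OF _ einterval_nested[OF e(1) y]] einterval_nested[OF e(1) y]
    by (auto simp: einterval_iff)
  have "ennreal (T y - T x') = (\<integral>\<^sup>+t\<in>{x'..y}. ennreal (1 / (\<bar>p t\<bar> * (w t)\<^sup>2)) \<partial>lebesgue)"
    by (rule nn_integral_Icc[OF mem, symmetric])
  also have "\<dots> \<le> int_to_end b p w x"
    unfolding int_to_end_def
  proof (rule nn_integral_mono)
    fix t
    have "y \<in> einterval x b" using einterval_nested[OF x' einterval_nested[OF e(1) y]] .
    then have "{x'..y} \<subseteq> einterval x b" by (intro einterval_Icc_subset x')
    then show "ennreal (1 / (\<bar>p t\<bar> * (w t)\<^sup>2)) * indicator {x'..y} t \<le> ennreal (1 / (\<bar>p t\<bar> * (w t)\<^sup>2)) * indicator (einterval x b) t"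
      by (auto simp: indicator_def)
  qed
  finally have "T y - T x' \<le> K" using K by (simp add: ennreal_le_iff)
  then show False using e(2)[OF y] by simp
qed

text \<open>Since \<open>T\<close> increases, only a finite limit has to be excluded, and
  \<open>\<bar>W * T x\<bar>\<close> equals \<open>\<bar>u x / w x\<bar>\<close>. The direction of
  divergence is thus decided by monotonicity.\<close>

lemma T_at_top:
  assumes "filterlim (\<lambda>x. \<bar>u x / w x\<bar>) at_top (right_end b)"
  shows "filterlim T at_top (right_end b)"
proof -
  have "\<not> (T \<longlongrightarrow> L) (right_end b)" for L
  proof
    assume "(T \<longlongrightarrow> L) (right_end b)"
    then have "((\<lambda>x. \<bar>W * T x\<bar>) \<longlongrightarrow> \<bar>W * L\<bar>) (right_end b)" by (intro tendsto_intros)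
    moreover have "\<bar>W * T x\<bar> = \<bar>u x / w x\<bar>" for x using W_nz \<sigma> by (simp add: T_def abs_mult)
    ultimately show False
      using not_tendsto_and_filterlim_at_infinity[OF right_end_neq_bot[OF db], of "\<lambda>x. \<bar>u x / w x\<bar>"]
        filterlim_at_top_imp_at_infinity[OF assms] by simp
  qed
  then show ?thesis using increasing_tendsto_or_at_top[OF d, of T] T_strict_mono by blast
qed

text \<open>\<open>T\<close> increases strictly from \<open>T x0\<close> to infinity: a positive
  start leaves no zero, a negative one exactly one. The hypotheses describe the sign of
  \<open>T x0\<close>, since multiplying it by \<open>W * W > 0\<close> moves the Wronskian from the
  denominator to the numerator.\<close>

lemma zeros_of_numerator:
  assumes lim: "filterlim T at_top (right_end b)" and x0: "x0 \<in> einterval d b"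
  shows "0 < \<sigma> * (u x0 / w x0) * W \<Longrightarrow> no_zero_in (einterval x0 b) u"
    and "\<sigma> * (u x0 / w x0) * W < 0 \<Longrightarrow> exactly_one_zero_in (einterval x0 b) u"
proof -
  have zero: "u x = 0 \<longleftrightarrow> T x = 0" if "x \<in> einterval d b" for x
    using nz[OF that] W_nz \<sigma> by (auto simp: T_def)
  have TW: "T x0 * (W * W) = \<sigma> * (u x0 / w x0) * W" using W_nz by (simp add: T_def)
  have W2: "0 < W * W" using W_nz by (simp add: zero_less_mult_iff) linarith
  have mem: "x \<in> einterval d b" "x0 < x" if "x \<in> einterval x0 b" for x
    using einterval_nested[OF x0 that] that by (auto simp: einterval_iff)
  show "no_zero_in (einterval x0 b) u" if "0 < \<sigma> * (u x0 / w x0) * W"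
  proof -
    have "0 < T x0" using that W2 unfolding TW[symmetric] by (simp add: zero_less_mult_iff)
    then show ?thesis unfolding no_zero_in_def using zero mem T_strict_mono[OF x0] by force
  qed
  show "exactly_one_zero_in (einterval x0 b) u" if "\<sigma> * (u x0 / w x0) * W < 0"
  proof -
    have neg: "T x0 < 0" using that W2 unfolding TW[symmetric] by (simp add: mult_less_0_iff)
    have x0b: "ereal x0 < b" using x0 by (simp add: einterval_iff)
    have "\<forall>\<^sub>F y in right_end b. 1 \<le> T y" using lim by (simp add: filterlim_at_top)
    then obtain e where e: "e \<in> einterval x0 b" "\<And>y. y \<in> einterval e b \<Longrightarrow> 1 \<le> T y"
      unfolding eventually_right_end[OF x0b] by blast
    obtain y where y: "y \<in> einterval e b" using einterval_nonempty[of e b] e(1) by (auto simp: einterval_iff)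
    have y': "y \<in> einterval x0 b" using einterval_nested[OF e(1) y] .
    have "continuous_on {x0..y} T"
      by (rule continuous_on_subset[OF AC_loc_continuous_on[OF T_AC_loc] einterval_Icc_subset[OF x0 mem(1)[OF y']]])
    moreover have "T x0 \<le> 0" "0 \<le> T y" "x0 \<le> y" using neg e(2)[OF y] mem(2)[OF y'] by auto
    ultimately obtain t where t: "x0 \<le> t" "t \<le> y" "T t = 0" using IVT'[of T x0 0 y] by blast
    have "t \<noteq> x0" using t neg by auto
    moreover have "ereal t \<le> ereal y" "ereal y < b" using t y' by (simp_all add: einterval_iff)
    then have "ereal t < b" by (rule le_less_trans)
    ultimately have tS: "t \<in> einterval x0 b" using t by (simp add: einterval_iff)
    show ?thesis
      unfolding exactly_one_zero_in_def
    proof (rule ex1I[of _ t])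
      show "t \<in> einterval x0 b \<and> u t = 0" using tS zero[OF mem(1)[OF tS]] t(3) by simp
      fix t' assume t': "t' \<in> einterval x0 b \<and> u t' = 0"
      then have "T t' = 0" using zero mem(1) by blast
      then show "t' = t"
        using T_strict_mono[of t t'] T_strict_mono[of t' t] mem(1)[OF tS] mem(1)[of t'] t' t(3)
        by (cases t t' rule: linorder_cases) auto
    qed
  qed
qed

end

section \<open>Existence of a principal solution\<close>

text \<open>Only finitely many zeros lie beyond some point \<open>e\<close>, so the maximum of these
  zeros, \<open>e\<close> and \<open>c\<close> can serve as \<open>d\<close>.\<close>

lemma nonoscillatory_eventually_nonzero:
  assumes nonosc: "\<not> oscillatory_at_right_end a b p q r s lam"
    and u: "is_solution a b p q r s lam u" "nontrivial_on (einterval a b) u" and c: "c \<in> einterval a b"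
  obtains d where "d \<in> einterval a b" "c \<le> d" "\<And>x. x \<in> einterval d b \<Longrightarrow> u x \<noteq> 0"
proof -
  obtain e where e: "e \<in> einterval a b" "finite {x \<in> einterval e b. u x = 0}"
    using nonosc u unfolding oscillatory_at_right_end_def by blast
  define M where "M = insert c (insert e {x \<in> einterval e b. u x = 0})"
  have M: "finite M" "M \<noteq> {}" "M \<subseteq> einterval a b"
    using e c einterval_nested[OF e(1)] by (auto simp: M_def)
  have "Max M \<in> M" using M by (intro Max_in)
  show thesis
  proof (rule that)
    show "Max M \<in> einterval a b" using \<open>Max M \<in> M\<close> M by blast
    show "c \<le> Max M" using M by (intro Max_ge) (auto simp: M_def)
    fix x assume x: "x \<in> einterval (Max M) b"
    show "u x \<noteq> 0"
    proof
      assume "u x = 0"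
      have "e \<le> Max M" using M by (intro Max_ge) (auto simp: M_def)
      then have "x \<in> einterval e b" using x by (simp add: einterval_iff)
      then have "x \<le> Max M" using M \<open>u x = 0\<close> by (intro Max_ge) (auto simp: M_def)
      then show False using x by (simp add: einterval_iff)
    qed
  qed
qed

text \<open>If \<open>u\<close> vanished identically, then so would \<open>v\<close>: almost
  everywhere by the equation, everywhere by continuity. The hypothesis on \<open>\<alpha>\<close>
  and \<open>\<beta>\<close> is a nonzero linear form in \<open>u x\<close> and \<open>v x\<close>,
  in applications a Wronskian.\<close>

lemma solution_pair_nontrivial:
  assumes uv: "solution_pair a b p q r s lam u v" and p: "AE x\<in>einterval a b in lebesgue. p x \<noteq> 0"
    and x: "x \<in> einterval a b" and W: "u x * \<alpha> + v x * \<beta> \<noteq> 0"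
  shows "nontrivial_on (einterval a b) u"
proof (rule ccontr)
  assume "\<not> nontrivial_on (einterval a b) u"
  then have u0: "u t = 0" if "t \<in> einterval a b" for t using that by (auto simp: nontrivial_on_def)
  have "AE x\<in>einterval a b in lebesgue. (u has_real_derivative v x / p x - s x * u x) (at x)"
    using uv unfolding solution_pair_def by blast
  then have "AE x\<in>einterval a b in lebesgue. v x = 0"
    using p
  proof eventually_elim
    case (elim t)
    show ?case
    proof
      assume t: "t \<in> einterval a b"
      then have d: "(u has_real_derivative v t / p t - s t * u t) (at t)" and "p t \<noteq> 0" using elim by blast+
      have "((\<lambda>_. 0) has_real_derivative v t / p t - s t * u t) (at t)"
        by (rule has_field_derivative_transform_within_open[OF d open_einterval t]) (simp add: u0)
      then have "v t / p t - s t * u t = 0" using DERIV_const DERIV_unique by blast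
      then show "v t = 0" using u0[OF t] \<open>p t \<noteq> 0\<close> by simp
    qed
  qed
  then have "v x = 0"
    using uv AC_loc_eq_if_ae_eq[OF _ AC_loc_const[of 0] _ x] unfolding solution_pair_def by blast
  then show False using W u0[OF x] by simp
qed

lemma AE_einterval_right_mono:
  assumes "AE x\<in>einterval (ereal c) b in lebesgue. P x" "c \<le> d"
  shows "AE x\<in>einterval (ereal d) b in lebesgue. P x"
  using assms(1) by eventually_elim (use assms(2) in \<open>auto simp: einterval_iff\<close>)

text \<open>
  Given two independent solutions, one of them without zeros near \<open>b\<close>, their quotient is monotone
  near \<open>b\<close>. If its limit is finite, subtracting the right multiple yields the principal solution;
  otherwise the denominator already is one.
\<close>

lemma principal_solution_exists:
  assumes loc: "locally_integrable_on (\<lambda>x. 1 / p x) (einterval a b)" "locally_integrable_on q (einterval a b)"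
    "locally_integrable_on r (einterval a b)" "locally_integrable_on s (einterval a b)"
    and r: "AE x\<in>einterval a b in lebesgue. r x > 0" and p: "AE x\<in>einterval a b in lebesgue. p x \<noteq> 0"
    and c: "c \<in> einterval a b" and sgn_p: "AE x\<in>einterval c b in lebesgue. 0 < \<sigma> * p x" and \<sigma>: "\<bar>\<sigma>\<bar> = 1"
    and nonosc: "\<not> oscillatory_at_right_end a b p q r s lam"
  obtains u v w z k where "solution_pair a b p q r s lam u v" "solution_pair a b p q r s lam w z"
    "\<forall>x\<in>einterval a b. u x * z x - v x * w x = k" "k \<noteq> 0" "((\<lambda>x. u x / w x) \<longlongrightarrow> 0) (right_end b)"
proof -
  \<comment> \<open>The initial data of \<open>f\<close> and \<open>g\<close> at \<open>c\<close>
    form the identity matrix, so their Wronskian is 1.\<close>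
  obtain f f1 where f: "solution_pair a b p q r s lam f f1" "f c = 1" "f1 c = 0"
    by (rule solution_pair_exists[OF loc c])
  obtain g g1 where g: "solution_pair a b p q r s lam g g1" "g c = 0" "g1 c = 1"
    by (rule solution_pair_exists[OF loc c])
  have W: "f x * g1 x - f1 x * g x = 1" if "x \<in> einterval a b" for x
    using solution_pair_wronskian_constant[OF f(1) g(1) that c] f g by simp
  have "nontrivial_on (einterval a b) f" unfolding nontrivial_on_def by (intro bexI[OF _ c]) (simp add: f(2))
  then obtain d where d: "d \<in> einterval a b" "c \<le> d" "\<And>x. x \<in> einterval d b \<Longrightarrow> f x \<noteq> 0"
    using nonoscillatory_eventually_nonzero[OF nonosc solution_pair_imp_is_solution(1)[OF f(1) r p] _ c] by blast
  interpret Q: solution_quotient a b p q r s lam \<sigma> d 1 g g1 f f1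
    by unfold_locales (use f g d W \<sigma> AE_einterval_right_mono[OF sgn_p d(2)] in auto)
  have \<sigma>2: "\<sigma> * \<sigma> = 1" using \<sigma> by (metis abs_mult_self_eq mult_1)
  from increasing_tendsto_or_at_top[OF d(1) Q.T_strict_mono] show thesis
  proof
    assume "\<exists>L. (Q.T \<longlongrightarrow> L) (right_end b)"
    then obtain L where L: "(Q.T \<longlongrightarrow> L) (right_end b)" ..
    \<comment> \<open>Since \<open>g x / f x = \<sigma> * Q.T x\<close>, this is the limit of the
      unnormalised quotient.\<close>
    define C where "C = \<sigma> * L"
    have "((\<lambda>x. \<sigma> * Q.T x - C) \<longlongrightarrow> \<sigma> * L - C) (right_end b)" by (intro tendsto_intros L)
    moreover have "\<sigma> * Q.T x = g x / f x" for x
      using \<sigma>2 by (simp add: Q.T_def mult.assoc[symmetric])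
    ultimately have lim: "((\<lambda>x. g x / f x - C) \<longlongrightarrow> 0) (right_end b)" by (simp add: C_def)
    show thesis
    proof (rule that[OF solution_pair_linear[OF g(1) f(1), of 1 "- C"] f(1)])
      show "\<forall>x\<in>einterval a b. (1 * g x + - C * f x) * f1 x - (1 * g1 x + - C * f1 x) * f x = - 1"
        using W by (simp add: algebra_simps)
      have "g x / f x - C = (1 * g x + - C * f x) / f x" if "x \<in> einterval d b" for x
        using d(3)[OF that] by (simp add: field_simps)
      moreover have "a < b" using c by (auto simp: einterval_iff)
      ultimately have "\<forall>\<^sub>F x in right_end b. g x / f x - C = (1 * g x + - C * f x) / f x"
        using d(1) eventually_right_end by blast
      then show "((\<lambda>x. (1 * g x + - C * f x) / f x) \<longlongrightarrow> 0) (right_end b)"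
        by (rule Lim_transform_eventually[OF lim])
    qed simp
  next
    assume top: "filterlim Q.T at_top (right_end b)"
    have "((\<lambda>x. inverse (Q.T x)) \<longlongrightarrow> 0) (right_end b)"
      by (rule filterlim_compose[OF tendsto_inverse_0 filterlim_at_top_imp_at_infinity[OF top]])
    then have "((\<lambda>x. \<sigma> * inverse (Q.T x)) \<longlongrightarrow> \<sigma> * 0) (right_end b)" by (intro tendsto_intros)
    \<comment> \<open>This holds at every \<open>x\<close>, zeros of \<open>f\<close> and
      \<open>g\<close> included, by the convention that division by zero yields 0.\<close>
    moreover have "\<sigma> * inverse (Q.T x) = f x / g x" for x
      using \<sigma>2 \<sigma> by (auto simp: Q.T_def divide_simps)
    ultimately have "((\<lambda>x. f x / g x) \<longlongrightarrow> 0) (right_end b)" by simp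
    then show thesis using that[OF f(1) g(1), of 1] W by simp
  qed
qed

text \<open>The quotient is eventually nonzero, so its modulus tends to 0 through positive values
  and the reciprocal diverges.\<close>

lemma abs_quotient_at_top:
  assumes lim: "((\<lambda>x. u x / w x) \<longlongrightarrow> (0::real)) F" and nz: "\<forall>\<^sub>F x in F. u x \<noteq> 0" "\<forall>\<^sub>F x in F. w x \<noteq> 0"
  shows "filterlim (\<lambda>x. \<bar>w x / u x\<bar>) at_top F"
proof -
  have "((\<lambda>x. \<bar>u x / w x\<bar>) \<longlongrightarrow> 0) F" using lim by (rule tendsto_rabs_zero)
  moreover have "\<forall>\<^sub>F x in F. 0 < \<bar>u x / w x\<bar>" using nz by eventually_elim simp
  ultimately have "filterlim (\<lambda>x. inverse \<bar>u x / w x\<bar>) at_top F" by (rule filterlim_inverse_at_top)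
  then show ?thesis by simp
qed

theorem theorem11p4:
  fixes a b :: ereal and p q r s :: "real \<Rightarrow> real" and lam c :: real
  assumes "a < b"
    and "p \<in> borel_measurable (lebesgue_on (einterval a b))"
    and "q \<in> borel_measurable (lebesgue_on (einterval a b))"
    and "r \<in> borel_measurable (lebesgue_on (einterval a b))"
    and "s \<in> borel_measurable (lebesgue_on (einterval a b))"
    and "locally_integrable_on (\<lambda>x. 1 / p x) (einterval a b)"
    and "locally_integrable_on q (einterval a b)"
    and "locally_integrable_on r (einterval a b)"
    and "locally_integrable_on s (einterval a b)"
    and "AE x\<in>einterval a b in lebesgue. r x > 0"
    and "AE x\<in>einterval a b in lebesgue. p x \<noteq> 0"
    and "c \<in> einterval a b"
    and "(AE x\<in>einterval c b in lebesgue. p x > 0) \<or> (AE x\<in>einterval c b in lebesgue. p x < 0)"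
    and "\<not> oscillatory_at_right_end a b p q r s lam"
  shows "\<exists>u0. is_solution a b p q r s lam u0 \<and> nontrivial_on (einterval a b) u0 \<and>
    int_near_end_infinite a b p u0 \<and>
    (\<forall>u1. is_solution a b p q r s lam u1 \<and> lin_indep_on (einterval a b) u0 u1 \<longrightarrow>
      ((\<lambda>x. u0 (real_of_ereal x) / u1 (real_of_ereal x)) \<longlongrightarrow> 0) (at_left b) \<and>
      int_near_end_finite a b p u1 \<and>
      (\<forall>x0\<in>einterval c b. (\<forall>x\<in>einterval a b. u0 x = 0 \<longrightarrow> x < x0) \<and> u1 x0 \<noteq> 0 \<longrightarrow>
        (u1 x0 / u0 x0 > 0 \<longrightarrow>
          ((AE x\<in>einterval c b in lebesgue. p x > 0) \<longrightarrow>
            (wronskian a b p s u0 u1 x0 > 0 \<longrightarrow> no_zero_in (einterval x0 b) u1) \<and>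
            (wronskian a b p s u0 u1 x0 < 0 \<longrightarrow> exactly_one_zero_in (einterval x0 b) u1)) \<and>
          ((AE x\<in>einterval c b in lebesgue. p x < 0) \<longrightarrow>
            (wronskian a b p s u0 u1 x0 < 0 \<longrightarrow> no_zero_in (einterval x0 b) u1) \<and>
            (wronskian a b p s u0 u1 x0 > 0 \<longrightarrow> exactly_one_zero_in (einterval x0 b) u1))) \<and>
        (u1 x0 / u0 x0 < 0 \<longrightarrow>
          ((AE x\<in>einterval c b in lebesgue. p x > 0) \<longrightarrow>
            (wronskian a b p s u0 u1 x0 < 0 \<longrightarrow> no_zero_in (einterval x0 b) u1) \<and>
            (wronskian a b p s u0 u1 x0 > 0 \<longrightarrow> exactly_one_zero_in (einterval x0 b) u1)) \<and>
          ((AE x\<in>einterval c b in lebesgue. p x < 0) \<longrightarrow>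
            (wronskian a b p s u0 u1 x0 > 0 \<longrightarrow> no_zero_in (einterval x0 b) u1) \<and>
            (wronskian a b p s u0 u1 x0 < 0 \<longrightarrow> exactly_one_zero_in (einterval x0 b) u1)))))"
proof -
  let ?S = "einterval a b"
  note loc = assms(6-9) and r = assms(10) and p = assms(11) and c = assms(12) and nonosc = assms(14)
  obtain \<sigma> :: real where \<sigma>: "\<bar>\<sigma>\<bar> = 1" "AE x\<in>einterval c b in lebesgue. 0 < \<sigma> * p x"
    using assms(13)
  proof
    assume "AE x\<in>einterval c b in lebesgue. p x > 0"
    then show thesis using that[of 1] by simp
  next
    assume "AE x\<in>einterval c b in lebesgue. p x < 0"
    then show thesis using that[of "- 1"] by simp
  qed
  obtain u0 v0 w z k where u0: "solution_pair a b p q r s lam u0 v0" and w: "solution_pair a b p q r s lam w z"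
    and k_all: "\<forall>x\<in>?S. u0 x * z x - v0 x * w x = k" and k_nz: "k \<noteq> 0"
    and lim: "((\<lambda>x. u0 x / w x) \<longlongrightarrow> 0) (right_end b)"
    by (rule principal_solution_exists[OF loc r p c \<sigma>(2,1) nonosc])
  have k: "u0 x * z x - v0 x * w x = k" if "x \<in> ?S" for x using k_all k_nz that by blast
  \<comment> \<open>A nonzero linear form in the data at \<open>c\<close> certifies nontriviality,
    and nonoscillation then excludes zeros near \<open>b\<close>.\<close>
  have nonzero: "\<exists>d\<in>?S. c \<le> d \<and> (\<forall>x\<in>einterval d b. u x \<noteq> 0)"
    if uv: "solution_pair a b p q r s lam u v" and nz: "u c * \<alpha> + v c * \<beta> \<noteq> 0" for u v \<alpha> \<beta>
    using nonoscillatory_eventually_nonzero[OF nonosc solution_pair_imp_is_solution(1)[OF uv r p]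
        solution_pair_nontrivial[OF uv p c nz] c] by metis
  have ev: "\<forall>\<^sub>F x in right_end b. u x \<noteq> 0" if "\<exists>d\<in>?S. c \<le> d \<and> (\<forall>x\<in>einterval d b. u x \<noteq> 0)" for u :: "real \<Rightarrow> real"
    unfolding eventually_right_end[OF assms(1)] using that by blast
  \<comment> \<open>Both forms are Wronskians: their coefficients are, up to sign, the data of the
    other solution, so their values are \<open>k\<close>.\<close>
  have u0_nz: "u0 c * z c + v0 c * (- w c) \<noteq> 0" using k[OF c] k_nz by simp
  have w_nz: "w c * (- v0 c) + z c * u0 c \<noteq> 0" using k[OF c] k_nz by (simp add: algebra_simps)
  obtain d0 where d0: "d0 \<in> ?S" "c \<le> d0" "\<forall>x\<in>einterval d0 b. u0 x \<noteq> 0" using nonzero[OF u0 u0_nz] by blast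
  note ev_u0 = ev[OF nonzero[OF u0 u0_nz]] and ev_w = ev[OF nonzero[OF w w_nz]]
  \<comment> \<open>With \<open>w\<close> over \<open>u0\<close> the quotient diverges, which gives
    the infinite integral for the denominator \<open>u0\<close>.\<close>
  interpret Q0: solution_quotient a b p q r s lam \<sigma> d0 k w z u0 v0
    by unfold_locales (use u0 w d0 k k_nz \<sigma> AE_einterval_right_mono[OF \<sigma>(2) d0(2)] in auto)
  have inf0: "int_near_end_infinite a b p u0"
    unfolding int_near_end_infinite_def no_zero_in_def
    using d0 Q0.int_to_end_infinite[OF Q0.T_at_top[OF abs_quotient_at_top[OF lim ev_u0 ev_w]]] by blast
  show ?thesis
  proof (intro exI[of _ u0] conjI allI impI)
    show "is_solution a b p q r s lam u0" by (rule solution_pair_imp_is_solution(1)[OF u0 r p])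
    show "nontrivial_on ?S u0" by (rule solution_pair_nontrivial[OF u0 p c u0_nz])
    show "int_near_end_infinite a b p u0" by (rule inf0)
    fix u1 assume asm: "is_solution a b p q r s lam u1 \<and> lin_indep_on ?S u0 u1"
    define v1 where "v1 = quasi_deriv a b p s u1"
    have u1: "solution_pair a b p q r s lam u1 v1"
      unfolding v1_def using asm by (intro is_solution_imp_solution_pair r p) blast
    define W where "W = u0 c * v1 c - v0 c * u1 c"
    define m where "m = u1 c * z c - v1 c * w c"
    have W: "u0 x * v1 x - v0 x * u1 x = W" and m: "u1 x * z x - v1 x * w x = m" if "x \<in> ?S" for x
      unfolding W_def m_def by (rule solution_pair_wronskian_constant[OF u0 u1 that c] solution_pair_wronskian_constant[OF u1 w that c])+
    \<comment> \<open>Eliminating between the three constant Wronskians expresses \<open>u1\<close>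
      through \<open>u0\<close> and \<open>w\<close>; if \<open>W\<close> were 0, \<open>u0\<close>
      and \<open>u1\<close> would be dependent.\<close>
    have rep: "k * u1 x = m * u0 x + W * w x" if "x \<in> ?S" for x
      unfolding k[OF that, symmetric] m[OF that, symmetric] W[OF that, symmetric] by (simp add: algebra_simps)
    have W_nz: "W \<noteq> 0"
    proof
      assume "W = 0"
      then have "\<forall>x\<in>?S. (- m) * u0 x + k * u1 x = 0" using rep by simp
      then have "k = 0" using asm unfolding lin_indep_on_def by blast
      then show False using k_nz by simp
    qed
    have u1_nz: "u1 c * (- v0 c) + v1 c * u0 c \<noteq> 0" using W_nz by (simp add: W_def algebra_simps)
    note ev_u1 = ev[OF nonzero[OF u1 u1_nz]]
    have lim1: "((\<lambda>x. u0 x / u1 x) \<longlongrightarrow> 0) (right_end b)"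
    proof -
      \<comment> \<open>Dividing the representation by \<open>w\<close> writes
        \<open>u0 / u1\<close> as a function of \<open>u0 / w\<close> that is continuous at 0
        because \<open>W \<noteq> 0\<close>.\<close>
      have "((\<lambda>x. k * (u0 x / w x) / (m * (u0 x / w x) + W)) \<longlongrightarrow> k * 0 / (m * 0 + W)) (right_end b)"
        by (intro tendsto_intros lim) (simp add: W_nz)
      then have *: "((\<lambda>x. k * (u0 x / w x) / (m * (u0 x / w x) + W)) \<longlongrightarrow> 0) (right_end b)" by simp
      have "\<forall>\<^sub>F x in right_end b. x \<in> ?S"
        unfolding eventually_right_end[OF assms(1)] using c einterval_nested[OF c] by blast
      with ev_w have "\<forall>\<^sub>F x in right_end b. k * (u0 x / w x) / (m * (u0 x / w x) + W) = u0 x / u1 x"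
      proof eventually_elim
        case (elim x)
        have "m * (u0 x / w x) + W = k * u1 x / w x" using elim rep[OF elim(2)] by (simp add: field_simps)
        then show ?case using elim(1) k_nz by simp
      qed
      then show ?thesis by (rule Lim_transform_eventually[OF *])
    qed
    show "((\<lambda>x. u0 (real_of_ereal x) / u1 (real_of_ereal x)) \<longlongrightarrow> 0) (at_left b)"
      using lim1 by (simp only: tendsto_right_end_iff[of "\<lambda>x. u0 x / u1 x"])
    show "int_near_end_finite a b p u1"
    proof -
      obtain d1 where d1: "d1 \<in> ?S" "c \<le> d1" "\<forall>x\<in>einterval d1 b. u1 x \<noteq> 0" using nonzero[OF u1 u1_nz] by blast
      have W': "u1 x * v0 x - v1 x * u0 x = - W" if "x \<in> ?S" for x using W[OF that] by (simp add: algebra_simps)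
      \<comment> \<open>The roles are exchanged, \<open>u0\<close> over \<open>u1\<close>, hence the
        Wronskian \<open>- W\<close>. This increasing quotient tends to 0, so 0 is an upper bound
        for it.\<close>
      interpret Q1: solution_quotient a b p q r s lam \<sigma> d1 "- W" u0 v0 u1 v1
        by unfold_locales (use u0 u1 d1 W' W_nz \<sigma> AE_einterval_right_mono[OF \<sigma>(2) d1(2)] in auto)
      have "((\<lambda>x. \<sigma> / (- W) * (u0 x / u1 x)) \<longlongrightarrow> \<sigma> / (- W) * 0) (right_end b)" by (intro tendsto_intros lim1) (simp add: W_nz)
      then have T0: "(Q1.T \<longlongrightarrow> 0) (right_end b)" by (simp add: Q1.T_def[abs_def])
      have "Q1.T y \<le> 0" if y: "y \<in> einterval d1 b" for y
      proof (rule tendsto_lowerbound[OF T0 _ right_end_neq_bot[OF assms(1)]])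
        have "Q1.T y \<le> Q1.T x" if "x \<in> einterval y b" for x
          using Q1.T_mono[OF y einterval_nested[OF y that]] that by (simp add: einterval_iff)
        then show "\<forall>\<^sub>F x in right_end b. Q1.T y \<le> Q1.T x" unfolding eventually_right_end[OF Q1.db] using y by blast
      qed
      then show ?thesis
        unfolding int_near_end_finite_def no_zero_in_def using d1 Q1.int_to_end_finite by blast
    qed
    \<comment> \<open>The sign \<open>\<tau>\<close> is quantified afresh, because each of the two
      cases for \<open>p\<close> supplies its own sign.\<close>
    have key: "(0 < \<tau> * (u1 x0 / u0 x0) * W \<longrightarrow> no_zero_in (einterval x0 b) u1) \<and>
        (\<tau> * (u1 x0 / u0 x0) * W < 0 \<longrightarrow> exactly_one_zero_in (einterval x0 b) u1)"
      if x0: "x0 \<in> einterval c b" "\<forall>x\<in>?S. u0 x = 0 \<longrightarrow> x < x0"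
        and \<tau>: "\<bar>\<tau>\<bar> = 1" "AE x\<in>einterval c b in lebesgue. 0 < \<tau> * p x" for x0 \<tau> :: real
    proof -
      have x0S: "x0 \<in> ?S" by (rule einterval_nested[OF c x0(1)])
      have "isCont u0 x0"
        using u0 x0S AC_loc_continuous_on unfolding solution_pair_def by (metis continuous_on_eq_continuous_at open_einterval)
      moreover have "u0 x0 \<noteq> 0" using x0(2) x0S by blast
      ultimately obtain e where e: "e > 0" "\<And>y. dist x0 y < e \<Longrightarrow> u0 y \<noteq> 0"
        using continuous_at_avoid[of x0 u0 0] by auto
      \<comment> \<open>The locale works on an open interval, which must contain \<open>x0\<close>
        and no zero of \<open>u0\<close>; its left end is moved slightly below \<open>x0\<close> by
        continuity. The maximum with \<open>c\<close> keeps it where the sign of \<open>p\<close> is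
        known.\<close>
      define y0 where "y0 = max c (x0 - e)"
      have y0: "c \<le> y0" "y0 < x0" using x0(1) e(1) by (auto simp: y0_def einterval_iff)
      have "ereal y0 < ereal x0" "ereal x0 < b" using y0 x0(1) by (auto simp: einterval_iff)
      then have y0b: "ereal y0 < b" by (rule less_trans)
      have "a < ereal c" "ereal c \<le> ereal y0" using c y0 by (auto simp: einterval_iff)
      then have "a < ereal y0" by (rule less_le_trans)
      then have y0S: "y0 \<in> ?S" using y0b by (simp add: einterval_iff)
      have nz: "u0 x \<noteq> 0" if x: "x \<in> einterval y0 b" for x
      proof (cases "x0 \<le> x")
        case True
        then show ?thesis using x0(2) einterval_nested[OF y0S x] by force
      next
        case False
        then have "dist x0 x < e" using x by (auto simp: y0_def einterval_iff dist_real_def)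
        then show ?thesis by (rule e(2))
      qed
      interpret Q2: solution_quotient a b p q r s lam \<tau> y0 W u1 v1 u0 v0
        by unfold_locales (use u0 u1 y0S nz W W_nz \<tau> AE_einterval_right_mono[OF \<tau>(2) y0(1)] in auto)
      have "x0 \<in> einterval y0 b" using y0 x0(1) by (simp add: einterval_iff)
      then show ?thesis
        using Q2.zeros_of_numerator[OF Q2.T_at_top[OF abs_quotient_at_top[OF lim1 ev_u0 ev_u1]]] by blast
    qed
    \<comment> \<open>\<open>v1\<close> is the quasi-derivative of \<open>u1\<close> by definition,
      whereas \<open>v0\<close> is known to agree with that of \<open>u0\<close> on
      \<open>(a,b)\<close>.\<close>
    have wr: "wronskian a b p s u0 u1 x = W" if "x \<in> ?S" for x
      using W[OF that] solution_pair_imp_is_solution(2)[OF u0 r p that] by (simp add: wronskian_def v1_def)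
    show "\<forall>x0\<in>einterval c b. (\<forall>x\<in>?S. u0 x = 0 \<longrightarrow> x < x0) \<and> u1 x0 \<noteq> 0 \<longrightarrow>  ((u1 x0 / u0 x0 > 0 \<longrightarrow>
          ((AE x\<in>einterval c b in lebesgue. p x > 0) \<longrightarrow>
            (wronskian a b p s u0 u1 x0 > 0 \<longrightarrow> no_zero_in (einterval x0 b) u1) \<and>
            (wronskian a b p s u0 u1 x0 < 0 \<longrightarrow> exactly_one_zero_in (einterval x0 b) u1)) \<and>
          ((AE x\<in>einterval c b in lebesgue. p x < 0) \<longrightarrow>
            (wronskian a b p s u0 u1 x0 < 0 \<longrightarrow> no_zero_in (einterval x0 b) u1) \<and>
            (wronskian a b p s u0 u1 x0 > 0 \<longrightarrow> exactly_one_zero_in (einterval x0 b) u1))) \<and>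
        (u1 x0 / u0 x0 < 0 \<longrightarrow>
          ((AE x\<in>einterval c b in lebesgue. p x > 0) \<longrightarrow>
            (wronskian a b p s u0 u1 x0 < 0 \<longrightarrow> no_zero_in (einterval x0 b) u1) \<and>
            (wronskian a b p s u0 u1 x0 > 0 \<longrightarrow> exactly_one_zero_in (einterval x0 b) u1)) \<and>
          ((AE x\<in>einterval c b in lebesgue. p x < 0) \<longrightarrow>
            (wronskian a b p s u0 u1 x0 > 0 \<longrightarrow> no_zero_in (einterval x0 b) u1) \<and>
            (wronskian a b p s u0 u1 x0 < 0 \<longrightarrow> exactly_one_zero_in (einterval x0 b) u1))))"
    proof (intro ballI impI)
      fix x0 assume x0: "x0 \<in> einterval c b" and a: "(\<forall>x\<in>?S. u0 x = 0 \<longrightarrow> x < x0) \<and> u1 x0 \<noteq> 0"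
      have wr0: "wronskian a b p s u0 u1 x0 = W" by (rule wr[OF einterval_nested[OF c x0]])
      have pos: "(0 < (u1 x0 / u0 x0) * W \<longrightarrow> no_zero_in (einterval x0 b) u1) \<and>
        ((u1 x0 / u0 x0) * W < 0 \<longrightarrow> exactly_one_zero_in (einterval x0 b) u1)"
        if "AE x\<in>einterval c b in lebesgue. p x > 0"
        using key[OF x0 conjunct1[OF a], of 1] that by simp
      have neg: "((u1 x0 / u0 x0) * W < 0 \<longrightarrow> no_zero_in (einterval x0 b) u1) \<and>
        (0 < (u1 x0 / u0 x0) * W \<longrightarrow> exactly_one_zero_in (einterval x0 b) u1)"
        if "AE x\<in>einterval c b in lebesgue. p x < 0"
        using key[OF x0 conjunct1[OF a], of "- 1"] that by simp
      show " ((u1 x0 / u0 x0 > 0 \<longrightarrow>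
          ((AE x\<in>einterval c b in lebesgue. p x > 0) \<longrightarrow>
            (wronskian a b p s u0 u1 x0 > 0 \<longrightarrow> no_zero_in (einterval x0 b) u1) \<and>
            (wronskian a b p s u0 u1 x0 < 0 \<longrightarrow> exactly_one_zero_in (einterval x0 b) u1)) \<and>
          ((AE x\<in>einterval c b in lebesgue. p x < 0) \<longrightarrow>
            (wronskian a b p s u0 u1 x0 < 0 \<longrightarrow> no_zero_in (einterval x0 b) u1) \<and>
            (wronskian a b p s u0 u1 x0 > 0 \<longrightarrow> exactly_one_zero_in (einterval x0 b) u1))) \<and>
        (u1 x0 / u0 x0 < 0 \<longrightarrow>
          ((AE x\<in>einterval c b in lebesgue. p x > 0) \<longrightarrow>
            (wronskian a b p s u0 u1 x0 < 0 \<longrightarrow> no_zero_in (einterval x0 b) u1) \<and>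
            (wronskian a b p s u0 u1 x0 > 0 \<longrightarrow> exactly_one_zero_in (einterval x0 b) u1)) \<and>
          ((AE x\<in>einterval c b in lebesgue. p x < 0) \<longrightarrow>
            (wronskian a b p s u0 u1 x0 > 0 \<longrightarrow> no_zero_in (einterval x0 b) u1) \<and>
            (wronskian a b p s u0 u1 x0 < 0 \<longrightarrow> exactly_one_zero_in (einterval x0 b) u1))))"
        unfolding wr0 using pos neg by (meson mult_pos_pos mult_neg_neg mult_pos_neg mult_neg_pos)
    qed
  qed
qed

end
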